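(* Let $$\mathcal W=\bigl(A,\ A^{-1},\ A^2,\ B,\ B^{-1},\ B^2,\ AB,\ AB^{-1},\ A^{-1}B,\ A^{-1}B^{-1},\ A^2B,\ AB^2,\ A^2B^2,\ ABAB^{-1},\ ABA^{-1}B^{-1}\bigr).$$ For each $W\in\mathcal W$, consider the real-valued trace function $[(A,B)]\mapsto\mathrm{tr}(W(A,B))$. Then, on a dense open subset of $\mathcal M^{\mathrm{reg}}_*$, these fifteen trace functions have linearly independent differentials. Consequently, $$\mathcal T:\mathcal M^{\mathrm{reg}}_*\longrightarrow\mathbb R^{15},\qquad [(A,B)]\longmapsto\bigl(\mathrm{tr}(W(A,B))\bigr)_{W\in\mathcal W},$$ is a local real-analytic diffeomorphism.
   Context: $\mathbb H$ denotes the quaternions with standard units $i,j,k$, real part $\mathrm{Re}$ and norm $|\cdot|$; $\mathbb S^2=\{I\in\mathbb H: I^2=-1\}$; $e^{I\theta}=\cos\theta+I\sin\theta$ for $I\in\mathbb S^2$. The Dieudonné determinant of $\left(\begin{smallmatrix}a&b\\c&d\end{smallmatrix}\right)\in\mathrm{GL}(2,\mathbb H)$ is $|ad-aca^{-1}b|$ if $a\neq0$ and $|cb|$ if $a=0$; $\mathrm{SL}(2,\mathbb H)$ is the group of matrices of Dieudonné determinant $1$; $\mathrm{PSL}(2,\mathbb H)=\mathrm{SL}(2,\mathbb H)/\{\pm I\}$. It acts on $\widehat{\mathbb H}=\mathbb H\cup\{\infty\}$ by $z\mapsto(az+b)(cz+d)^{-1}$. For $A=\left(\begin{smallmatrix}a&b\\c&d\end{smallmatrix}\right)$,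 $\mathrm{tr}(A):=\mathrm{Re}(a+d)$, which is invariant under conjugation. $A\in\mathrm{SL}(2,\mathbb H)$ is regular loxodromic if it is conjugate in $\mathrm{SL}(2,\mathbb H)$ to $\mathrm{diag}(re^{I\theta},r^{-1}e^{J\varphi})$ with $r>1$, $\theta,\varphi\in(0,\pi)$, $I,J\in\mathbb S^2$; it then has exactly two fixed points in $\widehat{\mathbb H}$. A regular loxodromic pair is a pair $(A,B)$ of regular loxodromic elements with disjoint fixed point sets. $\mathcal M^{\mathrm{reg}}$ is the set of classes $[(A,B)]$ of regular loxodromic pairs under simultaneous conjugation by $\mathrm{SL}(2,\mathbb H)$, with the quotient topology. Generic locus: $\mathcal M^{\mathrm{reg}}_*\subset\mathcal M^{\mathrm{reg}}$ is the open dense set of classes of pairs simultaneously conjugate to a pair $$A_0=\mathrm{diag}(re^{I\theta},r^{-1}e^{J\varphi}),\quad B_0=P\,\mathrm{diag}(se^{K\theta'},s^{-1}e^{L\varphi'})P^{-1},\quad P=\tfrac1{\sqrt{|1-w|}}\left(\begin{smallmatrix}1&w\\1&1\end{smallmatrix}\right),$$ with $r,s>1$, $\theta,\varphi,\theta',\varphi'\in(0,\pi)$, $I,J,K,L\in\mathbb S^2$, $w=x+yi$ with $x\in\mathbb R$, $y>0$, and $I,J,K,L$ not all contained in $\{i,-i\}$. (These parameters are unique up to simultaneous conjugation of $I,J,K,L$ by unit elements $e^{i\psi}$.) $\mathcal M^{\mathrm{reg}}_*$ is a real-analytic manifold of dimension 15: it is the quotient of this 16-dimensional parameter space by the free action of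 the circle $\{e^{i\psi}\}/\{\pm1\}$; equivalently, the quotient of the open set of corresponding pairs in $\mathrm{SL}(2,\mathbb H)^2$ by the free proper conjugation action of $\mathrm{PSL}(2,\mathbb H)$.
   Formalization: The local real-analytic diffeomorphism claim for T is stated on the dense open subset of the first sentence, not on all of M^reg_*; on all of it the claim is false: at classes of pairs symmetric under a transpose-type anti-automorphism of M_2(H) the fifteen differentials have rank at most 13. *)

theory Defs
  imports "HOL-Analysis.Analysis"
begin

section \<open>Quaternions\<close>

datatype quat = Quat (Re0: real) (Im1: real) (Im2: real) (Im3: real)

lemma quat_eq_iff: "x = y \<longleftrightarrow> Re0 x = Re0 y \<and> Im1 x = Im1 y \<and> Im2 x = Im2 y \<and> Im3 x = Im3 y"
  by (cases x; cases y) auto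

instantiation quat :: ab_group_add
begin

definition "0 = Quat 0 0 0 0"
definition "x + y = Quat (Re0 x + Re0 y) (Im1 x + Im1 y) (Im2 x + Im2 y) (Im3 x + Im3 y)"
definition "- x = Quat (- Re0 x) (- Im1 x) (- Im2 x) (- Im3 x)"
definition "x - y = Quat (Re0 x - Re0 y) (Im1 x - Im1 y) (Im2 x - Im2 y) (Im3 x - Im3 y)"

instance
  by standard (simp_all add: quat_eq_iff zero_quat_def plus_quat_def uminus_quat_def minus_quat_def)

end

lemma quat_additive_sel [simp]:
  "Re0 0 = 0" "Im1 0 = 0" "Im2 0 = 0" "Im3 0 = 0"
  "Re0 (x + y) = Re0 x + Re0 y" "Im1 (x + y) = Im1 x + Im1 y"
  "Im2 (x + y) = Im2 x + Im2 y" "Im3 (x + y) = Im3 x + Im3 y"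
  "Re0 (- x) = - Re0 x" "Im1 (- x) = - Im1 x" "Im2 (- x) = - Im2 x" "Im3 (- x) = - Im3 x"
  "Re0 (x - y) = Re0 x - Re0 y" "Im1 (x - y) = Im1 x - Im1 y"
  "Im2 (x - y) = Im2 x - Im2 y" "Im3 (x - y) = Im3 x - Im3 y"
  by (simp_all add: zero_quat_def plus_quat_def uminus_quat_def minus_quat_def)

instantiation quat :: ring_1
begin

definition "1 = Quat 1 0 0 0"
definition "x * y = Quat
  (Re0 x * Re0 y - Im1 x * Im1 y - Im2 x * Im2 y - Im3 x * Im3 y)
  (Re0 x * Im1 y + Im1 x * Re0 y + Im2 x * Im3 y - Im3 x * Im2 y)
  (Re0 x * Im2 y - Im1 x * Im3 y + Im2 x * Re0 y + Im3 x * Im1 y)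
  (Re0 x * Im3 y + Im1 x * Im2 y - Im2 x * Im1 y + Im3 x * Re0 y)"

instance
  by standard (simp_all add: quat_eq_iff one_quat_def times_quat_def algebra_simps)

end

lemma quat_mult_sel [simp]:
  "Re0 1 = 1" "Im1 1 = 0" "Im2 1 = 0" "Im3 1 = 0"
  "Re0 (x * y) = Re0 x * Re0 y - Im1 x * Im1 y - Im2 x * Im2 y - Im3 x * Im3 y"
  "Im1 (x * y) = Re0 x * Im1 y + Im1 x * Re0 y + Im2 x * Im3 y - Im3 x * Im2 y"
  "Im2 (x * y) = Re0 x * Im2 y - Im1 x * Im3 y + Im2 x * Re0 y + Im3 x * Im1 y"
  "Im3 (x * y) = Re0 x * Im3 y + Im1 x * Im2 y - Im2 x * Im1 y + Im3 x * Re0 y"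
  by (simp_all add: one_quat_def times_quat_def)

instantiation quat :: real_algebra_1
begin

definition "a *\<^sub>R x = Quat (a * Re0 x) (a * Im1 x) (a * Im2 x) (a * Im3 x)"

instance
  by standard (simp_all add: quat_eq_iff scaleR_quat_def algebra_simps)

end

lemma quat_scaleR_sel [simp]:
  "Re0 (a *\<^sub>R x) = a * Re0 x" "Im1 (a *\<^sub>R x) = a * Im1 x"
  "Im2 (a *\<^sub>R x) = a * Im2 x" "Im3 (a *\<^sub>R x) = a * Im3 x"
  by (simp_all add: scaleR_quat_def)

lemma quat_of_real_sel [simp]:
  "Re0 (of_real a) = a" "Im1 (of_real a) = 0" "Im2 (of_real a) = 0" "Im3 (of_real a) = 0"
  by (simp_all add: of_real_def)

definition quat_cnj :: "quat \<Rightarrow> quat"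
  where "quat_cnj x = Quat (Re0 x) (- Im1 x) (- Im2 x) (- Im3 x)"

instantiation quat :: real_inner
begin

definition "inner x y = Re0 x * Re0 y + Im1 x * Im1 y + Im2 x * Im2 y + Im3 x * Im3 y"
definition "norm (x::quat) = sqrt (inner x x)"
definition "sgn (x::quat) = x /\<^sub>R norm x"
definition "dist (x::quat) y = norm (x - y)"
definition "(uniformity :: (quat \<times> quat) filter) = (INF e\<in>{0 <..}. principal {(x, y). dist x y < e})"
definition "open (U :: quat set) \<longleftrightarrow> (\<forall>x\<in>U. eventually (\<lambda>(x', y). x' = x \<longrightarrow> y \<in> U) uniformity)"

instance
proof
  fix x y z :: quat and r :: real
  show "inner x y = inner y x"
    by (simp add: inner_quat_def mult.commute)
  show "inner (x + y) z = inner x z + inner y z"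
    by (simp add: inner_quat_def algebra_simps)
  show "inner (r *\<^sub>R x) y = r * inner x y"
    by (simp add: inner_quat_def algebra_simps)
  show "0 \<le> inner x x"
    by (simp add: inner_quat_def)
  show "inner x x = 0 \<longleftrightarrow> x = 0"
    by (auto simp: inner_quat_def quat_eq_iff add_nonneg_eq_0_iff)
qed (rule norm_quat_def sgn_quat_def dist_quat_def uniformity_quat_def open_quat_def)+

end

lemma quat_norm_sq: "(norm x)\<^sup>2 = (Re0 x)\<^sup>2 + (Im1 x)\<^sup>2 + (Im2 x)\<^sup>2 + (Im3 x)\<^sup>2"
  unfolding power2_norm_eq_inner by (simp add: inner_quat_def power2_eq_square)

lemma four_squares_mult:
  fixes a b c d e f g h :: real
  shows "(a*e - b*f - c*g - d*h)\<^sup>2 + (a*f + b*e + c*h - d*g)\<^sup>2 + (a*g - b*h + c*e + d*f)\<^sup>2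
    + (a*h + b*g - c*f + d*e)\<^sup>2
    = (a\<^sup>2 + b\<^sup>2 + c\<^sup>2 + d\<^sup>2) * (e\<^sup>2 + f\<^sup>2 + g\<^sup>2 + h\<^sup>2)"
  unfolding power2_eq_square ring_distribs left_diff_distrib right_diff_distrib by (simp add: ac_simps)

instantiation quat :: real_normed_div_algebra
begin

definition "inverse x = quat_cnj x /\<^sub>R (norm x)\<^sup>2"
definition "x div y = x * inverse y" for x y :: quat

instance
proof
  fix x y :: quat
  have l: "quat_cnj z * z = of_real ((norm z)\<^sup>2)" "z * quat_cnj z = of_real ((norm z)\<^sup>2)" for z
    unfolding quat_norm_sq by (simp_all add: quat_eq_iff quat_cnj_def power2_eq_square)
  show "inverse x * x = 1" "x * inverse x = 1" if "x \<noteq> 0"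
    using that by (simp_all add: inverse_quat_def l of_real_def)
  show "x div y = x * inverse y"
    by (rule divide_quat_def)
  show "inverse (0::quat) = 0"
    by (simp add: inverse_quat_def)
  have "(norm (x * y))\<^sup>2 = (norm x * norm y)\<^sup>2"
    unfolding power_mult_distrib quat_norm_sq quat_mult_sel by (rule four_squares_mult)
  then show "norm (x * y) = norm x * norm y"
    by simp
qed

end

definition quat_i :: quat where "quat_i = Quat 0 1 0 0"
definition quat_j :: quat where "quat_j = Quat 0 0 1 0"
definition quat_k :: quat where "quat_k = Quat 0 0 0 1"

instantiation quat :: euclidean_space
begin

definition "Basis = {1, quat_i, quat_j, quat_k}"

instance
proof
  note defs = Basis_quat_def one_quat_def quat_i_def quat_j_def quat_k_def
  show "(Basis :: quat set) \<noteq> {}" "finite (Basis :: quat set)"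
    by (simp_all add: Basis_quat_def)
  show "inner u v = (if u = v then 1 else 0)" if "u \<in> Basis" "v \<in> Basis" for u v :: quat
    using that unfolding defs inner_quat_def by (elim insertE emptyE) simp_all
  show "(\<forall>u\<in>Basis. inner x u = 0) \<longleftrightarrow> x = 0" for x :: quat
    unfolding defs inner_quat_def quat_eq_iff by simp
qed

end

definition imag_units :: "quat set"  (\<open>\<S>\<^sup>2\<close>)
  where "\<S>\<^sup>2 = {I. I * I = - 1}"

definition quat_cis :: "quat \<Rightarrow> real \<Rightarrow> quat"
  where "quat_cis I \<theta> = of_real (cos \<theta>) + I * of_real (sin \<theta>)"


section \<open>The group SL(2,H) and its action\<close>

type_synonym mat2 = "quat^2^2"

definition mat2 :: "quat \<Rightarrow> quat \<Rightarrow> quat \<Rightarrow> quat \<Rightarrow> mat2"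
  where "mat2 a b c d = vector [vector [a, b], vector [c, d]]"

definition dieudonne_det :: "mat2 \<Rightarrow> real"
  where "dieudonne_det A =
    (let a = A$1$1; b = A$1$2; c = A$2$1; d = A$2$2
     in if a \<noteq> 0 then norm (a * d - a * c * inverse a * b) else norm (c * b))"

definition SL2H :: "mat2 set"
  where "SL2H = {A. invertible A \<and> dieudonne_det A = 1}"

definition tr2 :: "mat2 \<Rightarrow> real"
  where "tr2 A = Re0 (A$1$1 + A$2$2)"

text \<open>The one-point compactification of the quaternions is modelled by \<^typ>\<open>quat option\<close>,
  with \<^const>\<open>None\<close> as the point at infinity.\<close>

definition moebius :: "mat2 \<Rightarrow> quat option \<Rightarrow> quat option"
  where "moebius A p =
    (let a = A$1$1; b = A$1$2; c = A$2$1; d = A$2$2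
     in case p of
          Some z \<Rightarrow> if c * z + d = 0 then None else Some ((a * z + b) * inverse (c * z + d))
        | None \<Rightarrow> if c = 0 then None else Some (a * inverse c))"

definition fixed_points :: "mat2 \<Rightarrow> quat option set"
  where "fixed_points A = {p. moebius A p = p}"

definition conj_by :: "mat2 \<Rightarrow> mat2 \<Rightarrow> mat2"
  where "conj_by P A = P ** A ** matrix_inv P"


section \<open>Regular loxodromic pairs and their moduli space\<close>

definition lox_diag :: "real \<Rightarrow> quat \<Rightarrow> real \<Rightarrow> quat \<Rightarrow> real \<Rightarrow> mat2"
  where "lox_diag r I \<theta> J \<phi> = mat2 (of_real r * quat_cis I \<theta>) 0 0 (of_real (inverse r) * quat_cis J \<phi>)"

definition regular_loxodromic :: "mat2 \<Rightarrow> bool"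
  where "regular_loxodromic A \<longleftrightarrow> A \<in> SL2H \<and>
    (\<exists>P\<in>SL2H. \<exists>r>1. \<exists>\<theta>\<in>{0<..<pi}. \<exists>\<phi>\<in>{0<..<pi}. \<exists>I\<in>\<S>\<^sup>2. \<exists>J\<in>\<S>\<^sup>2.
       A = conj_by P (lox_diag r I \<theta> J \<phi>))"

type_synonym mpair = "mat2 \<times> mat2"

definition regular_pairs :: "mpair set"
  where "regular_pairs = {(A, B). regular_loxodromic A \<and> regular_loxodromic B \<and>
    fixed_points A \<inter> fixed_points B = {}}"

definition pair_class :: "mpair \<Rightarrow> mpair set"
  where "pair_class p = {(conj_by P (fst p), conj_by P (snd p)) | P. P \<in> SL2H}"

definition Mreg :: "mpair set set"
  where "Mreg = pair_class ` regular_pairs"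

definition Mreg_top :: "mpair set topology"
  where "Mreg_top = topology (\<lambda>U. U \<subseteq> Mreg \<and>
    openin (top_of_set regular_pairs) {p \<in> regular_pairs. pair_class p \<in> U})"

lemma openin_Mreg_top:
  "openin Mreg_top U \<longleftrightarrow> U \<subseteq> Mreg \<and>
    openin (top_of_set regular_pairs) {p \<in> regular_pairs. pair_class p \<in> U}"
proof -
  let ?R = "top_of_set regular_pairs"
  let ?pre = "\<lambda>U. {p \<in> regular_pairs. pair_class p \<in> U}"
  have "istopology (\<lambda>U. U \<subseteq> Mreg \<and> openin ?R (?pre U))"
    unfolding istopology_def
  proof (intro conjI allI impI)
    fix S T assume "S \<subseteq> Mreg \<and> openin ?R (?pre S)" "T \<subseteq> Mreg \<and> openin ?R (?pre T)"
    moreover have "?pre (S \<inter> T) = ?pre S \<inter> ?pre T" by auto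
    ultimately show "S \<inter> T \<subseteq> Mreg" "openin ?R (?pre (S \<inter> T))"
      by (auto simp only: intro: openin_Int)
  next
    fix K assume K: "\<forall>S\<in>K. S \<subseteq> Mreg \<and> openin ?R (?pre S)"
    then show "\<Union>K \<subseteq> Mreg" by blast
    have "?pre (\<Union>K) = \<Union> (?pre ` K)" by auto
    moreover have "openin ?R (\<Union> (?pre ` K))"
      using K by (intro openin_Union) auto
    ultimately show "openin ?R (?pre (\<Union>K))" by simp
  qed
  then show ?thesis
    unfolding Mreg_top_def by simp
qed

lemma topspace_Mreg_top [simp]: "topspace Mreg_top = Mreg"
proof -
  have "{p \<in> regular_pairs. pair_class p \<in> Mreg} = regular_pairs"
    by (auto simp: Mreg_def)
  then have "openin Mreg_top Mreg"
    by (simp add: openin_Mreg_top)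
  then show ?thesis
    by (meson openin_Mreg_top openin_subset openin_topspace subset_antisym)
qed

lemma quotient_map_pair_class: "quotient_map (top_of_set regular_pairs) Mreg_top pair_class"
  by (simp add: quotient_map_def openin_Mreg_top) (simp add: Mreg_def)

definition fix_matrix :: "quat \<Rightarrow> mat2"
  where "fix_matrix w = (1 / sqrt (norm (1 - w))) *\<^sub>R mat2 1 w 1 1"

definition normal_pairs :: "mpair set"
  where "normal_pairs = {(lox_diag r I \<theta> J \<phi>, conj_by (fix_matrix w) (lox_diag s K \<theta>' L \<phi>'))
    | r s \<theta> \<phi> \<theta>' \<phi>' I J K L w x y.
      r > 1 \<and> s > 1 \<and> {\<theta>, \<phi>, \<theta>', \<phi>'} \<subseteq> {0<..<pi} \<and>
      {I, J, K, L} \<subseteq> \<S>\<^sup>2 \<and> \<not> {I, J, K, L} \<subseteq> {quat_i, - quat_i} \<and>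
      w = of_real x + of_real y * quat_i \<and> y > 0}"

definition Mreg_star :: "mpair set set"
  where "Mreg_star = {pair_class p | p. p \<in> regular_pairs \<and> pair_class p \<inter> normal_pairs \<noteq> {}}"

definition Mreg_star_top :: "mpair set topology"
  where "Mreg_star_top = subtopology Mreg_top Mreg_star"


section \<open>Real-analytic structure\<close>

text \<open>Expansion into a convergent power series in the coordinates of the Euclidean space. A
  multi-index is a function from the basis to the natural numbers.\<close>

definition real_analytic_at :: "('a::euclidean_space \<Rightarrow> 'b::real_normed_vector) \<Rightarrow> 'a \<Rightarrow> bool"
  where "real_analytic_at f x \<longleftrightarrow> (\<exists>\<delta>>0. \<exists>c. \<forall>y\<in>ball x \<delta>.
    ((\<lambda>\<alpha>. (\<Prod>b\<in>Basis. ((y - x) \<bullet> b) ^ \<alpha> b) *\<^sub>R c \<alpha>) has_sum f y) (Basis \<rightarrow>\<^sub>E (UNIV :: nat set)))"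

text \<open>For an open set \<open>S\<close> this is real-analyticity on \<open>S\<close>; for an embedded analytic
  submanifold it is analyticity for the induced structure.\<close>

definition real_analytic_on :: "('a::euclidean_space \<Rightarrow> 'b::real_normed_vector) \<Rightarrow> 'a set \<Rightarrow> bool"
  where "real_analytic_on f S \<longleftrightarrow> (\<forall>x\<in>S. \<exists>N g. open N \<and> x \<in> N \<and>
    (\<forall>y\<in>N. real_analytic_at g y) \<and> (\<forall>y\<in>N \<inter> S. g y = f y))"

text \<open>The pairs lying over \<^const>\<open>Mreg_star\<close> form an open subset of the analytic submanifold
  \<open>SL2H \<times> SL2H\<close> of the vector space of pairs of matrices, and the structure on \<^const>\<open>Mreg_star\<close> is
  that of the quotient by the free proper conjugation action. So \<^const>\<open>pair_class\<close> is an analytic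
  submersion there: a map defined on an open part of the quotient is analytic iff its composition
  with \<^const>\<open>pair_class\<close> is, and a map into the quotient is analytic iff it lifts locally to an
  analytic map into the pairs. The predicate below therefore says that \<open>\<phi>\<close> restricts to an analytic
  diffeomorphism from the open set \<open>U\<close> onto an open subset of 15-dimensional space, i.e. that
  \<open>(U, \<phi>)\<close> belongs to the maximal analytic atlas.\<close>

definition analytic_chart :: "mpair set set \<Rightarrow> (mpair set \<Rightarrow> real^15) \<Rightarrow> bool"
  where "analytic_chart U \<phi> \<longleftrightarrow>
    openin Mreg_star_top U \<and> inj_on \<phi> U \<and> open (\<phi> ` U) \<and>
    real_analytic_on (\<lambda>p. \<phi> (pair_class p)) {p \<in> regular_pairs. pair_class p \<in> U} \<and>
    (\<forall>y\<in>\<phi> ` U. \<exists>V \<sigma>. open V \<and> y \<in> V \<and> V \<subseteq> \<phi> ` U \<and> real_analytic_on \<sigma> V \<and>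
       (\<forall>z\<in>V. \<sigma> z \<in> regular_pairs \<and> pair_class (\<sigma> z) = inv_into U \<phi> z))"

definition local_analytic_diffeo_at :: "(mpair set \<Rightarrow> real^15) \<Rightarrow> mpair set \<Rightarrow> bool"
  where "local_analytic_diffeo_at F m \<longleftrightarrow> (\<exists>U. m \<in> U \<and> analytic_chart U F)"

text \<open>Linear independence at \<open>m\<close> of the differentials of a list of real functions on
  \<^const>\<open>Mreg_star\<close>, the differentials being computed in a chart around \<open>m\<close>. The condition does not
  depend on the chart; it is required in every chart, together with the existence of one.\<close>

definition independent_differentials_at :: "(mpair set \<Rightarrow> real) list \<Rightarrow> mpair set \<Rightarrow> bool"
  where "independent_differentials_at fs m \<longleftrightarrow>
    (\<exists>U \<phi>. m \<in> U \<and> analytic_chart U \<phi>) \<and>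
    (\<forall>U \<phi>. m \<in> U \<and> analytic_chart U \<phi> \<longrightarrow>
      (\<exists>D. (\<forall>n<length fs. ((\<lambda>y. (fs ! n) (inv_into U \<phi> y)) has_derivative D n) (at (\<phi> m))) \<and>
           (\<forall>c :: nat \<Rightarrow> real. (\<forall>v. (\<Sum>n<length fs. c n * D n v) = 0) \<longrightarrow> (\<forall>n<length fs. c n = 0))))"


section \<open>The trace functions\<close>

definition trace_words :: "(mat2 \<Rightarrow> mat2 \<Rightarrow> mat2) list"
  where "trace_words =
   [\<lambda>A B. A,
    \<lambda>A B. matrix_inv A,
    \<lambda>A B. A ** A,
    \<lambda>A B. B,
    \<lambda>A B. matrix_inv B,
    \<lambda>A B. B ** B,
    \<lambda>A B. A ** B,
    \<lambda>A B. A ** matrix_inv B,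
    \<lambda>A B. matrix_inv A ** B,
    \<lambda>A B. matrix_inv A ** matrix_inv B,
    \<lambda>A B. A ** A ** B,
    \<lambda>A B. A ** B ** B,
    \<lambda>A B. A ** A ** B ** B,
    \<lambda>A B. A ** B ** A ** matrix_inv B,
    \<lambda>A B. A ** B ** matrix_inv A ** matrix_inv B]"

text \<open>The trace of a word does not depend on the representative; see \<open>trace_fun_pair_class\<close>.\<close>

definition trace_fun :: "(mat2 \<Rightarrow> mat2 \<Rightarrow> mat2) \<Rightarrow> mpair set \<Rightarrow> real"
  where "trace_fun W m = (let (A, B) = (SOME p. p \<in> m) in tr2 (W A B))"

definition trace_map :: "mpair set \<Rightarrow> real^15"
  where "trace_map m = vector (map (\<lambda>W. trace_fun W m) trace_words)"

lemma matrix_inv_cancel: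
  fixes P :: mat2
  assumes "invertible P"
  shows "P ** matrix_inv P = mat 1" "matrix_inv P ** P = mat 1"
  using someI_ex [OF assms [unfolded invertible_def]] unfolding matrix_inv_def by auto

lemma matrix_inv_eqI:
  fixes P Q :: mat2
  assumes "P ** Q = mat 1" "Q ** P = mat 1"
  shows "matrix_inv P = Q"
proof -
  have P: "invertible P"
    using assms by (auto simp: invertible_def)
  have "matrix_inv P = matrix_inv P ** (P ** Q)"
    by (simp add: assms)
  also have "\<dots> = Q"
    by (simp add: matrix_mul_assoc matrix_inv_cancel [OF P])
  finally show ?thesis .
qed

lemma conj_by_mult:
  assumes "invertible P"
  shows "conj_by P A ** conj_by P B = conj_by P (A ** B)"
proof -
  have "conj_by P A ** conj_by P B = P ** A ** (matrix_inv P ** P) ** B ** matrix_inv P"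
    by (simp add: conj_by_def matrix_mul_assoc)
  then show ?thesis
    by (simp add: conj_by_def matrix_inv_cancel [OF assms] matrix_mul_assoc)
qed

lemma conj_by_inv:
  assumes "invertible P" "invertible A"
  shows "matrix_inv (conj_by P A) = conj_by P (matrix_inv A)"
  by (rule matrix_inv_eqI)
    (simp_all add: conj_by_mult assms matrix_inv_cancel, simp_all add: conj_by_def assms matrix_inv_cancel)

lemma tr2_commute: "tr2 (A ** B) = tr2 (B ** A)"
  by (simp add: tr2_def matrix_matrix_mult_def sum_2 algebra_simps)

lemma tr2_conj_by:
  assumes "invertible P"
  shows "tr2 (conj_by P A) = tr2 A"
proof -
  have "tr2 (conj_by P A) = tr2 (matrix_inv P ** (P ** A))"
    unfolding conj_by_def by (rule tr2_commute)
  then show ?thesis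
    by (simp add: matrix_mul_assoc matrix_inv_cancel [OF assms])
qed

lemma trace_fun_pair_class:
  assumes W: "W \<in> set trace_words" and inv: "invertible A" "invertible B"
  shows "trace_fun W (pair_class (A, B)) = tr2 (W A B)"
proof -
  have "invertible (mat 1 :: mat2)"
    by (auto simp: invertible_def intro!: exI [of _ "mat 1"])
  moreover have "dieudonne_det (mat 1) = 1"
    by (simp add: dieudonne_det_def mat_def)
  ultimately have "mat 1 \<in> SL2H"
    by (simp add: SL2H_def)
  then have "pair_class (A, B) \<noteq> {}"
    by (auto simp: pair_class_def)
  then have "(SOME p. p \<in> pair_class (A, B)) \<in> pair_class (A, B)"
    by (rule some_in_eq [THEN iffD2])
  then obtain P where P: "invertible P"
    and eq: "(SOME p. p \<in> pair_class (A, B)) = (conj_by P A, conj_by P B)"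
    by (auto simp: pair_class_def SL2H_def)
  have "W (conj_by P A) (conj_by P B) = conj_by P (W A B)"
    using W inv P by (auto simp: trace_words_def conj_by_mult conj_by_inv)
  then show ?thesis
    by (simp add: trace_fun_def eq tr2_conj_by [OF P])
qed

end

theory Submission
  imports Defs
begin

text \<open>Replacing inverses by adjugates turns the fifteen traces into polynomials in the entries of a pair of
arbitrary matrices; together with the squares of the two Dieudonne determinants they form a polynomial
map \<open>ext_trace\<close> from a space of dimension 32 to one of dimension 17 that is invariant under conjugation.
Pairs in \<open>SL(2,H)\<close> are the points at which the last two components equal 1.

Suppose that the derivative of \<open>ext_trace\<close> at a normal pair \<open>p\<close> is onto. A matrix commuting with both
members of \<open>p\<close> is a real scalar (\<open>normal_pair_centraliser\<close>), so the conjugation orbit of \<open>p\<close> has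
dimension 15, and it lies in a level set of \<open>ext_trace\<close>. As 15 + 17 = 32, an affine slice through \<open>p\<close> on
which the derivative of \<open>ext_trace\<close> is invertible is transversal to the orbit, and the conjugates of its
points fill a neighbourhood of \<open>p\<close> (\<open>conj_slice_open\<close>). On the slice an analytic inverse function
theorem (\<open>analytic_right_inverse\<close>) produces the pair with prescribed traces and determinants 1. Thus the
traces determine the class of a pair near \<open>p\<close>, and they come with an analytic section: they are a chart
(\<open>normal_pair_chart\<close>). In any other chart the differentials of the coordinates of this chart are
independent, by the chain rule (\<open>chart_independent_differentials\<close>).

The derivative is onto at one explicit pair (\<open>ref_surj\<close>). Join an arbitrary normal pair to it by a
polynomial path. A suitable maximal minor of the derivative is a polynomial along this path that does not
vanish at its end, so it is nonzero at all parameters close to, but different from, the start. The path leaves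
\<open>SL(2,H)\<close>, but \<open>ext_trace\<close> is homogeneous in each matrix, so that its points can be rescaled
into it. Hence the normal pairs with surjective derivative are dense (\<open>normal_pair_dense\<close>). Every pair
in \<open>SL(2,H)\<close> that is close to a normal pair is conjugate to a normal pair, so that the charts lie
in \<open>Mreg_star\<close>; this is shown by diagonalising both of its members (\<open>normal_pair_open\<close>).

Analyticity means here expansion into a power series. The inverse function theorem is therefore proved by a
contraction argument inside the algebra of power series of a fixed radius, normed by the weighted sum of the
absolute values of the coefficients.\<close>

section \<open>Power series with an absolute norm\<close>

abbreviation multi_indices :: "('a::euclidean_space \<Rightarrow> nat) set"
  where "multi_indices \<equiv> Basis \<rightarrow>\<^sub>E UNIV"

definition monomial_at :: "'a::euclidean_space \<Rightarrow> ('a \<Rightarrow> nat) \<Rightarrow> 'a \<Rightarrow> real"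
  where "monomial_at x \<alpha> y = (\<Prod>b\<in>Basis. ((y - x) \<bullet> b) ^ \<alpha> b)"

definition multi_degree :: "('a::euclidean_space \<Rightarrow> nat) \<Rightarrow> nat"
  where "multi_degree \<alpha> = sum \<alpha> Basis"

text \<open>The norm is the sum of the absolute values of the coefficients weighted by \<open>\<rho>\<close> to the degree. It is
submultiplicative and complete. The supremum of \<open>f\<close> on the ball would not do: uniform limits of
power series in real variables need not be analytic.\<close>

definition pow_series :: "'a::euclidean_space \<Rightarrow> real \<Rightarrow> real \<Rightarrow> ('a \<Rightarrow> real) \<Rightarrow> bool"
  where "pow_series x \<rho> M f \<longleftrightarrow> (\<exists>c N.
    ((\<lambda>\<alpha>. \<bar>c \<alpha>\<bar> * \<rho> ^ multi_degree \<alpha>) has_sum N) multi_indices \<and> N \<le> M \<and>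
    (\<forall>y\<in>ball x \<rho>. ((\<lambda>\<alpha>. c \<alpha> * monomial_at x \<alpha> y) has_sum f y) multi_indices))"

lemma abs_monomial_at_le:
  assumes "norm (y - x) \<le> \<rho>"
  shows "\<bar>monomial_at x \<alpha> y\<bar> \<le> \<rho> ^ multi_degree \<alpha>"
proof -
  have "\<bar>monomial_at x \<alpha> y\<bar> = (\<Prod>b\<in>Basis. \<bar>(y - x) \<bullet> b\<bar> ^ \<alpha> b)"
    by (simp add: monomial_at_def abs_prod power_abs)
  also have "\<dots> \<le> (\<Prod>b\<in>Basis. \<rho> ^ \<alpha> b)"
  proof (rule prod_mono)
    fix b :: 'a assume "b \<in> Basis"
    then have "\<bar>(y - x) \<bullet> b\<bar> \<le> norm (y - x)"
      by (rule Basis_le_norm)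
    also have "\<dots> \<le> \<rho>"
      by (rule assms)
    finally show "0 \<le> \<bar>(y - x) \<bullet> b\<bar> ^ \<alpha> b \<and> \<bar>(y - x) \<bullet> b\<bar> ^ \<alpha> b \<le> \<rho> ^ \<alpha> b"
      by (simp add: power_mono)
  qed
  also have "\<dots> = \<rho> ^ multi_degree \<alpha>"
    by (simp add: multi_degree_def power_sum)
  finally show ?thesis .
qed

lemma norm_le_of_mem_ball: "y \<in> ball x \<rho> \<Longrightarrow> norm (y - x) \<le> \<rho>"
  by (simp add: dist_norm norm_minus_commute)

lemma pow_seriesI:
  assumes "0 < \<rho>" "(g has_sum N) multi_indices" "N \<le> M"
    and "\<And>\<alpha>. \<alpha> \<in> multi_indices \<Longrightarrow> \<bar>c \<alpha>\<bar> * \<rho> ^ multi_degree \<alpha> \<le> g \<alpha>"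
    and "\<And>y. y \<in> ball x \<rho> \<Longrightarrow> ((\<lambda>\<alpha>. c \<alpha> * monomial_at x \<alpha> y) has_sum f y) multi_indices"
  shows "pow_series x \<rho> M f"
proof -
  have nonneg: "0 \<le> \<bar>c \<alpha>\<bar> * \<rho> ^ multi_degree \<alpha>" for \<alpha>
    using assms(1) by simp
  have s: "(\<lambda>\<alpha>. \<bar>c \<alpha>\<bar> * \<rho> ^ multi_degree \<alpha>) summable_on multi_indices"
    by (rule summable_on_comparison_test [OF has_sum_imp_summable [OF assms(2)] assms(4) nonneg])
  from has_sum_mono [OF has_sum_infsum [OF s] assms(2,4)]
  have le: "(\<Sum>\<^sub>\<infinity>\<alpha>\<in>multi_indices. \<bar>c \<alpha>\<bar> * \<rho> ^ multi_degree \<alpha>) \<le> M"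
    using assms(3) by linarith
  show ?thesis
    unfolding pow_series_def
    by (rule exI [of _ c], rule exI, rule conjI, rule has_sum_infsum [OF s]) (use le assms(5) in auto)
qed

text \<open>Products and iterated sums of power series are families of monomials with repeated exponents.
Collecting equal exponents does not increase the norm; absolute convergence justifies the rearrangement.\<close>

lemma pow_series_regroup:
  assumes \<rho>: "0 < \<rho>" and N: "((\<lambda>i. \<bar>c i\<bar> * \<rho> ^ multi_degree (a i)) has_sum N) I" "N \<le> M"
    and a: "\<And>i. i \<in> I \<Longrightarrow> a i \<in> multi_indices"
    and f: "\<And>y. y \<in> ball x \<rho> \<Longrightarrow> ((\<lambda>i. c i * monomial_at x (a i) y) has_sum f y) I"
  shows "pow_series x \<rho> M f"
proof -
  define S where "S \<gamma> = {i \<in> I. a i = \<gamma>}" for \<gamma>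
  define C where "C \<gamma> = infsum c (S \<gamma>)" for \<gamma>
  have bij: "bij_betw (\<lambda>i. (a i, i)) I (Sigma multi_indices S)"
    using a by (auto simp: S_def bij_betw_def inj_on_def image_iff)
  have abs: "(\<lambda>i. \<bar>c i\<bar>) summable_on S \<gamma>" if "\<gamma> \<in> multi_indices" for \<gamma>
  proof -
    have "(\<lambda>i. \<bar>c i\<bar> * \<rho> ^ multi_degree (a i)) summable_on S \<gamma>"
      by (rule summable_on_subset_banach [OF has_sum_imp_summable [OF N(1)]]) (auto simp: S_def)
    also have "?this \<longleftrightarrow> (\<lambda>i. \<bar>c i\<bar> * \<rho> ^ multi_degree \<gamma>) summable_on S \<gamma>"
      by (rule summable_on_cong) (simp add: S_def)
    finally show ?thesis
      using \<rho> by (simp add: summable_on_cmult_left')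
  qed
  have sC: "(c has_sum C \<gamma>) (S \<gamma>)" if "\<gamma> \<in> multi_indices" for \<gamma>
    unfolding C_def
    by (rule has_sum_infsum, subst summable_on_iff_abs_summable_on_real) (simp add: abs that)
  define g where "g \<gamma> = (\<Sum>\<^sub>\<infinity>i\<in>S \<gamma>. \<bar>c i\<bar>) * \<rho> ^ multi_degree \<gamma>" for \<gamma>
  show ?thesis
  proof (rule pow_seriesI [OF \<rho> _ N(2)])
    have "((\<lambda>(\<gamma>, i). \<bar>c i\<bar> * \<rho> ^ multi_degree (a i)) has_sum N) (Sigma multi_indices S)"
      using has_sum_reindex_bij_betw [OF bij, of "\<lambda>(\<gamma>, i). \<bar>c i\<bar> * \<rho> ^ multi_degree (a i)"] N(1) by simp
    then show "(g has_sum N) multi_indices"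
    proof (rule has_sum_SigmaD)
      fix \<gamma> :: "'b \<Rightarrow> nat" assume "\<gamma> \<in> multi_indices"
      then have "((\<lambda>i. \<bar>c i\<bar> * \<rho> ^ multi_degree \<gamma>) has_sum g \<gamma>) (S \<gamma>)"
        unfolding g_def by (intro has_sum_cmult_left has_sum_infsum abs)
      then show "((\<lambda>i. case (\<gamma>, i) of (\<gamma>, i) \<Rightarrow> \<bar>c i\<bar> * \<rho> ^ multi_degree (a i)) has_sum g \<gamma>) (S \<gamma>)"
        by (rule has_sum_cong [THEN iffD1, rotated]) (simp add: S_def)
    qed
    show "\<bar>C \<gamma>\<bar> * \<rho> ^ multi_degree \<gamma> \<le> g \<gamma>" if "\<gamma> \<in> multi_indices" for \<gamma>
      unfolding g_def C_def using norm_infsum_bound [of c "S \<gamma>"] abs [OF that] \<rho>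
      by (intro mult_right_mono) auto
    fix y assume y: "y \<in> ball x \<rho>"
    have "((\<lambda>(\<gamma>, i). c i * monomial_at x (a i) y) has_sum f y) (Sigma multi_indices S)"
      using has_sum_reindex_bij_betw [OF bij, of "\<lambda>(\<gamma>, i). c i * monomial_at x (a i) y"] f [OF y] by simp
    then show "((\<lambda>\<gamma>. C \<gamma> * monomial_at x \<gamma> y) has_sum f y) multi_indices"
    proof (rule has_sum_SigmaD)
      fix \<gamma> :: "'b \<Rightarrow> nat" assume "\<gamma> \<in> multi_indices"
      then have "((\<lambda>i. c i * monomial_at x \<gamma> y) has_sum C \<gamma> * monomial_at x \<gamma> y) (S \<gamma>)"
        by (intro has_sum_cmult_left sC)
      then show "((\<lambda>i. case (\<gamma>, i) of (\<gamma>, i) \<Rightarrow> c i * monomial_at x (a i) y) has_sum C \<gamma> * monomial_at x \<gamma> y) (S \<gamma>)"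
        by (rule has_sum_cong [THEN iffD1, rotated]) (simp add: S_def)
    qed
  qed
qed

lemma pow_seriesE:
  assumes "pow_series x \<rho> M f"
  obtains c N where "((\<lambda>\<alpha>. \<bar>c \<alpha>\<bar> * \<rho> ^ multi_degree \<alpha>) has_sum N) multi_indices" "N \<le> M"
    "\<And>y. y \<in> ball x \<rho> \<Longrightarrow> ((\<lambda>\<alpha>. c \<alpha> * monomial_at x \<alpha> y) has_sum f y) multi_indices"
  using assms unfolding pow_series_def by blast

lemma pow_series_mono:
  assumes "pow_series x \<rho> M f" "M \<le> M'"
  shows "pow_series x \<rho> M' f"
proof (rule pow_seriesE [OF assms(1)])
  fix c N
  assume c: "((\<lambda>\<alpha>. \<bar>c \<alpha>\<bar> * \<rho> ^ multi_degree \<alpha>) has_sum N) multi_indices" "N \<le> M"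
    "\<And>y. y \<in> ball x \<rho> \<Longrightarrow> ((\<lambda>\<alpha>. c \<alpha> * monomial_at x \<alpha> y) has_sum f y) multi_indices"
  show ?thesis
    unfolding pow_series_def
    by (rule exI [of _ c], rule exI [of _ N]) (use c assms(2) in simp)
qed

lemma pow_series_cong:
  assumes "pow_series x \<rho> M f" "\<And>y. y \<in> ball x \<rho> \<Longrightarrow> g y = f y"
  shows "pow_series x \<rho> M g"
proof (rule pow_seriesE [OF assms(1)])
  fix c N
  assume c: "((\<lambda>\<alpha>. \<bar>c \<alpha>\<bar> * \<rho> ^ multi_degree \<alpha>) has_sum N) multi_indices" "N \<le> M"
    "\<And>y. y \<in> ball x \<rho> \<Longrightarrow> ((\<lambda>\<alpha>. c \<alpha> * monomial_at x \<alpha> y) has_sum f y) multi_indices"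
  show ?thesis
    unfolding pow_series_def
    by (rule exI [of _ c], rule exI [of _ N]) (use c assms(2) in simp)
qed

lemma pow_series_single:
  assumes "0 < \<rho>" "\<alpha> \<in> multi_indices"
  shows "pow_series x \<rho> (\<bar>k\<bar> * \<rho> ^ multi_degree \<alpha>) (\<lambda>y. k * monomial_at x \<alpha> y)"
proof (rule pow_series_regroup [where I = "{()}" and c = "\<lambda>_. k" and a = "\<lambda>_. \<alpha>"])
  show "((\<lambda>_. \<bar>k\<bar> * \<rho> ^ multi_degree \<alpha>) has_sum \<bar>k\<bar> * \<rho> ^ multi_degree \<alpha>) {()}"
    by (rule has_sum_finiteI) simp_all
  show "((\<lambda>_. k * monomial_at x \<alpha> y) has_sum k * monomial_at x \<alpha> y) {()}" for y
    by (rule has_sum_finiteI) simp_all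
qed (rule assms order_refl)+

lemma pow_series_const:
  assumes "0 < \<rho>"
  shows "pow_series x \<rho> \<bar>k\<bar> (\<lambda>_. k)"
proof -
  have "(\<lambda>b\<in>Basis. 0) \<in> (multi_indices :: ('a \<Rightarrow> nat) set)"
    by simp
  from pow_series_single [OF assms this, where k = k and x = x] show ?thesis
    by (simp add: multi_degree_def monomial_at_def)
qed

lemma pow_series_coord:
  assumes "0 < \<rho>" "b \<in> Basis"
  shows "pow_series x \<rho> \<rho> (\<lambda>y. (y - x) \<bullet> b)"
proof -
  define a where "a = (\<lambda>b'\<in>Basis. if b' = b then Suc 0 else 0)"
  have "multi_degree a = (\<Sum>b'\<in>Basis. if b' = b then Suc 0 else 0)"
    unfolding multi_degree_def a_def by (rule sum.cong) simp_all
  then have deg: "multi_degree a = 1"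
    using assms(2) by simp
  have mon: "monomial_at x a y = (y - x) \<bullet> b" for y
  proof -
    have "monomial_at x a y = (\<Prod>b'\<in>Basis. if b' = b then (y - x) \<bullet> b' else 1)"
      unfolding monomial_at_def a_def by (rule prod.cong) simp_all
    then show ?thesis
      using assms(2) by simp
  qed
  have "a \<in> multi_indices"
    by (simp add: a_def)
  from pow_series_single [OF assms(1) this, where k = 1 and x = x] show ?thesis
    by (simp add: deg mon)
qed

lemma pow_series_add:
  assumes \<rho>: "0 < \<rho>" and f: "pow_series x \<rho> M f" and g: "pow_series x \<rho> N g"
  shows "pow_series x \<rho> (M + N) (\<lambda>y. f y + g y)"
proof -
  from f obtain c M' where c: "((\<lambda>\<alpha>. \<bar>c \<alpha>\<bar> * \<rho> ^ multi_degree \<alpha>) has_sum M') multi_indices" "M' \<le> M"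
    "\<forall>y\<in>ball x \<rho>. ((\<lambda>\<alpha>. c \<alpha> * monomial_at x \<alpha> y) has_sum f y) multi_indices"
    unfolding pow_series_def by blast
  from g obtain d N' where d: "((\<lambda>\<alpha>. \<bar>d \<alpha>\<bar> * \<rho> ^ multi_degree \<alpha>) has_sum N') multi_indices" "N' \<le> N"
    "\<forall>y\<in>ball x \<rho>. ((\<lambda>\<alpha>. d \<alpha> * monomial_at x \<alpha> y) has_sum g y) multi_indices"
    unfolding pow_series_def by blast
  show ?thesis
  proof (rule pow_seriesI [OF \<rho> has_sum_add [OF c(1) d(1)], where c = "\<lambda>\<alpha>. c \<alpha> + d \<alpha>"])
    show "\<bar>c \<alpha> + d \<alpha>\<bar> * \<rho> ^ multi_degree \<alpha> \<le> \<bar>c \<alpha>\<bar> * \<rho> ^ multi_degree \<alpha> + \<bar>d \<alpha>\<bar> * \<rho> ^ multi_degree \<alpha>" for \<alpha>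
      using \<rho> by (simp add: abs_triangle_ineq flip: distrib_right)
    show "((\<lambda>\<alpha>. (c \<alpha> + d \<alpha>) * monomial_at x \<alpha> y) has_sum f y + g y) multi_indices" if "y \<in> ball x \<rho>" for y
      using has_sum_add [OF c(3) [rule_format, OF that] d(3) [rule_format, OF that]]
      by (simp add: distrib_right)
  qed (use c(2) d(2) in simp)
qed

lemma monomial_at_mult:
  "monomial_at x (\<lambda>b\<in>Basis. \<alpha> b + \<beta> b) y = monomial_at x \<alpha> y * monomial_at x \<beta> y"
  by (simp add: monomial_at_def power_add prod.distrib)

lemma multi_degree_add:
  "multi_degree (\<lambda>b\<in>Basis. \<alpha> b + \<beta> b) = multi_degree \<alpha> + multi_degree \<beta>"
  by (simp add: multi_degree_def sum.distrib)

lemma has_sum_product_real: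
  fixes f :: "'i \<Rightarrow> real" and g :: "'j \<Rightarrow> real"
  assumes f: "(f has_sum S) A" and g: "(g has_sum T) B"
  shows "((\<lambda>(i, j). f i * g j) has_sum S * T) (A \<times> B)"
proof (rule has_sum_SigmaI)
  show "((\<lambda>j. case (i, j) of (i, j) \<Rightarrow> f i * g j) has_sum f i * T) B" for i
    using has_sum_cmult_right [OF g] by simp
  show "((\<lambda>i. f i * T) has_sum S * T) A"
    by (rule has_sum_cmult_left [OF f])
  have *: "(\<lambda>i. \<bar>f i\<bar>) summable_on A" "(\<lambda>j. \<bar>g j\<bar>) summable_on B"
    using summable_on_iff_abs_summable_on_real [THEN iffD1, OF has_sum_imp_summable [OF f]]
      summable_on_iff_abs_summable_on_real [THEN iffD1, OF has_sum_imp_summable [OF g]] by simp_all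
  have "(\<lambda>(i, j). \<bar>f i\<bar> * \<bar>g j\<bar>) summable_on A \<times> B"
    by (rule summable_on_SigmaI [where g = "\<lambda>i. \<bar>f i\<bar> * (\<Sum>\<^sub>\<infinity>j\<in>B. \<bar>g j\<bar>)"])
      (use * in \<open>auto intro!: has_sum_cmult_right summable_on_cmult_left\<close>)
  then have "(\<lambda>p. norm (case p of (i, j) \<Rightarrow> f i * g j)) summable_on A \<times> B"
    by (rule summable_on_cong [THEN iffD1, rotated]) (auto simp: abs_mult)
  then show "(\<lambda>(i, j). f i * g j) summable_on A \<times> B"
    by (rule abs_summable_summable)
qed

lemma pow_series_mult:
  assumes \<rho>: "0 < \<rho>" and f: "pow_series x \<rho> M f" and g: "pow_series x \<rho> N g" and "0 \<le> M"
  shows "pow_series x \<rho> (M * N) (\<lambda>y. f y * g y)"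
proof -
  from f obtain c M' where c: "((\<lambda>\<alpha>. \<bar>c \<alpha>\<bar> * \<rho> ^ multi_degree \<alpha>) has_sum M') multi_indices" "M' \<le> M"
    "\<forall>y\<in>ball x \<rho>. ((\<lambda>\<alpha>. c \<alpha> * monomial_at x \<alpha> y) has_sum f y) multi_indices"
    unfolding pow_series_def by blast
  from g obtain d N' where d: "((\<lambda>\<alpha>. \<bar>d \<alpha>\<bar> * \<rho> ^ multi_degree \<alpha>) has_sum N') multi_indices" "N' \<le> N"
    "\<forall>y\<in>ball x \<rho>. ((\<lambda>\<alpha>. d \<alpha> * monomial_at x \<alpha> y) has_sum g y) multi_indices"
    unfolding pow_series_def by blast
  have "0 \<le> M'" "0 \<le> N'"
    by (rule has_sum_nonneg [OF c(1)], use \<rho> in simp) (rule has_sum_nonneg [OF d(1)], use \<rho> in simp)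
  let ?a = "\<lambda>(\<alpha>, \<beta>). \<lambda>b\<in>Basis. \<alpha> b + \<beta> b :: nat"
  show ?thesis
  proof (rule pow_series_regroup [OF \<rho>, where c = "\<lambda>(\<alpha>, \<beta>). c \<alpha> * d \<beta>" and a = ?a
        and I = "multi_indices \<times> multi_indices" and N = "M' * N'"])
    show "((\<lambda>i. \<bar>case i of (\<alpha>, \<beta>) \<Rightarrow> c \<alpha> * d \<beta>\<bar> * \<rho> ^ multi_degree (?a i)) has_sum M' * N') (multi_indices \<times> multi_indices)"
      using has_sum_product_real [OF c(1) d(1)]
      by (simp add: case_prod_unfold multi_degree_add power_add abs_mult mult_ac)
    show "M' * N' \<le> M * N"
      using c(2) d(2) \<open>0 \<le> M'\<close> \<open>0 \<le> N'\<close> \<open>0 \<le> M\<close> by (intro mult_mono) auto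
    show "((\<lambda>i. (case i of (\<alpha>, \<beta>) \<Rightarrow> c \<alpha> * d \<beta>) * monomial_at x (?a i) y) has_sum f y * g y) (multi_indices \<times> multi_indices)"
      if "y \<in> ball x \<rho>" for y
      using has_sum_product_real [OF c(3) [rule_format, OF that] d(3) [rule_format, OF that]]
      by (simp add: case_prod_unfold monomial_at_mult mult_ac)
  qed auto
qed

text \<open>This is the completeness of the norm.\<close>

lemma pow_series_infsum:
  assumes \<rho>: "0 < \<rho>" and f: "\<And>k. k \<in> K \<Longrightarrow> pow_series x \<rho> (M k) (f k)"
    and M: "(M has_sum S) K" and F: "\<And>y. y \<in> ball x \<rho> \<Longrightarrow> ((\<lambda>k. f k y) has_sum F y) K"
  shows "pow_series x \<rho> S F"
proof -
  from f have "\<forall>k\<in>K. \<exists>c N. ((\<lambda>\<alpha>. \<bar>c \<alpha>\<bar> * \<rho> ^ multi_degree \<alpha>) has_sum N) multi_indices \<and> N \<le> M k \<and>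
      (\<forall>y\<in>ball x \<rho>. ((\<lambda>\<alpha>. c \<alpha> * monomial_at x \<alpha> y) has_sum f k y) multi_indices)"
    unfolding pow_series_def by blast
  from bchoice [OF this] obtain c where "\<forall>k\<in>K. \<exists>N. ((\<lambda>\<alpha>. \<bar>c k \<alpha>\<bar> * \<rho> ^ multi_degree \<alpha>) has_sum N) multi_indices \<and> N \<le> M k \<and>
      (\<forall>y\<in>ball x \<rho>. ((\<lambda>\<alpha>. c k \<alpha> * monomial_at x \<alpha> y) has_sum f k y) multi_indices)"
    by blast
  from bchoice [OF this] obtain N where cN: "\<forall>k\<in>K. ((\<lambda>\<alpha>. \<bar>c k \<alpha>\<bar> * \<rho> ^ multi_degree \<alpha>) has_sum N k) multi_indices \<and> N k \<le> M k \<and>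
      (\<forall>y\<in>ball x \<rho>. ((\<lambda>\<alpha>. c k \<alpha> * monomial_at x \<alpha> y) has_sum f k y) multi_indices)"
    by blast
  have c: "\<And>k. k \<in> K \<Longrightarrow> ((\<lambda>\<alpha>. \<bar>c k \<alpha>\<bar> * \<rho> ^ multi_degree \<alpha>) has_sum N k) multi_indices"
    "\<And>k. k \<in> K \<Longrightarrow> N k \<le> M k"
    "\<And>k y. k \<in> K \<Longrightarrow> y \<in> ball x \<rho> \<Longrightarrow> ((\<lambda>\<alpha>. c k \<alpha> * monomial_at x \<alpha> y) has_sum f k y) multi_indices"
    using cN by blast+
  have N0: "0 \<le> N k" if "k \<in> K" for k
    by (rule has_sum_nonneg [OF c(1) [OF that]]) (use \<rho> in simp)
  have "N summable_on K"
    by (rule summable_on_comparison_test [OF has_sum_imp_summable [OF M] c(2) N0])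
  then have N: "(N has_sum infsum N K) K"
    by (rule has_sum_infsum)
  have s: "(\<lambda>(k, \<alpha>). \<bar>c k \<alpha>\<bar> * \<rho> ^ multi_degree \<alpha>) summable_on K \<times> multi_indices"
  proof (rule summable_on_SigmaI [where g = N])
    show "((\<lambda>\<alpha>. case (k, \<alpha>) of (k, \<alpha>) \<Rightarrow> \<bar>c k \<alpha>\<bar> * \<rho> ^ multi_degree \<alpha>) has_sum N k) multi_indices"
      if "k \<in> K" for k
      unfolding prod.case by (rule c(1) [OF that])
    show "0 \<le> (case (k, \<alpha>) of (k, \<alpha>) \<Rightarrow> \<bar>c k \<alpha>\<bar> * \<rho> ^ multi_degree \<alpha>)" for k \<alpha>
      unfolding prod.case using \<rho> by simp
  qed (rule \<open>N summable_on K\<close>)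
  show ?thesis
  proof (rule pow_series_regroup [OF \<rho>, where c = "\<lambda>(k, \<alpha>). c k \<alpha>" and a = snd
        and I = "K \<times> multi_indices" and N = "infsum N K"])
    show "((\<lambda>i. \<bar>case i of (k, \<alpha>) \<Rightarrow> c k \<alpha>\<bar> * \<rho> ^ multi_degree (snd i)) has_sum infsum N K) (K \<times> multi_indices)"
      by (rule has_sum_SigmaI [OF _ N], unfold prod.case snd_conv, erule c(1), use s in \<open>simp only: case_prod_unfold\<close>)
    show "infsum N K \<le> S"
      by (rule has_sum_mono [OF N M c(2)])
    show "snd i \<in> multi_indices" if "i \<in> K \<times> multi_indices" for i
      using that by (rule mem_Times_iff [THEN iffD1, THEN conjunct2])
    fix y assume y: "y \<in> ball x \<rho>"
    show "((\<lambda>i. (case i of (k, \<alpha>) \<Rightarrow> c k \<alpha>) * monomial_at x (snd i) y) has_sum F y) (K \<times> multi_indices)"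
    proof (rule has_sum_SigmaI [OF _ F [OF y]])
      show "((\<lambda>\<alpha>. (case (k, \<alpha>) of (k, \<alpha>) \<Rightarrow> c k \<alpha>) * monomial_at x (snd (k, \<alpha>)) y) has_sum f k y) multi_indices"
        if "k \<in> K" for k
        unfolding prod.case snd_conv by (rule c(3) [OF that y])
      have "(\<lambda>i. norm ((case i of (k, \<alpha>) \<Rightarrow> c k \<alpha>) * monomial_at x (snd i) y)) summable_on K \<times> multi_indices"
      proof (rule summable_on_comparison_test [OF s])
        show "norm ((case i of (k, \<alpha>) \<Rightarrow> c k \<alpha>) * monomial_at x (snd i) y)
            \<le> (case i of (k, \<alpha>) \<Rightarrow> \<bar>c k \<alpha>\<bar> * \<rho> ^ multi_degree \<alpha>)" for i
          by (cases i) (simp add: abs_mult mult_left_mono abs_monomial_at_le norm_le_of_mem_ball [OF y])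
      qed (rule norm_ge_zero)
      then show "(\<lambda>i. (case i of (k, \<alpha>) \<Rightarrow> c k \<alpha>) * monomial_at x (snd i) y) summable_on K \<times> multi_indices"
        by (rule abs_summable_summable)
    qed
  qed
qed

lemma pow_series_nonneg:
  assumes "pow_series x \<rho> M f" "0 < \<rho>"
  shows "0 \<le> M"
proof (rule pow_seriesE [OF assms(1)])
  fix c N
  assume c: "((\<lambda>\<alpha>. \<bar>c \<alpha>\<bar> * \<rho> ^ multi_degree \<alpha>) has_sum N) multi_indices" "N \<le> M"
  have "0 \<le> N"
    by (rule has_sum_nonneg [OF c(1)]) (use assms(2) in simp)
  then show ?thesis
    using c(2) by linarith
qed

lemma pow_series_bound:
  assumes "pow_series x \<rho> M f" "y \<in> ball x \<rho>"
  shows "\<bar>f y\<bar> \<le> M"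
proof (rule pow_seriesE [OF assms(1)])
  fix c N
  assume c: "((\<lambda>\<alpha>. \<bar>c \<alpha>\<bar> * \<rho> ^ multi_degree \<alpha>) has_sum N) multi_indices" "N \<le> M"
    "\<And>y. y \<in> ball x \<rho> \<Longrightarrow> ((\<lambda>\<alpha>. c \<alpha> * monomial_at x \<alpha> y) has_sum f y) multi_indices"
  have le: "\<bar>c \<alpha> * monomial_at x \<alpha> y\<bar> \<le> \<bar>c \<alpha>\<bar> * \<rho> ^ multi_degree \<alpha>" for \<alpha>
    by (simp add: abs_mult mult_left_mono abs_monomial_at_le [OF norm_le_of_mem_ball [OF assms(2)]])
  have "f y \<le> N"
    by (rule has_sum_mono [OF c(3) [OF assms(2)] c(1)]) (rule abs_le_D1 [OF le])
  moreover have "- f y \<le> N"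
    by (rule has_sum_mono [OF has_sum_uminusI [OF c(3) [OF assms(2)]] c(1)]) (rule abs_le_D2 [OF le])
  ultimately show ?thesis
    using c(2) by linarith
qed

lemma pow_series_cmult:
  assumes "0 < \<rho>" "pow_series x \<rho> M f"
  shows "pow_series x \<rho> (\<bar>k\<bar> * M) (\<lambda>y. k * f y)"
  using pow_series_mult [OF assms(1) pow_series_const assms(2)] assms(1) by simp

lemma pow_series_sum:
  assumes "0 < \<rho>" "finite I" "\<And>i. i \<in> I \<Longrightarrow> pow_series x \<rho> (M i) (f i)"
  shows "pow_series x \<rho> (\<Sum>i\<in>I. M i) (\<lambda>y. \<Sum>i\<in>I. f i y)"
  using assms(2,3)
proof (induction I rule: finite_induct)
  case empty
  then show ?case using pow_series_const [OF assms(1), of x 0] by simp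
next
  case (insert i I)
  then show ?case using pow_series_add [OF assms(1), of x "M i" "f i" "sum M I"] by simp
qed

lemma pow_series_power:
  assumes "0 < \<rho>" "pow_series x \<rho> M f"
  shows "pow_series x \<rho> (M ^ n) (\<lambda>y. f y ^ n)"
proof (induction n)
  case 0
  then show ?case using pow_series_const [OF assms(1), of x 1] by simp
next
  case (Suc n)
  then show ?case
    using pow_series_mult [OF assms Suc] pow_series_nonneg [OF assms(2,1)] by simp
qed

lemma pow_series_prod:
  assumes "0 < \<rho>" "finite I" "\<And>i. i \<in> I \<Longrightarrow> pow_series x \<rho> (M i) (f i)"
  shows "pow_series x \<rho> (\<Prod>i\<in>I. M i) (\<lambda>y. \<Prod>i\<in>I. f i y)"
  using assms(2,3)
proof (induction I rule: finite_induct)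
  case empty
  then show ?case using pow_series_const [OF assms(1), of x 1] by simp
next
  case (insert i I)
  have "pow_series x \<rho> (M i * prod M I) (\<lambda>y. f i y * (\<Prod>i\<in>I. f i y))"
    by (rule pow_series_mult [OF assms(1) _ _ pow_series_nonneg [OF _ assms(1)]]) (use insert in auto)
  with insert show ?case by simp
qed

text \<open>Relative to \<open>x'\<close> and the radius \<open>\<rho> - dist x x'\<close>, a coordinate \<open>(y - x) \<bullet> b\<close> has norm at
most \<open>\<rho>\<close>. So a monomial expanded about \<open>x'\<close> keeps its norm bound.\<close>

lemma pow_series_recentre:
  assumes f: "pow_series x \<rho> M f" and x': "dist x x' < \<rho>"
  shows "pow_series x' (\<rho> - dist x x') M f"
proof -
  define \<rho>' where "\<rho>' = \<rho> - dist x x'"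
  have \<rho>': "0 < \<rho>'" and \<rho>: "0 < \<rho>"
    using x' by (auto simp: \<rho>'_def intro: le_less_trans [OF zero_le_dist])
  from f obtain c N where c: "((\<lambda>\<alpha>. \<bar>c \<alpha>\<bar> * \<rho> ^ multi_degree \<alpha>) has_sum N) multi_indices" "N \<le> M"
    "\<And>y. y\<in>ball x \<rho> \<Longrightarrow> ((\<lambda>\<alpha>. c \<alpha> * monomial_at x \<alpha> y) has_sum f y) multi_indices"
    unfolding pow_series_def by blast
  have coord: "pow_series x' \<rho>' \<rho> (\<lambda>y. (y - x) \<bullet> b)" if "b \<in> Basis" for b
  proof -
    have "\<bar>(x' - x) \<bullet> b\<bar> \<le> dist x x'"
      using Basis_le_norm [OF that, of "x' - x"] by (simp add: dist_norm norm_minus_commute)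
    then have "\<rho>' + \<bar>(x' - x) \<bullet> b\<bar> \<le> \<rho>"
      by (simp add: \<rho>'_def)
    with pow_series_add [OF \<rho>' pow_series_coord [OF \<rho>' that] pow_series_const [OF \<rho>', of x' "(x' - x) \<bullet> b"]]
    have "pow_series x' \<rho>' \<rho> (\<lambda>y. (y - x') \<bullet> b + (x' - x) \<bullet> b)"
      by (rule pow_series_mono)
    then show ?thesis
      by (simp flip: inner_add_left)
  qed
  have "pow_series x' \<rho>' (\<bar>c \<alpha>\<bar> * \<rho> ^ multi_degree \<alpha>) (\<lambda>y. c \<alpha> * monomial_at x \<alpha> y)" for \<alpha>
    unfolding monomial_at_def multi_degree_def power_sum
    by (intro pow_series_cmult pow_series_prod pow_series_power coord \<rho>' finite_Basis)
  then have "pow_series x' \<rho>' N f"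
  proof (rule pow_series_infsum [OF \<rho>' _ c(1)])
    fix y assume "y \<in> ball x' \<rho>'"
    then have "y \<in> ball x \<rho>"
      using dist_triangle [of x y x'] by (simp add: \<rho>'_def)
    then show "((\<lambda>\<alpha>. c \<alpha> * monomial_at x \<alpha> y) has_sum f y) multi_indices"
      by (rule c(3))
  qed
  from pow_series_mono [OF this c(2)] show ?thesis
    unfolding \<rho>'_def .
qed

section \<open>Real-analytic functions\<close>

lemma real_analytic_atI:
  fixes f :: "'a::euclidean_space \<Rightarrow> 'b::euclidean_space"
  assumes "0 < \<rho>" and "\<And>b. b \<in> Basis \<Longrightarrow> \<exists>M. pow_series x \<rho> M (\<lambda>y. f y \<bullet> b)"
  shows "real_analytic_at f x"
proof -
  have "\<forall>b\<in>Basis. \<exists>c. \<forall>y\<in>ball x \<rho>. ((\<lambda>\<alpha>. c \<alpha> * monomial_at x \<alpha> y) has_sum f y \<bullet> b) multi_indices"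
    using assms(2) unfolding pow_series_def by blast
  from bchoice [OF this] obtain c where c: "\<And>b y. b \<in> Basis \<Longrightarrow> y \<in> ball x \<rho> \<Longrightarrow>
      ((\<lambda>\<alpha>. c b \<alpha> * monomial_at x \<alpha> y) has_sum f y \<bullet> b) multi_indices"
    by blast
  define C where "C \<alpha> = (\<Sum>b\<in>Basis. c b \<alpha> *\<^sub>R b)" for \<alpha>
  have "((\<lambda>\<alpha>. monomial_at x \<alpha> y *\<^sub>R C \<alpha>) has_sum f y) multi_indices" if y: "y \<in> ball x \<rho>" for y
  proof -
    have part: "((\<lambda>\<alpha>. \<Sum>b\<in>B. (c b \<alpha> * monomial_at x \<alpha> y) *\<^sub>R b) has_sum (\<Sum>b\<in>B. (f y \<bullet> b) *\<^sub>R b)) multi_indices"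
      if "B \<subseteq> Basis" for B :: "'b set"
      using finite_subset [OF that finite_Basis] that
    proof (induction B rule: finite_induct)
      case (insert b B)
      then show ?case
        using has_sum_add [OF has_sum_bounded_linear [OF bounded_linear_scaleR_left c [OF _ y]]] by auto
    qed simp
    show ?thesis
      using part [OF subset_refl] by (simp add: C_def scaleR_sum_right mult.commute euclidean_representation)
  qed
  then show ?thesis
    unfolding real_analytic_at_def monomial_at_def using assms(1) by blast
qed

lemma real_polynomial_pow_series:
  fixes f :: "'a::euclidean_space \<Rightarrow> real"
  assumes "real_polynomial_function f" "0 < \<rho>"
  shows "\<exists>M. pow_series x \<rho> M f"
  using assms(1)
proof (induction f rule: real_polynomial_function.induct)
  case (linear f)
  then interpret bounded_linear f .
  have eq: "f y = f x + (\<Sum>b\<in>Basis. f b * ((y - x) \<bullet> b))" for y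
  proof -
    have "f (y - x) = f (\<Sum>b\<in>Basis. ((y - x) \<bullet> b) *\<^sub>R b)"
      by (simp only: euclidean_representation)
    also have "\<dots> = (\<Sum>b\<in>Basis. f b * ((y - x) \<bullet> b))"
      unfolding sum by (simp add: scaleR mult.commute)
    finally show ?thesis
      by (simp add: diff)
  qed
  have "pow_series x \<rho> (\<bar>f x\<bar> + (\<Sum>b\<in>Basis. \<bar>f b\<bar> * \<rho>)) (\<lambda>y. f x + (\<Sum>b\<in>Basis. f b * ((y - x) \<bullet> b)))"
    by (intro pow_series_add pow_series_const pow_series_sum pow_series_cmult pow_series_coord
        finite_Basis assms(2))
  then show ?case
    using eq by (metis (no_types, lifting) pow_series_cong)
next
  case (const c)
  then show ?case using pow_series_const [OF assms(2)] by blast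
next
  case (add f g)
  then obtain M N where "pow_series x \<rho> M f" "pow_series x \<rho> N g" by blast
  from pow_series_add [OF assms(2) this] show ?case by blast
next
  case (mult f g)
  then obtain M N where "pow_series x \<rho> M f" "pow_series x \<rho> N g" by blast
  from pow_series_mult [OF assms(2) this pow_series_nonneg [OF this(1) assms(2)]] show ?case by blast
qed

lemma polynomial_real_analytic_at:
  fixes f :: "'a::euclidean_space \<Rightarrow> 'b::euclidean_space"
  assumes "polynomial_function f"
  shows "real_analytic_at f x"
  by (rule real_analytic_atI [OF zero_less_one])
    (use assms in \<open>auto simp: polynomial_function_iff_Basis_inner intro: real_polynomial_pow_series\<close>)

lemma finite_multi_indices_degree_le:
  "finite {\<alpha> \<in> (multi_indices :: ('a::euclidean_space \<Rightarrow> nat) set). multi_degree \<alpha> \<le> n}"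
proof (rule finite_subset)
  show "finite (Basis \<rightarrow>\<^sub>E {..n} :: ('a \<Rightarrow> nat) set)"
    by (intro finite_PiE finite_Basis finite_atMost)
  show "{\<alpha> \<in> multi_indices. multi_degree \<alpha> \<le> n} \<subseteq> (Basis \<rightarrow>\<^sub>E {..n} :: ('a \<Rightarrow> nat) set)"
  proof
    fix \<alpha> :: "'a \<Rightarrow> nat"
    assume "\<alpha> \<in> {\<alpha> \<in> multi_indices. multi_degree \<alpha> \<le> n}"
    then have \<alpha>: "\<alpha> \<in> multi_indices" "sum \<alpha> Basis \<le> n"
      by (simp_all add: multi_degree_def)
    show "\<alpha> \<in> Basis \<rightarrow>\<^sub>E {..n}"
    proof (rule PiE_I)
      fix b :: 'a assume "b \<in> Basis"
      then have "\<alpha> b \<le> sum \<alpha> Basis"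
        by (intro member_le_sum) simp_all
      with \<alpha>(2) show "\<alpha> b \<in> {..n}" by simp
    qed (rule PiE_arb [OF \<alpha>(1)])
  qed
qed

lemma real_polynomial_monomial_at: "real_polynomial_function (monomial_at x \<alpha>)"
  unfolding monomial_at_def [abs_def] inner_diff_left
  by (intro real_polynomial_function_prod real_polynomial_function_power real_polynomial_function_diff
      real_polynomial_function.intros(1,2) finite_Basis bounded_linear_inner_left)

text \<open>The terms of degree at most one form a polynomial, and the remaining terms carry a factor
\<open>(norm (y - x) / \<rho>)\<^sup>2\<close>.\<close>

lemma pow_series_differentiable:
  fixes f :: "'a::euclidean_space \<Rightarrow> real"
  assumes f: "pow_series x \<rho> M f" and \<rho>: "0 < \<rho>"
  shows "f differentiable (at x)"
proof -
  obtain c N where c: "((\<lambda>\<alpha>. \<bar>c \<alpha>\<bar> * \<rho> ^ multi_degree \<alpha>) has_sum N) multi_indices"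
    "\<And>y. y\<in>ball x \<rho> \<Longrightarrow> ((\<lambda>\<alpha>. c \<alpha> * monomial_at x \<alpha> y) has_sum f y) multi_indices"
    using pow_seriesE [OF f] by blast
  define F :: "('a \<Rightarrow> nat) set" where "F = {\<alpha> \<in> multi_indices. multi_degree \<alpha> \<le> Suc 0}"
  define g where "g y = (\<Sum>\<alpha>\<in>F. c \<alpha> * monomial_at x \<alpha> y)" for y
  have F: "finite F"
    unfolding F_def by (rule finite_multi_indices_degree_le)
  have "real_polynomial_function g"
    unfolding g_def [abs_def] using F
    by (intro real_polynomial_function_sum real_polynomial_function.intros(4) real_polynomial_function.intros(2)
        real_polynomial_monomial_at)
  then have g: "g differentiable (at x)"
    by (simp add: differentiable_at_real_polynomial_function)
  have N0: "0 \<le> N"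
    by (rule has_sum_nonneg [OF c(1)]) (use \<rho> in simp)
  have bound: "\<bar>f y - g y\<bar> \<le> N * (norm (y - x) / \<rho>)\<^sup>2" if y: "norm (y - x) < \<rho>" for y
  proof -
    define \<tau> where "\<tau> = norm (y - x)"
    have \<tau>: "0 \<le> \<tau>" "\<tau> / \<rho> \<le> 1"
      using y \<rho> by (auto simp: \<tau>_def)
    have yb: "y \<in> ball x \<rho>"
      using y by (simp add: dist_norm norm_minus_commute)
    have split: "((\<lambda>\<alpha>. c \<alpha> * monomial_at x \<alpha> y) has_sum (f y - g y)) (multi_indices - F)"
      unfolding g_def by (rule has_sum_Diff [OF c(2) [OF yb] has_sum_finite [OF F]]) (auto simp: F_def)
    have le: "\<bar>c \<alpha> * monomial_at x \<alpha> y\<bar> \<le> (\<tau> / \<rho>)\<^sup>2 * (\<bar>c \<alpha>\<bar> * \<rho> ^ multi_degree \<alpha>)"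
      if "\<alpha> \<in> multi_indices - F" for \<alpha>
    proof -
      have "2 \<le> multi_degree \<alpha>"
        using that by (auto simp: F_def)
      then have "(\<tau> / \<rho>) ^ multi_degree \<alpha> \<le> (\<tau> / \<rho>)\<^sup>2"
        using \<tau> \<rho> by (intro power_decreasing) auto
      then have "\<tau> ^ multi_degree \<alpha> \<le> (\<tau> / \<rho>)\<^sup>2 * \<rho> ^ multi_degree \<alpha>"
        using \<rho> by (simp add: power_divide pos_divide_le_eq)
      moreover have "\<bar>monomial_at x \<alpha> y\<bar> \<le> \<tau> ^ multi_degree \<alpha>"
        by (rule abs_monomial_at_le) (simp add: \<tau>_def)
      ultimately have "\<bar>monomial_at x \<alpha> y\<bar> \<le> (\<tau> / \<rho>)\<^sup>2 * \<rho> ^ multi_degree \<alpha>"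
        by linarith
      then show ?thesis
        using mult_left_mono [of _ _ "\<bar>c \<alpha>\<bar>"] by (simp add: abs_mult mult.left_commute)
    qed
    have sub: "(\<lambda>\<alpha>. \<bar>c \<alpha>\<bar> * \<rho> ^ multi_degree \<alpha>) summable_on (multi_indices - F)"
      by (rule summable_on_subset_banach [OF has_sum_imp_summable [OF c(1)]]) auto
    define N' where "N' = (\<Sum>\<^sub>\<infinity>\<alpha>\<in>multi_indices - F. \<bar>c \<alpha>\<bar> * \<rho> ^ multi_degree \<alpha>)"
    have "N' \<le> N"
      unfolding N'_def by (rule has_sum_mono' [OF has_sum_infsum [OF sub] c(1)]) (use \<rho> in auto)
    have N': "((\<lambda>\<alpha>. (\<tau> / \<rho>)\<^sup>2 * (\<bar>c \<alpha>\<bar> * \<rho> ^ multi_degree \<alpha>)) has_sum ((\<tau> / \<rho>)\<^sup>2 * N')) (multi_indices - F)"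
      unfolding N'_def by (rule has_sum_cmult_right [OF has_sum_infsum [OF sub]])
    have "f y - g y \<le> (\<tau> / \<rho>)\<^sup>2 * N'"
      by (rule has_sum_mono [OF split N']) (use le in \<open>force simp: abs_le_iff\<close>)
    moreover have "- (f y - g y) \<le> (\<tau> / \<rho>)\<^sup>2 * N'"
      by (rule has_sum_mono [OF has_sum_uminusI [OF split] N']) (use le in \<open>force simp: abs_le_iff\<close>)
    moreover have "(\<tau> / \<rho>)\<^sup>2 * N' \<le> (\<tau> / \<rho>)\<^sup>2 * N"
      using \<open>N' \<le> N\<close> by (intro mult_left_mono) auto
    ultimately show ?thesis
      by (simp add: \<tau>_def mult.commute abs_le_iff)
  qed
  have "((\<lambda>y. f y - g y) has_derivative (\<lambda>_. 0)) (at x)"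
    unfolding has_derivative_at_alt
  proof (intro conjI allI impI)
    fix e :: real assume e: "0 < e"
    define d where "d = min \<rho> (e * \<rho>\<^sup>2 / (N + 1))"
    have "0 < d"
      using e \<rho> N0 by (auto simp: d_def)
    moreover have "norm (f y - g y - (f x - g x) - 0) \<le> e * norm (y - x)" if y: "norm (y - x) < d" for y
    proof -
      have "f x - g x = 0"
        using bound [of x] \<rho> by simp
      moreover have "\<bar>f y - g y\<bar> \<le> N * (norm (y - x) / \<rho>)\<^sup>2"
        using bound y by (simp add: d_def)
      moreover have "N * (norm (y - x) / \<rho>)\<^sup>2 \<le> e * norm (y - x)"
      proof -
        have "norm (y - x) * (N + 1) \<le> e * \<rho>\<^sup>2"
          using y N0 by (simp add: d_def pos_less_divide_eq)
        then have "norm (y - x) * N \<le> e * \<rho>\<^sup>2"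
          by (smt (verit) norm_ge_zero mult_left_mono)
        then have "norm (y - x) * (norm (y - x) * N) \<le> norm (y - x) * (e * \<rho>\<^sup>2)"
          by (rule mult_left_mono) simp
        then show ?thesis
          using \<rho> by (simp add: power_divide power2_eq_square field_simps)
      qed
      ultimately show ?thesis by simp
    qed
    ultimately show "\<exists>d>0. \<forall>y. norm (y - x) < d \<longrightarrow> norm (f y - g y - (f x - g x) - 0) \<le> e * norm (y - x)"
      by blast
  qed simp
  then have "(\<lambda>y. f y - g y) differentiable (at x)"
    by (rule differentiableI)
  from differentiable_add [OF this g] show ?thesis
    by simp
qed

text \<open>At the point all of whose coordinates relative to \<open>x\<close> are \<open>\<rho>\<close>, every monomial has the value
\<open>\<rho>\<close> to its degree, and an unconditionally convergent real series converges absolutely.\<close>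

lemma real_analytic_at_pow_series:
  fixes f :: "'a::euclidean_space \<Rightarrow> real"
  assumes "real_analytic_at f x"
  obtains \<rho> M where "0 < \<rho>" "pow_series x \<rho> M f"
proof -
  obtain \<delta> c where \<delta>: "0 < \<delta>"
    and c: "\<And>y. y \<in> ball x \<delta> \<Longrightarrow> ((\<lambda>\<alpha>. monomial_at x \<alpha> y *\<^sub>R c \<alpha>) has_sum f y) multi_indices"
    using assms unfolding real_analytic_at_def monomial_at_def by blast
  define \<rho> where "\<rho> = \<delta> / (2 * DIM('a))"
  have \<rho>: "0 < \<rho>"
    using \<delta> by (simp add: \<rho>_def)
  define y where "y = x + (\<Sum>b\<in>Basis. \<rho> *\<^sub>R b)"
  have "norm (\<Sum>b\<in>Basis. \<rho> *\<^sub>R b :: 'a) \<le> (\<Sum>b\<in>(Basis :: 'a set). \<rho>)"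
    by (rule sum_norm_le) (use \<rho> in simp)
  also have "\<dots> < \<delta>"
    using \<delta> by (simp add: \<rho>_def)
  finally have y: "y \<in> ball x \<delta>"
    by (simp add: y_def dist_norm)
  have mon: "monomial_at x \<alpha> y = \<rho> ^ multi_degree \<alpha>" for \<alpha>
  proof -
    have "(y - x) \<bullet> b = \<rho>" if "b \<in> Basis" for b
      using that by (simp add: y_def inner_sum_left inner_Basis if_distrib cong: if_cong)
    then show ?thesis
      by (simp add: monomial_at_def multi_degree_def power_sum)
  qed
  have "(\<lambda>\<alpha>. \<bar>c \<alpha>\<bar> * \<rho> ^ multi_degree \<alpha>) summable_on multi_indices"
    using summable_on_iff_abs_summable_on_real [THEN iffD1, OF has_sum_imp_summable [OF c [OF y]]] \<rho>
    by (simp add: mon abs_mult mult.commute)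
  moreover have "\<rho> \<le> \<delta>"
  proof -
    have "1 \<le> 2 * real DIM('a)"
      using DIM_positive [where 'a = 'a] by linarith
    then show ?thesis
      using \<delta> by (simp add: \<rho>_def pos_divide_le_eq mult_le_cancel_left1)
  qed
  then have "((\<lambda>\<alpha>. c \<alpha> * monomial_at x \<alpha> z) has_sum f z) multi_indices" if "z \<in> ball x \<rho>" for z
    using c [of z] that by (simp add: mult.commute)
  ultimately have "pow_series x \<rho> (\<Sum>\<^sub>\<infinity>\<alpha>\<in>multi_indices. \<bar>c \<alpha>\<bar> * \<rho> ^ multi_degree \<alpha>) f"
    unfolding pow_series_def using has_sum_infsum order_refl by blast
  with \<rho> show thesis
    by (rule that)
qed

lemma real_analytic_at_differentiable:
  fixes f :: "'a::euclidean_space \<Rightarrow> 'b::euclidean_space"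
  assumes "real_analytic_at f x"
  shows "f differentiable (at x)"
proof -
  have "real_analytic_at (\<lambda>y. f y \<bullet> b) x" for b
  proof -
    obtain \<delta> c where \<delta>: "0 < \<delta>"
      and c: "\<And>y. y \<in> ball x \<delta> \<Longrightarrow> ((\<lambda>\<alpha>. (\<Prod>b\<in>Basis. ((y - x) \<bullet> b) ^ \<alpha> b) *\<^sub>R c \<alpha>) has_sum f y) multi_indices"
      using assms unfolding real_analytic_at_def by blast
    have "((\<lambda>\<alpha>. (\<Prod>b\<in>Basis. ((y - x) \<bullet> b) ^ \<alpha> b) *\<^sub>R (c \<alpha> \<bullet> b)) has_sum (f y \<bullet> b)) multi_indices"
      if "y \<in> ball x \<delta>" for y
      using has_sum_bounded_linear [OF bounded_linear_inner_left c [OF that], of b] by simp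
    then show ?thesis
      unfolding real_analytic_at_def using \<delta> by (intro exI [of _ \<delta>] conjI exI [of _ "\<lambda>\<alpha>. c \<alpha> \<bullet> b"]) auto
  qed
  then show ?thesis
    by (subst differentiable_componentwise_within)
      (metis real_analytic_at_pow_series pow_series_differentiable)
qed

section \<open>An analytic inverse function theorem for polynomial maps\<close>

definition vec_series :: "'a::euclidean_space \<Rightarrow> real \<Rightarrow> real \<Rightarrow> ('a \<Rightarrow> 'b::euclidean_space) \<Rightarrow> bool"
  where "vec_series x \<rho> M u \<longleftrightarrow> (\<forall>b\<in>Basis. pow_series x \<rho> M (\<lambda>y. u y \<bullet> b))"

text \<open>The function \<open>f\<close> vanishes to order \<open>n + 1\<close> at 0, with a Lipschitz estimate to match, where points are
replaced by power series and absolute values by the norm of \<^const>\<open>pow_series\<close>.\<close>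

definition series_bound :: "nat \<Rightarrow> 'a::euclidean_space \<Rightarrow> ('b::euclidean_space \<Rightarrow> real) \<Rightarrow> real \<Rightarrow> bool"
  where "series_bound n x f C \<longleftrightarrow> 0 \<le> C \<and>
    (\<forall>\<rho> \<epsilon> u. 0 < \<rho> \<longrightarrow> \<epsilon> \<le> 1 \<longrightarrow> vec_series x \<rho> \<epsilon> u \<longrightarrow> pow_series x \<rho> (C * \<epsilon> ^ Suc n) (\<lambda>y. f (u y))) \<and>
    (\<forall>\<rho> \<epsilon> \<delta> u v. 0 < \<rho> \<longrightarrow> \<epsilon> \<le> 1 \<longrightarrow> vec_series x \<rho> \<epsilon> u \<longrightarrow> vec_series x \<rho> \<epsilon> v \<longrightarrow>
      vec_series x \<rho> \<delta> (\<lambda>y. u y - v y) \<longrightarrow> pow_series x \<rho> (C * \<epsilon> ^ n * \<delta>) (\<lambda>y. f (u y) - f (v y)))"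

lemma vec_series_nonneg:
  fixes u :: "'a::euclidean_space \<Rightarrow> 'b::euclidean_space"
  assumes "vec_series x \<rho> M u" "0 < \<rho>"
  shows "0 \<le> M"
  using assms pow_series_nonneg nonempty_Basis unfolding vec_series_def by blast

lemma series_bound_nonneg: "series_bound n x f C \<Longrightarrow> 0 \<le> C"
  by (simp add: series_bound_def)

lemma series_bound_value:
  "series_bound n x f C \<Longrightarrow> 0 < \<rho> \<Longrightarrow> \<epsilon> \<le> 1 \<Longrightarrow> vec_series x \<rho> \<epsilon> u \<Longrightarrow>
    pow_series x \<rho> (C * \<epsilon> ^ Suc n) (\<lambda>y. f (u y))"
  unfolding series_bound_def by blast

lemma series_bound_diff:
  "series_bound n x f C \<Longrightarrow> 0 < \<rho> \<Longrightarrow> \<epsilon> \<le> 1 \<Longrightarrow> vec_series x \<rho> \<epsilon> u \<Longrightarrow> vec_series x \<rho> \<epsilon> v \<Longrightarrow>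
    vec_series x \<rho> \<delta> (\<lambda>y. u y - v y) \<Longrightarrow> pow_series x \<rho> (C * \<epsilon> ^ n * \<delta>) (\<lambda>y. f (u y) - f (v y))"
  unfolding series_bound_def by blast

lemma series_boundI:
  fixes x :: "'a::euclidean_space" and f :: "'b::euclidean_space \<Rightarrow> real"
  assumes "0 \<le> C"
    and "\<And>\<rho> \<epsilon> u. \<lbrakk>0 < \<rho>; 0 \<le> \<epsilon>; \<epsilon> \<le> 1; vec_series x \<rho> \<epsilon> u\<rbrakk> \<Longrightarrow> pow_series x \<rho> (C * \<epsilon> ^ Suc n) (\<lambda>y. f (u y))"
    and "\<And>\<rho> \<epsilon> \<delta> u v. \<lbrakk>0 < \<rho>; 0 \<le> \<epsilon>; \<epsilon> \<le> 1; 0 \<le> \<delta>; vec_series x \<rho> \<epsilon> u; vec_series x \<rho> \<epsilon> v;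
      vec_series x \<rho> \<delta> (\<lambda>y. u y - v y)\<rbrakk> \<Longrightarrow> pow_series x \<rho> (C * \<epsilon> ^ n * \<delta>) (\<lambda>y. f (u y) - f (v y))"
  shows "series_bound n x f C"
  unfolding series_bound_def
proof (intro conjI allI impI)
  fix \<rho> \<epsilon> and u :: "'a \<Rightarrow> 'b"
  assume "0 < \<rho>" "\<epsilon> \<le> 1" "vec_series x \<rho> \<epsilon> u"
  then show "pow_series x \<rho> (C * \<epsilon> ^ Suc n) (\<lambda>y. f (u y))"
    using assms(2) [OF _ vec_series_nonneg] by blast
next
  fix \<rho> \<epsilon> \<delta> and u v :: "'a \<Rightarrow> 'b"
  assume "0 < \<rho>" "\<epsilon> \<le> 1" "vec_series x \<rho> \<epsilon> u" "vec_series x \<rho> \<epsilon> v" "vec_series x \<rho> \<delta> (\<lambda>y. u y - v y)"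
  then show "pow_series x \<rho> (C * \<epsilon> ^ n * \<delta>) (\<lambda>y. f (u y) - f (v y))"
    using assms(3) [OF _ vec_series_nonneg _ vec_series_nonneg] by blast
qed (rule assms(1))

lemma series_bound_linear:
  fixes f :: "'b::euclidean_space \<Rightarrow> real"
  assumes "bounded_linear f"
  shows "series_bound 0 x f (\<Sum>b\<in>Basis. \<bar>f b\<bar>)"
proof -
  interpret bounded_linear f by fact
  have eq: "f z = (\<Sum>b\<in>Basis. f b * (z \<bullet> b))" for z
  proof -
    have "f z = f (\<Sum>b\<in>Basis. (z \<bullet> b) *\<^sub>R b)"
      by (simp only: euclidean_representation)
    then show ?thesis
      unfolding sum by (simp add: scaleR mult.commute)
  qed
  have *: "pow_series x \<rho> ((\<Sum>b\<in>Basis. \<bar>f b\<bar>) * M) (\<lambda>y. f (w y))" if "vec_series x \<rho> M w" "0 < \<rho>" for w \<rho> M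
  proof -
    have "pow_series x \<rho> (\<Sum>b\<in>Basis. \<bar>f b\<bar> * M) (\<lambda>y. \<Sum>b\<in>Basis. f b * (w y \<bullet> b))"
      using that by (intro pow_series_sum pow_series_cmult finite_Basis) (simp_all add: vec_series_def)
    then show ?thesis
      by (simp add: sum_distrib_right flip: eq)
  qed
  show ?thesis
  proof (rule series_boundI)
    show "0 \<le> (\<Sum>b\<in>Basis. \<bar>f b\<bar>)"
      by (simp add: sum_nonneg)
  qed (use * in \<open>simp_all flip: diff\<close>)
qed

lemma series_bound_lower:
  assumes "series_bound (Suc 0) x f C"
  shows "series_bound 0 x f C"
proof (rule series_boundI [OF series_bound_nonneg [OF assms]])
  note C = series_bound_nonneg [OF assms]
  show "pow_series x \<rho> (C * \<epsilon> ^ Suc 0) (\<lambda>y. f (u y))"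
    if "0 < \<rho>" "0 \<le> \<epsilon>" "\<epsilon> \<le> 1" "vec_series x \<rho> \<epsilon> u" for \<rho> \<epsilon> u
  proof (rule pow_series_mono [OF series_bound_value [OF assms that(1,3,4)]])
    show "C * \<epsilon> ^ Suc (Suc 0) \<le> C * \<epsilon> ^ Suc 0"
      using C that(2,3) by (simp add: mult_left_mono mult_left_le)
  qed
  show "pow_series x \<rho> (C * \<epsilon> ^ 0 * \<delta>) (\<lambda>y. f (u y) - f (v y))"
    if "0 < \<rho>" "0 \<le> \<epsilon>" "\<epsilon> \<le> 1" "0 \<le> \<delta>" "vec_series x \<rho> \<epsilon> u" "vec_series x \<rho> \<epsilon> v"
      "vec_series x \<rho> \<delta> (\<lambda>y. u y - v y)" for \<rho> \<epsilon> \<delta> u v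
  proof (rule pow_series_mono [OF series_bound_diff [OF assms that(1,3,5-7)]])
    show "C * \<epsilon> ^ Suc 0 * \<delta> \<le> C * \<epsilon> ^ 0 * \<delta>"
      using C that(2-4) by (simp add: mult_left_le mult_right_mono)
  qed
qed

lemma series_bound_add:
  assumes f: "series_bound n x f C" and g: "series_bound n x g D"
  shows "series_bound n x (\<lambda>z. f z + g z) (C + D)"
proof (rule series_boundI)
  show "pow_series x \<rho> ((C + D) * \<epsilon> ^ Suc n) (\<lambda>y. f (u y) + g (u y))"
    if "0 < \<rho>" "0 \<le> \<epsilon>" "\<epsilon> \<le> 1" "vec_series x \<rho> \<epsilon> u" for \<rho> \<epsilon> u
    unfolding distrib_right
    by (rule pow_series_add [OF that(1) series_bound_value [OF f that(1,3,4)] series_bound_value [OF g that(1,3,4)]])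
  show "pow_series x \<rho> ((C + D) * \<epsilon> ^ n * \<delta>) (\<lambda>y. f (u y) + g (u y) - (f (v y) + g (v y)))"
    if "0 < \<rho>" "0 \<le> \<epsilon>" "\<epsilon> \<le> 1" "0 \<le> \<delta>" "vec_series x \<rho> \<epsilon> u" "vec_series x \<rho> \<epsilon> v"
      "vec_series x \<rho> \<delta> (\<lambda>y. u y - v y)" for \<rho> \<epsilon> \<delta> u v
    unfolding distrib_right add_diff_add
    by (rule pow_series_add [OF that(1) series_bound_diff [OF f that(1,3,5-7)] series_bound_diff [OF g that(1,3,5-7)]])
qed (use series_bound_nonneg [OF f] series_bound_nonneg [OF g] in simp)

text \<open>The Lipschitz estimate comes from
\<open>f u * g u - f v * g v = f u * (g u - g v) + g v * (f u - f v)\<close>, whence the factor 2.\<close>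

lemma series_bound_mult:
  assumes f: "series_bound 0 x f C" and g: "series_bound 0 x g D"
  shows "series_bound (Suc 0) x (\<lambda>z. f z * g z) (2 * C * D)"
proof (rule series_boundI)
  note C = series_bound_nonneg [OF f] series_bound_nonneg [OF g]
  show "0 \<le> 2 * C * D"
    using C by simp
  show "pow_series x \<rho> (2 * C * D * \<epsilon> ^ Suc (Suc 0)) (\<lambda>y. f (u y) * g (u y))"
    if "0 < \<rho>" "0 \<le> \<epsilon>" "\<epsilon> \<le> 1" "vec_series x \<rho> \<epsilon> u" for \<rho> \<epsilon> u
  proof -
    have "pow_series x \<rho> (C * \<epsilon> ^ Suc 0 * (D * \<epsilon> ^ Suc 0)) (\<lambda>y. f (u y) * g (u y))"
      by (rule pow_series_mult [OF that(1) series_bound_value [OF f that(1,3,4)] series_bound_value [OF g that(1,3,4)]])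
        (use C that in simp)
    then show ?thesis
      by (rule pow_series_mono) (use C that in \<open>simp add: mult_ac\<close>)
  qed
  show "pow_series x \<rho> (2 * C * D * \<epsilon> ^ Suc 0 * \<delta>) (\<lambda>y. f (u y) * g (u y) - f (v y) * g (v y))"
    if "0 < \<rho>" "0 \<le> \<epsilon>" "\<epsilon> \<le> 1" "0 \<le> \<delta>" "vec_series x \<rho> \<epsilon> u" "vec_series x \<rho> \<epsilon> v"
      "vec_series x \<rho> \<delta> (\<lambda>y. u y - v y)" for \<rho> \<epsilon> \<delta> u v
  proof -
    have 1: "pow_series x \<rho> (C * \<epsilon> ^ Suc 0 * (D * \<epsilon> ^ 0 * \<delta>)) (\<lambda>y. f (u y) * (g (u y) - g (v y)))"
      by (rule pow_series_mult [OF that(1) series_bound_value [OF f that(1,3,5)] series_bound_diff [OF g that(1,3,5-7)]])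
        (use C that in simp)
    have 2: "pow_series x \<rho> (D * \<epsilon> ^ Suc 0 * (C * \<epsilon> ^ 0 * \<delta>)) (\<lambda>y. g (v y) * (f (u y) - f (v y)))"
      by (rule pow_series_mult [OF that(1) series_bound_value [OF g that(1,3,6)] series_bound_diff [OF f that(1,3,5-7)]])
        (use C that in simp)
    show ?thesis
      using pow_series_add [OF that(1) 1 2] by (simp add: algebra_simps)
  qed
qed

lemma series_bound_cmult:
  assumes f: "series_bound n x f C"
  shows "series_bound n x (\<lambda>z. k * f z) (\<bar>k\<bar> * C)"
proof (rule series_boundI)
  show "pow_series x \<rho> (\<bar>k\<bar> * C * \<epsilon> ^ Suc n) (\<lambda>y. k * f (u y))"
    if "0 < \<rho>" "0 \<le> \<epsilon>" "\<epsilon> \<le> 1" "vec_series x \<rho> \<epsilon> u" for \<rho> \<epsilon> u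
    unfolding mult.assoc by (rule pow_series_cmult [OF that(1) series_bound_value [OF f that(1,3,4)]])
  show "pow_series x \<rho> (\<bar>k\<bar> * C * \<epsilon> ^ n * \<delta>) (\<lambda>y. k * f (u y) - k * f (v y))"
    if "0 < \<rho>" "0 \<le> \<epsilon>" "\<epsilon> \<le> 1" "0 \<le> \<delta>" "vec_series x \<rho> \<epsilon> u" "vec_series x \<rho> \<epsilon> v"
      "vec_series x \<rho> \<delta> (\<lambda>y. u y - v y)" for \<rho> \<epsilon> \<delta> u v
    using pow_series_cmult [OF that(1) series_bound_diff [OF f that(1,3,5-7)], of k]
    by (simp add: mult.assoc right_diff_distrib)
qed (use series_bound_nonneg [OF f] in simp)

text \<open>The first-order Taylor expansion. For a product the remainder is
\<open>c * q' + c' * q + (l + q) * (l' + q')\<close>.\<close>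

lemma polynomial_split_order:
  fixes f :: "'b::euclidean_space \<Rightarrow> real" and x :: "'a::euclidean_space"
  assumes "real_polynomial_function f"
  shows "\<exists>c l q C. bounded_linear l \<and> series_bound (Suc 0) x q C \<and> f = (\<lambda>z. c + l z + q z)"
  using assms
proof (induction f rule: real_polynomial_function.induct)
  case (linear f)
  have "series_bound (Suc 0) x (\<lambda>z::'b. 0) 0"
    by (rule series_boundI) (use pow_series_const [of _ x 0] in simp_all)
  then show ?case
    using linear by (intro exI [of _ 0] exI [of _ f] exI [of _ "\<lambda>z. 0"] exI [of _ 0]) simp
next
  case (const c)
  have "series_bound (Suc 0) x (\<lambda>z::'b. 0) 0"
    by (rule series_boundI) (use pow_series_const [of _ x 0] in simp_all)
  then show ?case
    by (intro exI [of _ c] exI [of _ "\<lambda>z. 0"] exI [of _ 0]) simp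
next
  case (add f g)
  then obtain c l q C c' l' q' C' where "bounded_linear l" "series_bound (Suc 0) x q C" "f = (\<lambda>z. c + l z + q z)"
    "bounded_linear l'" "series_bound (Suc 0) x q' C'" "g = (\<lambda>z. c' + l' z + q' z)"
    by blast
  then show ?case
    by - (rule exI [of _ "c + c'"], rule exI [of _ "\<lambda>z. l z + l' z"], rule exI [of _ "\<lambda>z. q z + q' z"],
        rule exI [of _ "C + C'"], simp add: bounded_linear_add series_bound_add fun_eq_iff)
next
  case (mult f g)
  then obtain c l q C c' l' q' C' where fg: "bounded_linear l" "series_bound (Suc 0) x q C" "f = (\<lambda>z. c + l z + q z)"
    "bounded_linear l'" "series_bound (Suc 0) x q' C'" "g = (\<lambda>z. c' + l' z + q' z)"
    by blast
  have lin: "bounded_linear (\<lambda>z. c * l' z + c' * l z)"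
    using fg(1,4) by (intro bounded_linear_add bounded_linear_const_mult)
  note ord = series_bound_add [OF series_bound_cmult [OF fg(5), of c]
      series_bound_add [OF series_bound_cmult [OF fg(2), of c'] series_bound_mult
        [OF series_bound_add [OF series_bound_linear [OF fg(1)] series_bound_lower [OF fg(2)]]
            series_bound_add [OF series_bound_linear [OF fg(4)] series_bound_lower [OF fg(5)]]]]]
  show ?case
    by (rule exI [of _ "c * c'"], rule exI, rule exI, rule exI, intro conjI, rule lin, rule ord)
      (simp add: fg fun_eq_iff algebra_simps)
qed

lemma vec_series_const:
  fixes x :: "'a::euclidean_space" and s :: "'b::euclidean_space"
  assumes "0 < \<rho>" "norm s \<le> M"
  shows "vec_series x \<rho> M (\<lambda>_. s)"
  unfolding vec_series_def
proof
  fix b :: 'b assume "b \<in> Basis"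
  then have "\<bar>s \<bullet> b\<bar> \<le> M"
    using Basis_le_norm [of b s] assms(2) by linarith
  then show "pow_series x \<rho> M (\<lambda>_. s \<bullet> b)"
    by (rule pow_series_mono [OF pow_series_const [OF assms(1)]])
qed

lemma vec_series_add:
  assumes "0 < \<rho>" "vec_series x \<rho> M u" "vec_series x \<rho> N v"
  shows "vec_series x \<rho> (M + N) (\<lambda>y. u y + v y)"
  unfolding vec_series_def inner_add_left
  by (intro ballI pow_series_add) (use assms in \<open>simp_all add: vec_series_def\<close>)

lemma vec_series_minus:
  fixes u v :: "'a::euclidean_space \<Rightarrow> 'b::euclidean_space"
  assumes "0 < \<rho>" "vec_series x \<rho> M (\<lambda>y. u y - v y)"
  shows "vec_series x \<rho> M (\<lambda>y. v y - u y)"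
  unfolding vec_series_def
proof
  fix b :: 'b assume "b \<in> Basis"
  then have "pow_series x \<rho> (\<bar>- 1\<bar> * M) (\<lambda>y. - 1 * ((u y - v y) \<bullet> b))"
    using assms(2) by (intro pow_series_cmult assms(1)) (simp add: vec_series_def)
  then show "pow_series x \<rho> M (\<lambda>y. (v y - u y) \<bullet> b)"
    by (simp add: inner_diff_left)
qed

text \<open>Points are constant series.\<close>

lemma series_bound_points:
  fixes q :: "'b::euclidean_space \<Rightarrow> real"
  assumes "series_bound (Suc 0) x q C" "norm s \<le> \<epsilon>" "norm s' \<le> \<epsilon>" "\<epsilon> \<le> 1"
  shows "\<bar>q s - q s'\<bar> \<le> C * \<epsilon> * norm (s - s')"
proof -
  have "pow_series x 1 (C * \<epsilon> ^ Suc 0 * norm (s - s')) (\<lambda>y. q s - q s')"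
    by (rule series_bound_diff [OF assms(1) _ assms(4)]) (use assms(2,3) in \<open>simp_all add: vec_series_const\<close>)
  from pow_series_bound [OF this, of x] show ?thesis by simp
qed

lemma polynomial_quadratic_remainder:
  fixes f :: "'b::euclidean_space \<Rightarrow> real" and x :: "'a::euclidean_space"
  assumes "real_polynomial_function f" and f': "(f has_derivative f') (at 0)"
  shows "\<exists>C. series_bound (Suc 0) x (\<lambda>z. f z - f 0 - f' z) C"
proof -
  obtain c l q C where l: "bounded_linear l" and q: "series_bound (Suc 0) x q C" and f: "f = (\<lambda>z. c + l z + q z)"
    using polynomial_split_order [OF assms(1)] by blast
  note C = series_bound_nonneg [OF q]
  have "pow_series x 1 (C * 0 ^ Suc (Suc 0)) (\<lambda>y. q 0)"
    by (rule series_bound_value [OF q]) (simp_all add: vec_series_const)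
  from pow_series_bound [OF this, of x] have q0: "q 0 = 0"
    by simp
  have "(q has_derivative (\<lambda>_. 0)) (at 0)"
    unfolding has_derivative_at_alt
  proof (intro conjI allI impI)
    fix e :: real assume e: "0 < e"
    define d where "d = min 1 (e / (C + 1))"
    have d: "0 < d" using e C by (simp add: d_def)
    have "norm (q y - q 0 - 0) \<le> e * norm (y - 0)" if y: "norm (y - 0) < d" for y
    proof -
      have "\<bar>q y - q 0\<bar> \<le> C * norm y * norm (y - 0)"
        by (rule series_bound_points [OF q]) (use y in \<open>simp_all add: d_def\<close>)
      also have "\<dots> \<le> e * norm (y - 0)"
      proof (rule mult_right_mono)
        have "norm y * (C + 1) < e"
          using y C by (simp add: d_def pos_less_divide_eq)
        then show "C * norm y \<le> e"
          using norm_ge_zero [of y] by (simp add: distrib_left mult.commute del: norm_ge_zero)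
      qed simp
      finally show ?thesis by simp
    qed
    then show "\<exists>d>0. \<forall>y. norm (y - 0) < d \<longrightarrow> norm (q y - q 0 - 0) \<le> e * norm (y - 0)"
      using d by blast
  qed simp
  then have "(f has_derivative (\<lambda>z. 0 + l z + 0)) (at 0)"
    unfolding f by (intro has_derivative_add has_derivative_const bounded_linear_imp_has_derivative l)
  then have "f' = l"
    using has_derivative_unique [OF f'] by simp
  then have "(\<lambda>z. f z - f 0 - f' z) = q"
    using linear_0 [OF bounded_linear.linear [OF l]] by (simp add: f q0)
  with q show ?thesis by auto
qed

lemma vec_series_norm_le:
  fixes u :: "'a::euclidean_space \<Rightarrow> 'b::euclidean_space" and M :: real
  assumes "vec_series x \<rho> M u" "y \<in> ball x \<rho>"
  shows "norm (u y) \<le> DIM('b) * M"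
proof -
  have "norm (u y) \<le> (\<Sum>b\<in>Basis. \<bar>u y \<bullet> b\<bar>)"
    by (rule norm_le_l1)
  also have "\<dots> \<le> (\<Sum>b\<in>(Basis::'b set). M)"
    using assms by (intro sum_mono pow_series_bound) (auto simp: vec_series_def)
  finally show ?thesis by simp
qed

text \<open>With \<open>Q z = G z - G 0 - z\<close> the equation for \<open>z = s t\<close> becomes \<open>z = L (t - t0) - Q z\<close>. As \<open>Q\<close> is of second
order, the iteration of the right-hand side contracts by the factor 1/2 on power series of small norm, and
its limit is a power series. The same estimate at points gives the injectivity of \<open>G\<close>.\<close>

lemma analytic_right_inverse:
  fixes G :: "'e::euclidean_space \<Rightarrow> 'e" and L :: "'a::euclidean_space \<Rightarrow> 'e"
  assumes G: "polynomial_function G" and G': "(G has_derivative (\<lambda>z. z)) (at 0)" and L: "bounded_linear L"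
  obtains \<rho> \<eta> M s where "0 < \<rho>" "0 < \<eta>" "vec_series t0 \<rho> M s" "s t0 = 0"
    "\<And>t. t \<in> ball t0 \<rho> \<Longrightarrow> G (s t) = G 0 + L (t - t0) \<and> norm (s t) < \<eta>" "inj_on G (ball 0 \<eta>)"
proof -
  define Q where "Q z = G z - G 0 - z" for z
  have "\<exists>C. series_bound (Suc 0) t0 (\<lambda>z. Q z \<bullet> b) C" if "b \<in> Basis" for b
  proof -
    have "real_polynomial_function (\<lambda>z. G z \<bullet> b)"
      using G that by (simp add: polynomial_function_iff_Basis_inner)
    moreover have "((\<lambda>z. G z \<bullet> b) has_derivative (\<lambda>z. z \<bullet> b)) (at 0)"
      by (intro has_derivative_inner_left G')
    ultimately have "\<exists>C. series_bound (Suc 0) t0 (\<lambda>z. G z \<bullet> b - G 0 \<bullet> b - z \<bullet> b) C"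
      by (rule polynomial_quadratic_remainder)
    then show ?thesis
      by (simp add: Q_def inner_diff_left)
  qed
  then have "\<forall>b\<in>Basis. \<exists>C. series_bound (Suc 0) t0 (\<lambda>z. Q z \<bullet> b) C" by blast
  from bchoice [OF this] obtain Cb where Cb: "\<And>b. b \<in> Basis \<Longrightarrow> series_bound (Suc 0) t0 (\<lambda>z. Q z \<bullet> b) (Cb b)"
    by blast
  define C where "C = (\<Sum>b\<in>Basis. Cb b)"
  have CbC: "Cb b \<le> C" "0 \<le> Cb b" if "b \<in> Basis" for b
    unfolding C_def using Cb that by (auto intro!: member_le_sum series_bound_nonneg)
  have C: "0 \<le> C"
    unfolding C_def by (intro sum_nonneg CbC)
  define n where "n = real DIM('e)"
  have n: "1 \<le> n"
    unfolding n_def using DIM_positive [where 'a = 'e] by linarith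
  \<comment> \<open>On the ball of radius \<open>\<eta>\<close> the map \<open>Q\<close> is a contraction. A series of norm \<open>\<epsilon>\<close> takes its values
    in this ball, since each of its \<open>n\<close> coordinates is bounded by \<open>\<epsilon>\<close>.\<close>
  define \<eta> where "\<eta> = 1 / (4 * n * (C + 1))"
  define \<epsilon> where "\<epsilon> = \<eta> / (2 * n)"
  have nC: "1 \<le> n * (C + 1)"
    using mult_mono [of 1 n 1 "C + 1"] n C by simp
  have \<eta>: "0 < \<eta>" "\<eta> \<le> 1" "n * C * \<eta> < 1"
  proof -
    show "0 < \<eta>" "\<eta> \<le> 1"
      using nC n C by (simp_all add: \<eta>_def field_simps)
    have "n * C < 4 * n * (C + 1)"
      using n C by (intro le_less_trans [of "n * C" "n * (C + 1)"]) (simp_all add: mult_left_mono)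
    then show "n * C * \<eta> < 1"
      using n C by (simp add: \<eta>_def pos_divide_less_eq)
  qed
  have \<epsilon>: "0 < \<epsilon>" "\<epsilon> \<le> 1" "C * \<epsilon> \<le> 1 / 2" "n * \<epsilon> < \<eta>"
  proof -
    show "0 < \<epsilon>" "n * \<epsilon> < \<eta>"
      using \<eta> n by (simp_all add: \<epsilon>_def)
    have "\<epsilon> \<le> \<eta>"
      using \<eta> n by (simp add: \<epsilon>_def pos_divide_le_eq mult_le_cancel_left1)
    then show "\<epsilon> \<le> 1"
      using \<eta> by simp
    have *: "2 * (n * (C * \<epsilon>)) = C * \<eta>"
      using n by (simp add: \<epsilon>_def)
    have "C * \<eta> \<le> n * C * \<eta>"
      using mult_right_mono [OF n, of "C * \<eta>"] C \<eta>(1) by (simp add: mult.assoc)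
    then have "2 * (n * (C * \<epsilon>)) < 1"
      using \<eta>(3) unfolding * by linarith
    moreover have "C * \<epsilon> \<le> n * (C * \<epsilon>)"
      using mult_right_mono [OF n, of "C * \<epsilon>"] C \<open>0 < \<epsilon>\<close> by simp
    ultimately show "C * \<epsilon> \<le> 1 / 2" by linarith
  qed
  define K where "K = (\<Sum>b\<in>Basis. norm (L b))"
  have K: "0 \<le> K"
    by (simp add: K_def sum_nonneg)
  \<comment> \<open>The radius is so small that the inhomogeneous term \<open>L (t - t0)\<close> uses up only half of the norm \<open>\<epsilon>\<close>.\<close>
  define \<rho> where "\<rho> = \<epsilon> / (2 * (K + 1))"
  have \<rho>: "0 < \<rho>" "K * \<rho> \<le> \<epsilon> / 2"
  proof -
    show "0 < \<rho>" using \<epsilon>(1) K by (simp add: \<rho>_def)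
    have "2 * (K + 1) * \<rho> = \<epsilon>" using K by (simp add: \<rho>_def)
    then show "K * \<rho> \<le> \<epsilon> / 2" using \<open>0 < \<rho>\<close> by (simp add: algebra_simps)
  qed
  have Lser: "vec_series t0 \<rho> (\<epsilon> / 2) (\<lambda>t. L (t - t0))"
    unfolding vec_series_def
  proof
    fix b :: 'e assume b: "b \<in> Basis"
    have eq: "L z \<bullet> b = (\<Sum>a\<in>Basis. (L a \<bullet> b) * (z \<bullet> a))" for z
    proof -
      have "L z = L (\<Sum>a\<in>Basis. (z \<bullet> a) *\<^sub>R a)"
        by (simp only: euclidean_representation)
      also have "\<dots> = (\<Sum>a\<in>Basis. (z \<bullet> a) *\<^sub>R L a)"
        using bounded_linear.linear [OF L] by (simp add: linear_sum linear_cmul)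
      finally show ?thesis
        by (simp add: inner_sum_left mult.commute)
    qed
    have "pow_series t0 \<rho> (\<Sum>a\<in>Basis. \<bar>L a \<bullet> b\<bar> * \<rho>) (\<lambda>t. \<Sum>a\<in>Basis. (L a \<bullet> b) * ((t - t0) \<bullet> a))"
      by (intro pow_series_sum pow_series_cmult pow_series_coord finite_Basis \<rho>(1))
    moreover have "(\<Sum>a\<in>Basis. \<bar>L a \<bullet> b\<bar> * \<rho>) \<le> \<epsilon> / 2"
    proof -
      have "(\<Sum>a\<in>Basis. \<bar>L a \<bullet> b\<bar> * \<rho>) \<le> (\<Sum>a\<in>Basis. norm (L a) * \<rho>)"
        using b \<rho>(1) by (intro sum_mono mult_right_mono Basis_le_norm) simp_all
      also have "\<dots> = K * \<rho>"
        by (simp add: K_def sum_distrib_right)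
      finally show ?thesis using \<rho>(2) by linarith
    qed
    ultimately show "pow_series t0 \<rho> (\<epsilon> / 2) (\<lambda>t. L (t - t0) \<bullet> b)"
      by (rule pow_series_cong [OF pow_series_mono]) (rule eq)
  qed
  have Q0: "Q 0 = 0"
    by (simp add: Q_def)
  have Qdiff: "vec_series t0 \<rho> (\<delta> / 2) (\<lambda>t. Q (v t) - Q (u t))"
    if "vec_series t0 \<rho> \<epsilon> u" "vec_series t0 \<rho> \<epsilon> v" "vec_series t0 \<rho> \<delta> (\<lambda>t. v t - u t)" for u v \<delta>
    unfolding vec_series_def
  proof
    fix b :: 'e assume b: "b \<in> Basis"
    have "pow_series t0 \<rho> (Cb b * \<epsilon> ^ Suc 0 * \<delta>) (\<lambda>t. Q (v t) \<bullet> b - Q (u t) \<bullet> b)"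
      by (rule series_bound_diff [OF Cb [OF b] \<rho>(1) \<epsilon>(2) that(2,1,3)])
    moreover have "Cb b * \<epsilon> ^ Suc 0 * \<delta> \<le> \<delta> / 2"
    proof -
      have "Cb b * \<epsilon> \<le> C * \<epsilon>"
        using CbC [OF b] \<epsilon>(1) by (simp add: mult_right_mono)
      then have "Cb b * \<epsilon> \<le> 1 / 2"
        using \<epsilon>(3) by linarith
      from mult_right_mono [OF this vec_series_nonneg [OF that(3) \<rho>(1)]] show ?thesis by simp
    qed
    ultimately show "pow_series t0 \<rho> (\<delta> / 2) (\<lambda>t. (Q (v t) - Q (u t)) \<bullet> b)"
      unfolding inner_diff_left by (rule pow_series_mono)
  qed
  define it where "it = rec_nat (\<lambda>t. 0 :: 'e) (\<lambda>_ u t. L (t - t0) - Q (u t))"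
  have it: "it 0 = (\<lambda>t. 0)" "it (Suc k) = (\<lambda>t. L (t - t0) - Q (it k t))" for k
    by (simp_all add: it_def)
  have series: "vec_series t0 \<rho> (\<epsilon> * (1 - (1/2) ^ k)) (it k) \<and>
      vec_series t0 \<rho> (\<epsilon> * (1/2) ^ Suc k) (\<lambda>t. it (Suc k) t - it k t)" for k
  proof (induction k)
    case 0
    then show ?case
      using vec_series_const [OF \<rho>(1), of "0::'e" 0 t0] Lser by (simp add: it Q0)
  next
    case (Suc k)
    have "vec_series t0 \<rho> (\<epsilon> * (1 - (1/2) ^ k) + \<epsilon> * (1/2) ^ Suc k) (\<lambda>t. it k t + (it (Suc k) t - it k t))"
      using Suc by (intro vec_series_add \<rho>(1)) blast+
    then have 1: "vec_series t0 \<rho> (\<epsilon> * (1 - (1/2) ^ Suc k)) (it (Suc k))"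
      by (simp add: algebra_simps)
    have up: "vec_series t0 \<rho> \<epsilon> (it j)" if "vec_series t0 \<rho> (\<epsilon> * (1 - (1/2) ^ j)) (it j)" for j
    proof -
      have "\<epsilon> * (1 - (1/2) ^ j) \<le> \<epsilon>"
        using \<epsilon>(1) by (simp add: mult_le_cancel_left2)
      with that show ?thesis
        unfolding vec_series_def by (blast intro: pow_series_mono)
    qed
    have "vec_series t0 \<rho> (\<epsilon> * (1/2) ^ Suc k / 2) (\<lambda>t. Q (it k t) - Q (it (Suc k) t))"
      by (rule Qdiff [OF up [OF 1] up [OF conjunct1 [OF Suc]] vec_series_minus [OF \<rho>(1) conjunct2 [OF Suc]]])
    then show ?case
      using 1 by (simp add: it(2) [of "Suc k"] it(2) [of k])
  qed
  have dser: "pow_series t0 \<rho> (\<epsilon> * (1/2) ^ Suc k) (\<lambda>t. (it (Suc k) t - it k t) \<bullet> b)" if "b \<in> Basis" for k b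
    using series [of k] that unfolding vec_series_def by blast
  have geo: "(\<lambda>k. \<epsilon> * (1/2) ^ Suc k) sums \<epsilon>"
    using sums_mult [OF power_half_series, of \<epsilon>] by simp
  then have geoS: "((\<lambda>k. \<epsilon> * (1/2) ^ Suc k) has_sum \<epsilon>) UNIV"
    by (rule sums_nonneg_imp_has_sum) (use \<epsilon>(1) in simp)
  have dsum: "summable (\<lambda>k. norm ((it (Suc k) t - it k t) \<bullet> b))" if "t \<in> ball t0 \<rho>" "b \<in> Basis" for t b
  proof (rule summable_comparison_test' [OF sums_summable [OF geo]])
    show "norm (norm ((it (Suc k) t - it k t) \<bullet> b)) \<le> \<epsilon> * (1/2) ^ Suc k" if "0 \<le> k" for k
      using pow_series_bound [OF dser [OF \<open>b \<in> Basis\<close>] \<open>t \<in> ball t0 \<rho>\<close>, of k] by simp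
  qed
  define s where "s t = (\<Sum>b\<in>Basis. (\<Sum>k. (it (Suc k) t - it k t) \<bullet> b) *\<^sub>R b)" for t
  have sb: "s t \<bullet> b = (\<Sum>k. (it (Suc k) t - it k t) \<bullet> b)" if "b \<in> Basis" for t b
    unfolding s_def using that by (rule inner_sum_left_Basis)
  have hs: "((\<lambda>k. (it (Suc k) t - it k t) \<bullet> b) has_sum (s t \<bullet> b)) UNIV" if "t \<in> ball t0 \<rho>" "b \<in> Basis" for t b
    unfolding sb [OF that(2)] using summable_sums [OF summable_norm_cancel [OF dsum [OF that]]]
    by (rule norm_summable_imp_has_sum [OF dsum [OF that]])
  have s_series: "vec_series t0 \<rho> \<epsilon> s"
    unfolding vec_series_def
  proof
    fix b :: 'e assume b: "b \<in> Basis"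
    show "pow_series t0 \<rho> \<epsilon> (\<lambda>t. s t \<bullet> b)"
      by (rule pow_series_infsum [OF \<rho>(1) dser [OF b] geoS hs [OF _ b]])
  qed
  have G_s: "G (s t) = G 0 + L (t - t0)" if t: "t \<in> ball t0 \<rho>" for t
  proof -
    have "(\<lambda>k. it k t \<bullet> b) \<longlonglongrightarrow> s t \<bullet> b" if b: "b \<in> Basis" for b
    proof -
      have "(\<lambda>k. \<Sum>j<k. (it (Suc j) t - it j t) \<bullet> b) \<longlonglongrightarrow> s t \<bullet> b"
        using has_sum_imp_sums [OF hs [OF t b]] by (simp add: sums_def)
      moreover have "(\<Sum>j<k. (it (Suc j) t - it j t) \<bullet> b) = it k t \<bullet> b" for k
        unfolding inner_diff_left sum_lessThan_telescope [of "\<lambda>j. it j t \<bullet> b"] by (simp add: it(1))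
      ultimately show ?thesis by simp
    qed
    then have lim: "(\<lambda>k. it k t) \<longlonglongrightarrow> s t"
      by (subst tendsto_componentwise_iff) simp
    have "isCont Q (s t)"
      unfolding Q_def [abs_def] by (intro continuous_intros continuous_polymonial_function G)
    from isCont_tendsto_compose [OF this lim]
    have "(\<lambda>k. L (t - t0) - Q (it k t)) \<longlonglongrightarrow> L (t - t0) - Q (s t)"
      by (intro tendsto_intros)
    moreover have "(\<lambda>k. it (Suc k) t) \<longlonglongrightarrow> s t"
      using lim by (rule LIMSEQ_Suc)
    ultimately have "s t = L (t - t0) - Q (s t)"
      unfolding it(2) by (metis LIMSEQ_unique)
    then have "G (s t) - G 0 = L (t - t0)"
      by (simp add: Q_def algebra_simps)
    then show ?thesis
      by (simp add: algebra_simps)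
  qed
  have norm_s: "norm (s t) < \<eta>" if "t \<in> ball t0 \<rho>" for t
    using vec_series_norm_le [OF s_series that] \<epsilon>(4) by (simp add: n_def)
  have inj: "inj_on G (ball 0 \<eta>)"
  proof (rule inj_onI)
    fix z z' assume z: "z \<in> ball 0 \<eta>" "z' \<in> ball 0 \<eta>" "G z = G z'"
    have "norm (Q z - Q z') \<le> (\<Sum>b\<in>Basis. \<bar>(Q z - Q z') \<bullet> b\<bar>)"
      by (rule norm_le_l1)
    also have "\<dots> \<le> (\<Sum>b\<in>(Basis::'e set). C * \<eta> * norm (z - z'))"
    proof (rule sum_mono)
      fix b :: 'e assume b: "b \<in> Basis"
      have "\<bar>Q z \<bullet> b - Q z' \<bullet> b\<bar> \<le> Cb b * \<eta> * norm (z - z')"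
        by (rule series_bound_points [OF Cb [OF b]]) (use z \<eta> in simp_all)
      also have "\<dots> \<le> C * \<eta> * norm (z - z')"
        using CbC [OF b] \<eta>(1) by (intro mult_right_mono) simp_all
      finally show "\<bar>(Q z - Q z') \<bullet> b\<bar> \<le> C * \<eta> * norm (z - z')"
        by (simp add: inner_diff_left)
    qed
    also have "\<dots> = n * C * \<eta> * norm (z - z')"
      by (simp add: n_def)
    finally have le: "norm (z - z') \<le> n * C * \<eta> * norm (z - z')"
      using z(3) by (simp add: Q_def norm_minus_commute)
    show "z = z'"
    proof (rule ccontr)
      assume "z \<noteq> z'"
      then have "n * C * \<eta> * norm (z - z') < 1 * norm (z - z')"
        using \<eta>(3) by (intro mult_strict_right_mono) simp_all
      with le show False by simp
    qed
  qed
  have "s t0 = 0"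
  proof (rule inj_onD [OF inj])
    show "G (s t0) = G 0"
      using G_s [of t0] \<rho>(1) linear_0 [OF bounded_linear.linear [OF L]] by simp
  qed (use norm_s [of t0] \<rho>(1) \<eta>(1) in simp_all)
  then show thesis
    using that [OF \<rho>(1) \<eta>(1) s_series _ _ inj] G_s norm_s by blast
qed

lemma vec_series_affine_analytic:
  fixes s :: "'a::euclidean_space \<Rightarrow> 'b::euclidean_space" and R :: "'b \<Rightarrow> 'c::euclidean_space"
  assumes s: "vec_series t0 \<rho> M s" and R: "bounded_linear R" and t: "t \<in> ball t0 \<rho>"
  shows "real_analytic_at (\<lambda>t. p + R (s t)) t"
proof (rule real_analytic_atI)
  show \<rho>': "0 < \<rho> - dist t0 t"
    using t by simp
  then have \<rho>: "0 < \<rho>"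
    using zero_le_dist [of t0 t] by linarith
  fix c :: 'c
  have eq: "(p + R z) \<bullet> c = p \<bullet> c + (\<Sum>b\<in>Basis. (R b \<bullet> c) * (z \<bullet> b))" for z
  proof -
    have "R z = R (\<Sum>b\<in>Basis. (z \<bullet> b) *\<^sub>R b)"
      by (simp only: euclidean_representation)
    also have "\<dots> = (\<Sum>b\<in>Basis. (z \<bullet> b) *\<^sub>R R b)"
      using bounded_linear.linear [OF R] by (simp add: linear_sum linear_cmul)
    finally show ?thesis
      by (simp add: inner_sum_left inner_add_left mult.commute)
  qed
  have "pow_series t0 \<rho> (\<bar>p \<bullet> c\<bar> + (\<Sum>b\<in>Basis. \<bar>R b \<bullet> c\<bar> * M)) (\<lambda>t. p \<bullet> c + (\<Sum>b\<in>Basis. (R b \<bullet> c) * (s t \<bullet> b)))"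
    by (intro pow_series_add pow_series_const pow_series_sum pow_series_cmult finite_Basis \<rho>)
      (use s in \<open>simp add: vec_series_def\<close>)
  then have "pow_series t (\<rho> - dist t0 t) (\<bar>p \<bullet> c\<bar> + (\<Sum>b\<in>Basis. \<bar>R b \<bullet> c\<bar> * M))
      (\<lambda>t. p \<bullet> c + (\<Sum>b\<in>Basis. (R b \<bullet> c) * (s t \<bullet> b)))"
    by (rule pow_series_recentre) (use t in simp)
  then show "\<exists>M. pow_series t (\<rho> - dist t0 t) M (\<lambda>t. (p + R (s t)) \<bullet> c)"
    unfolding eq by blast
qed

lemma polynomial_function_bilinear:
  fixes f :: "'x::real_normed_vector \<Rightarrow> 'a::euclidean_space" and g :: "'x \<Rightarrow> 'b::euclidean_space"
    and h :: "'a \<Rightarrow> 'b \<Rightarrow> 'c::euclidean_space"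
  assumes h: "bounded_bilinear h" and f: "polynomial_function f" and g: "polynomial_function g"
  shows "polynomial_function (\<lambda>x. h (f x) (g x))"
proof -
  interpret bounded_bilinear h by fact
  have eq: "h (f x) (g x) = (\<Sum>b\<in>Basis. \<Sum>c\<in>Basis. (f x \<bullet> b) *\<^sub>R ((g x \<bullet> c) *\<^sub>R h b c))" for x
  proof -
    have "h (f x) (g x) = h (\<Sum>b\<in>Basis. (f x \<bullet> b) *\<^sub>R b) (g x)"
      by (simp only: euclidean_representation)
    also have "\<dots> = (\<Sum>b\<in>Basis. (f x \<bullet> b) *\<^sub>R h b (g x))"
      by (simp only: sum_left scaleR_left)
    also have "\<dots> = (\<Sum>b\<in>Basis. (f x \<bullet> b) *\<^sub>R h b (\<Sum>c\<in>Basis. (g x \<bullet> c) *\<^sub>R c))"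
      by (simp only: euclidean_representation)
    also have "\<dots> = (\<Sum>b\<in>Basis. \<Sum>c\<in>Basis. (f x \<bullet> b) *\<^sub>R ((g x \<bullet> c) *\<^sub>R h b c))"
      by (simp only: sum_right scaleR_right scaleR_sum_right)
    finally show ?thesis .
  qed
  have f': "polynomial_function (\<lambda>x. f x \<bullet> b)" if "b \<in> Basis" for b
    using f that by (simp add: polynomial_function_iff_Basis_inner)
  have g': "polynomial_function (\<lambda>x. g x \<bullet> b)" if "b \<in> Basis" for b
    using g that by (simp add: polynomial_function_iff_Basis_inner)
  show ?thesis
    unfolding eq
    by (intro polynomial_function_sum finite_Basis polynomial_function_mult [OF f']
        polynomial_function_mult [OF g'] polynomial_function_const)
qed

section \<open>Two by two quaternionic matrices\<close>

lemma mat2_nth [simp]: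
  "mat2 a b c d $ 1 $ 1 = a" "mat2 a b c d $ 1 $ 2 = b" "mat2 a b c d $ 2 $ 1 = c" "mat2 a b c d $ 2 $ 2 = d"
  by (simp_all add: mat2_def)

lemma mat2_eq_iff: "(A :: mat2) = B \<longleftrightarrow> A$1$1 = B$1$1 \<and> A$1$2 = B$1$2 \<and> A$2$1 = B$2$1 \<and> A$2$2 = B$2$2"
  by (auto simp: vec_eq_iff forall_2)

lemma mat2_eta: "mat2 (A$1$1) (A$1$2) (A$2$1) (A$2$2) = A"
  by (simp add: mat2_eq_iff)

lemma mat2_cases: obtains a b c d where "A = mat2 a b c d"
  by (metis mat2_eta)

lemma mat2_inject [simp]: "mat2 a b c d = mat2 a' b' c' d' \<longleftrightarrow> a = a' \<and> b = b' \<and> c = c' \<and> d = d'"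
  by (simp add: mat2_eq_iff)

lemma mat2_mult [simp]:
  "mat2 a b c d ** mat2 e f g h = mat2 (a*e + b*g) (a*f + b*h) (c*e + d*g) (c*f + d*h)"
  by (simp add: mat2_eq_iff matrix_matrix_mult_def sum_2)

lemma mat2_one: "mat 1 = mat2 1 0 0 1"
  by (simp add: mat2_eq_iff mat_def)

lemma mat2_add [simp]: "mat2 a b c d + mat2 e f g h = mat2 (a + e) (b + f) (c + g) (d + h)"
  by (simp add: mat2_eq_iff)

lemma mat2_diff [simp]: "mat2 a b c d - mat2 e f g h = mat2 (a - e) (b - f) (c - g) (d - h)"
  by (simp add: mat2_eq_iff)

lemma mat2_scaleR [simp]: "r *\<^sub>R mat2 a b c d = mat2 (r *\<^sub>R a) (r *\<^sub>R b) (r *\<^sub>R c) (r *\<^sub>R d)"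
  by (simp add: mat2_eq_iff)

lemma mat2_mult_scaleR [simp]:
  fixes A B :: mat2
  shows "(r *\<^sub>R A) ** B = r *\<^sub>R (A ** B)" "A ** (r *\<^sub>R B) = r *\<^sub>R (A ** B)"
  by (cases A rule: mat2_cases; cases B rule: mat2_cases; simp add: scaleR_add_right)+

lemma bounded_bilinear_matrix_mult: "bounded_bilinear ((**) :: mat2 \<Rightarrow> mat2 \<Rightarrow> mat2)"
  unfolding bilinear_conv_bounded_bilinear [symmetric] bilinear_def
  by (auto intro!: linearI simp: matrix_matrix_mult_def vec_eq_iff sum_2 algebra_simps)

lemma tr2_mat2 [simp]: "tr2 (mat2 a b c d) = Re0 a + Re0 d"
  by (simp add: tr2_def)

section \<open>The Dieudonne determinant is multiplicative\<close>

lemma dieudonne_det_mat2: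
  "dieudonne_det (mat2 a b c d) = (if a \<noteq> 0 then norm a * norm (d - c * inverse a * b) else norm c * norm b)"
proof -
  have "a * d - a * c * inverse a * b = a * (d - c * inverse a * b)"
    by (simp add: right_diff_distrib mult.assoc)
  then show ?thesis
    by (simp add: dieudonne_det_def norm_mult)
qed

lemma dieudonne_det_nonneg: "0 \<le> dieudonne_det A"
  by (simp add: dieudonne_det_def Let_def)

lemma dieudonne_det_lower: "dieudonne_det (mat2 1 0 x 1 ** B) = dieudonne_det B"
proof (cases B rule: mat2_cases)
  case (1 a b c d)
  have "x * b + d - (x * a + c) * inverse a * b = d - c * inverse a * b" if "a \<noteq> 0"
    using that by (simp add: distrib_right mult.assoc)
  then show ?thesis
    unfolding 1 mat2_mult dieudonne_det_mat2
    by (cases "a = 0")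
      (simp_all only: mult_1_left mult_zero_left add_0_right add_0_left mult_zero_right simp_thms if_True if_False)
qed

lemma dieudonne_det_diag: "dieudonne_det (mat2 x 0 0 y ** B) = norm x * norm y * dieudonne_det B"
proof (cases B rule: mat2_cases)
  case (1 a b c d)
  show ?thesis
  proof (cases "x = 0")
    case True
    then show ?thesis by (simp add: 1 dieudonne_det_mat2)
  next
    case False
    have "y * d - y * c * inverse (x * a) * (x * b) = y * (d - c * inverse a * b)" if "a \<noteq> 0"
      using that False by (simp add: nonzero_inverse_mult_distrib right_diff_distrib mult.assoc)
        (simp flip: mult.assoc)
    then show ?thesis
      using False by (simp add: 1 dieudonne_det_mat2 norm_mult)
  qed
qed

lemma dieudonne_det_swap: "dieudonne_det (mat2 0 1 1 0 ** B) = dieudonne_det B"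
proof (cases B rule: mat2_cases)
  case (1 a b c d)
  have "norm c * norm (b - a * inverse c * d) = norm a * norm (d - c * inverse a * b)"
    if "a \<noteq> 0" "c \<noteq> 0"
  proof -
    have "b - a * inverse c * d = - (a * inverse c * (d - c * inverse a * b))"
      using that by (simp add: right_diff_distrib mult.assoc) (simp flip: mult.assoc)
    then show ?thesis
      using that by (simp add: norm_mult norm_inverse)
  qed
  then show ?thesis
    by (auto simp: 1 dieudonne_det_mat2)
qed

text \<open>Gaussian elimination: the left factors for which the formula holds are closed under products, contain the
elementary matrices, and hence contain all matrices with nonzero first column. If the first column is
zero, both sides vanish.\<close>

lemma dieudonne_det_mult: "dieudonne_det (A ** B) = dieudonne_det A * dieudonne_det B"
proof -
  define mult where "mult A \<longleftrightarrow> (\<forall>B. dieudonne_det (A ** B) = dieudonne_det A * dieudonne_det B)" for A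
  have prod: "mult (A ** B)" if "mult A" "mult B" for A B
    using that by (simp add: mult_def flip: matrix_mul_assoc)
  have diag: "mult (mat2 x 0 0 y)" and lower: "mult (mat2 1 0 x 1)" and swap: "mult (mat2 0 1 1 0)" for x y
    unfolding mult_def dieudonne_det_diag dieudonne_det_lower dieudonne_det_swap
    by (simp_all add: dieudonne_det_mat2)
  have pivot: "mult (mat2 a b c d)" if "a \<noteq> 0" for a b c d
  proof -
    have "mat2 a b c d = mat2 1 0 (c * inverse a) 1 ** (mat2 a 0 0 (d - c * inverse a * b) **
        (mat2 0 1 1 0 ** (mat2 1 0 (inverse a * b) 1 ** mat2 0 1 1 0)))"
      using that by (simp add: mult.assoc) (simp flip: mult.assoc)
    then show ?thesis
      by (simp only:) (intro prod diag lower swap)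
  qed
  have "mult A"
  proof (cases A rule: mat2_cases)
    case (1 a b c d)
    consider "a \<noteq> 0" | "a = 0" "c \<noteq> 0" | "a = 0" "c = 0" by blast
    then show ?thesis
    proof cases
      case 2
      have "A = mat2 0 1 1 0 ** mat2 c d a b" by (simp add: 1)
      then show ?thesis using prod [OF swap pivot] 2 by simp
    next
      case 3
      have "dieudonne_det (mat2 0 b 0 d ** B) = 0" for B
      proof (cases B rule: mat2_cases)
        case (1 e f g h)
        have "d * h - d * g * inverse (b * g) * (b * h) = 0" if "b \<noteq> 0" "g \<noteq> 0"
          using that by (simp add: nonzero_inverse_mult_distrib mult.assoc) (simp flip: mult.assoc)
        then show ?thesis
          by (auto simp: 1 dieudonne_det_mat2)
      qed
      then show ?thesis
        by (simp add: mult_def 1 3 dieudonne_det_mat2)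
    qed (simp add: 1 pivot)
  qed
  then show ?thesis
    by (simp add: mult_def)
qed

section \<open>The adjugate\<close>

lemma quat_cnj_sel [simp]:
  "Re0 (quat_cnj x) = Re0 x" "Im1 (quat_cnj x) = - Im1 x" "Im2 (quat_cnj x) = - Im2 x" "Im3 (quat_cnj x) = - Im3 x"
  by (simp_all add: quat_cnj_def)

lemma quat_mult_cnj: "x * quat_cnj x = of_real ((norm x)\<^sup>2)" "quat_cnj x * x = of_real ((norm x)\<^sup>2)"
  unfolding quat_norm_sq by (simp_all add: quat_eq_iff power2_eq_square)

lemma quat_cnj_mult: "quat_cnj (x * y) = quat_cnj y * quat_cnj x"
  by (simp add: quat_eq_iff)

lemma quat_cnj_cnj [simp]: "quat_cnj (quat_cnj x) = x"
  by (simp add: quat_eq_iff)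

lemma Re0_mult_commute: "Re0 (x * y) = Re0 (y * x)"
  by (simp add: mult.commute)

text \<open>The Study determinant, which is the square of the Dieudonne determinant (\<open>sq_det_eq\<close> below). Unlike the
latter it is a polynomial in the real coordinates of the entries.\<close>

definition sq_det :: "mat2 \<Rightarrow> real"
  where "sq_det A = (let a = A$1$1; b = A$1$2; c = A$2$1; d = A$2$2 in
    (norm a)\<^sup>2 * (norm d)\<^sup>2 + (norm b)\<^sup>2 * (norm c)\<^sup>2 - 2 * Re0 (quat_cnj a * b * quat_cnj d * c))"

text \<open>The matrix \<open>sq_det A *\<^sub>R matrix_inv A\<close>, written as a polynomial so that it makes sense for all \<open>A\<close>.\<close>

definition adj2 :: "mat2 \<Rightarrow> mat2"
  where "adj2 A = (let a = A$1$1; b = A$1$2; c = A$2$1; d = A$2$2 in mat2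
    ((norm d)\<^sup>2 *\<^sub>R quat_cnj a - quat_cnj c * d * quat_cnj b)
    ((norm b)\<^sup>2 *\<^sub>R quat_cnj c - quat_cnj a * b * quat_cnj d)
    ((norm c)\<^sup>2 *\<^sub>R quat_cnj b - quat_cnj d * c * quat_cnj a)
    ((norm a)\<^sup>2 *\<^sub>R quat_cnj d - quat_cnj b * a * quat_cnj c))"

lemma adj2_mat2: "adj2 (mat2 a b c d) = mat2
    ((norm d)\<^sup>2 *\<^sub>R quat_cnj a - quat_cnj c * d * quat_cnj b)
    ((norm b)\<^sup>2 *\<^sub>R quat_cnj c - quat_cnj a * b * quat_cnj d)
    ((norm c)\<^sup>2 *\<^sub>R quat_cnj b - quat_cnj d * c * quat_cnj a)
    ((norm a)\<^sup>2 *\<^sub>R quat_cnj d - quat_cnj b * a * quat_cnj c)"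
  by (simp add: adj2_def)

lemma sq_det_mat2: "sq_det (mat2 a b c d) =
    (norm a)\<^sup>2 * (norm d)\<^sup>2 + (norm b)\<^sup>2 * (norm c)\<^sup>2 - 2 * Re0 (quat_cnj a * b * quat_cnj d * c)"
  by (simp add: sq_det_def)

lemma quat_cancel_cnj:
  "x * (quat_cnj x * y) = (norm x)\<^sup>2 *\<^sub>R y" "quat_cnj x * (x * y) = (norm x)\<^sup>2 *\<^sub>R y"
  using quat_mult_cnj [of x] by (simp_all flip: mult.assoc add: scaleR_conv_of_real)

lemma quat_mult_cnj_scaleR: "x * quat_cnj x = (norm x)\<^sup>2 *\<^sub>R 1" "quat_cnj x * x = (norm x)\<^sup>2 *\<^sub>R 1"
  using quat_mult_cnj [of x] by (simp_all add: scaleR_conv_of_real)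

lemma quat_sub_cnj_pair: "x = quat_cnj y \<Longrightarrow> u *\<^sub>R 1 - x + (v *\<^sub>R 1 - y) = (u + v - 2 * Re0 y) *\<^sub>R (1 :: quat)"
  by (simp add: quat_eq_iff)

lemma mult_adj2: "A ** adj2 A = sq_det A *\<^sub>R mat 1"
proof (cases A rule: mat2_cases)
  case (1 a b c d)
  have rot: "Re0 (b * (quat_cnj d * (c * quat_cnj a))) = Re0 (quat_cnj a * b * quat_cnj d * c)"
    using Re0_mult_commute [of "quat_cnj a" "b * quat_cnj d * c"] by (simp only: mult.assoc)
  have rot': "Re0 (d * (quat_cnj b * (a * quat_cnj c))) = Re0 (quat_cnj a * b * quat_cnj d * c)"
  proof -
    have "quat_cnj (d * (quat_cnj b * (a * quat_cnj c))) = c * (quat_cnj a * b * quat_cnj d)"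
      by (simp add: quat_cnj_mult mult.assoc)
    then have "Re0 (d * (quat_cnj b * (a * quat_cnj c))) = Re0 (c * (quat_cnj a * b * quat_cnj d))"
      by (metis quat_cnj_sel(1))
    then show ?thesis
      using Re0_mult_commute by metis
  qed
  have e11: "a * ((norm d)\<^sup>2 *\<^sub>R quat_cnj a - quat_cnj c * d * quat_cnj b)
      + b * ((norm c)\<^sup>2 *\<^sub>R quat_cnj b - quat_cnj d * c * quat_cnj a) = sq_det A *\<^sub>R 1"
    using quat_sub_cnj_pair [of "a * (quat_cnj c * (d * quat_cnj b))" "b * (quat_cnj d * (c * quat_cnj a))"]
    by (simp add: 1 sq_det_mat2 right_diff_distrib mult.assoc quat_cnj_mult quat_mult_cnj_scaleR rot mult.commute
        del: quat_mult_sel)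
  have e22: "c * ((norm b)\<^sup>2 *\<^sub>R quat_cnj c - quat_cnj a * b * quat_cnj d)
      + d * ((norm a)\<^sup>2 *\<^sub>R quat_cnj d - quat_cnj b * a * quat_cnj c) = sq_det A *\<^sub>R 1"
    using quat_sub_cnj_pair [of "c * (quat_cnj a * (b * quat_cnj d))" "d * (quat_cnj b * (a * quat_cnj c))"]
    by (simp add: 1 sq_det_mat2 right_diff_distrib mult.assoc quat_cnj_mult quat_mult_cnj_scaleR rot' algebra_simps
        del: quat_mult_sel)
  show ?thesis
    using e11 e22
    by (simp add: 1 adj2_mat2 mat2_one right_diff_distrib mult.assoc quat_cancel_cnj)
qed

lemma adj2_mult: "adj2 A ** A = sq_det A *\<^sub>R mat 1"
proof (cases A rule: mat2_cases)
  case (1 a b c d)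
  have e11: "((norm d)\<^sup>2 *\<^sub>R quat_cnj a - quat_cnj c * d * quat_cnj b) * a
      + ((norm b)\<^sup>2 *\<^sub>R quat_cnj c - quat_cnj a * b * quat_cnj d) * c = sq_det A *\<^sub>R 1"
    using quat_sub_cnj_pair [of "quat_cnj c * (d * (quat_cnj b * a))" "quat_cnj a * (b * (quat_cnj d * c))"]
    by (simp add: 1 sq_det_mat2 left_diff_distrib mult.assoc quat_cnj_mult quat_mult_cnj_scaleR mult.commute
        del: quat_mult_sel)
  have *: "Re0 (quat_cnj b * (a * (quat_cnj c * d))) = Re0 (quat_cnj a * (b * (quat_cnj d * c)))"
    by (simp add: algebra_simps)
  have e22: "((norm c)\<^sup>2 *\<^sub>R quat_cnj b - quat_cnj d * c * quat_cnj a) * b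
      + ((norm a)\<^sup>2 *\<^sub>R quat_cnj d - quat_cnj b * a * quat_cnj c) * d = sq_det A *\<^sub>R 1"
    using quat_sub_cnj_pair [of "quat_cnj d * (c * (quat_cnj a * b))" "quat_cnj b * (a * (quat_cnj c * d))"]
    by (simp add: 1 sq_det_mat2 left_diff_distrib mult.assoc quat_cnj_mult quat_mult_cnj_scaleR * algebra_simps
        del: quat_mult_sel)
  show ?thesis
    using e11 e22
    by (simp add: 1 adj2_mat2 mat2_one left_diff_distrib mult.assoc quat_cancel_cnj quat_mult_cnj_scaleR)
qed

lemma sq_det_eq: "sq_det A = (dieudonne_det A)\<^sup>2"
proof (cases A rule: mat2_cases)
  case (1 a b c d)
  show ?thesis
  proof (cases "a = 0")
    case True
    then show ?thesis
      by (simp add: 1 sq_det_mat2 dieudonne_det_mat2 power_mult_distrib)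
  next
    case False
    define n where "n = (norm a)\<^sup>2"
    have n: "n \<noteq> 0" using False by (simp add: n_def)
    have eq: "n *\<^sub>R (d - c * inverse a * b) = n *\<^sub>R d - c * quat_cnj a * b"
      using n by (simp add: inverse_quat_def n_def scaleR_diff_right)
    have in_eq: "inner d (c * quat_cnj a * b) = Re0 (quat_cnj a * b * quat_cnj d * c)"
      by (simp add: inner_quat_def algebra_simps)
    have "n\<^sup>2 * (norm (d - c * inverse a * b))\<^sup>2 = (norm (n *\<^sub>R d - c * quat_cnj a * b))\<^sup>2"
      by (simp flip: eq add: power_mult_distrib)
    also have "\<dots> = n\<^sup>2 * (norm d)\<^sup>2 + (norm c)\<^sup>2 * n * (norm b)\<^sup>2 - 2 * n * Re0 (quat_cnj a * b * quat_cnj d * c)"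
    proof -
      have "norm (quat_cnj a) = norm a"
        by (simp add: norm_quat_def inner_quat_def)
      then show ?thesis
        unfolding power2_norm_eq_inner [of "n *\<^sub>R d - c * quat_cnj a * b"] inner_diff_left inner_diff_right
        by (simp add: inner_commute [of "c * quat_cnj a * b"] in_eq power2_norm_eq_inner [symmetric]
            norm_mult power_mult_distrib n_def power2_eq_square del: quat_mult_sel)
    qed
    finally have "n * (n * (norm (d - c * inverse a * b))\<^sup>2) = n * sq_det A"
      by (simp add: 1 sq_det_mat2 n_def power2_eq_square algebra_simps del: quat_mult_sel)
    then show ?thesis
      using n False unfolding mult_cancel_left by (simp add: 1 dieudonne_det_mat2 power_mult_distrib n_def)
  qed
qed

lemma matrix_inv_eq_adj2:
  assumes "sq_det A \<noteq> 0"
  shows "matrix_inv A = (1 / sq_det A) *\<^sub>R adj2 A"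
  by (rule matrix_inv_eqI) (use assms in \<open>simp_all add: mult_adj2 adj2_mult\<close>)

lemma dieudonne_det_one: "dieudonne_det (mat 1) = 1"
  by (simp add: mat2_one dieudonne_det_mat2)

lemma invertible_iff_sq_det: "invertible A \<longleftrightarrow> sq_det A \<noteq> 0"
proof
  assume "invertible (A :: mat2)"
  then obtain B where "A ** B = mat 1" by (auto simp: invertible_def)
  then have "dieudonne_det A * dieudonne_det B = 1"
    by (simp flip: dieudonne_det_mult add: dieudonne_det_one)
  then show "sq_det A \<noteq> 0"
    by (auto simp: sq_det_eq)
next
  assume "sq_det A \<noteq> 0"
  then have "A ** ((1 / sq_det A) *\<^sub>R adj2 A) = mat 1 \<and> ((1 / sq_det A) *\<^sub>R adj2 A) ** A = mat 1"
    by (simp add: mult_adj2 adj2_mult)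
  then show "invertible A"
    unfolding invertible_def by blast
qed

lemma SL2H_iff: "A \<in> SL2H \<longleftrightarrow> sq_det A = 1"
  using dieudonne_det_nonneg [of A]
  by (auto simp: SL2H_def invertible_iff_sq_det sq_det_eq power2_eq_1_iff)

lemma sq_det_mult: "sq_det (A ** B) = sq_det A * sq_det B"
  by (simp add: sq_det_eq dieudonne_det_mult power_mult_distrib)

lemma sq_det_nonneg: "0 \<le> sq_det A"
  by (simp add: sq_det_eq)

lemma sq_det_one [simp]: "sq_det (mat 1) = 1"
  by (simp add: sq_det_eq dieudonne_det_one)

lemma sq_det_scaleR: "sq_det (r *\<^sub>R A) = r ^ 4 * sq_det A"
  by (cases A rule: mat2_cases)
    (simp add: sq_det_mat2 power_mult_distrib power2_eq_square power4_eq_xxxx algebra_simps)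

lemma adj2_scaleR: "adj2 (r *\<^sub>R A) = r ^ 3 *\<^sub>R adj2 A"
  by (cases A rule: mat2_cases)
    (simp add: adj2_mat2 quat_eq_iff power2_eq_square power3_eq_cube power_mult_distrib algebra_simps)

lemma sq_det_conj_by: "invertible P \<Longrightarrow> sq_det (conj_by P A) = sq_det A"
proof -
  assume P: "invertible P"
  have "sq_det P * sq_det (matrix_inv P) = 1"
    by (simp flip: sq_det_mult add: matrix_inv_cancel [OF P])
  then show ?thesis
    by (simp add: conj_by_def sq_det_mult)
qed

lemma conj_by_scaleR: "conj_by P (r *\<^sub>R A) = r *\<^sub>R conj_by P A"
  by (simp add: conj_by_def)

lemma adj2_eq_inv: "invertible A \<Longrightarrow> adj2 A = sq_det A *\<^sub>R matrix_inv A"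
  by (simp add: matrix_inv_eq_adj2 invertible_iff_sq_det)

lemma adj2_conj_by:
  assumes "invertible P" "invertible A"
  shows "adj2 (conj_by P A) = conj_by P (adj2 A)"
proof -
  have "invertible (conj_by P A)"
    using assms by (simp add: invertible_iff_sq_det sq_det_conj_by)
  then show ?thesis
    using assms by (simp add: adj2_eq_inv conj_by_inv sq_det_conj_by conj_by_scaleR)
qed

lemma conj_by_conj_by:
  assumes "invertible P" "invertible Q"
  shows "conj_by P (conj_by Q A) = conj_by (P ** Q) A"
proof -
  have "matrix_inv (P ** Q) = matrix_inv Q ** matrix_inv P"
  proof (rule matrix_inv_eqI)
    have "P ** Q ** (matrix_inv Q ** matrix_inv P) = P ** (Q ** matrix_inv Q) ** matrix_inv P"
      by (simp add: matrix_mul_assoc)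
    then show "P ** Q ** (matrix_inv Q ** matrix_inv P) = mat 1"
      by (simp add: matrix_inv_cancel assms)
    have "matrix_inv Q ** matrix_inv P ** (P ** Q) = matrix_inv Q ** (matrix_inv P ** P) ** Q"
      by (simp add: matrix_mul_assoc)
    then show "matrix_inv Q ** matrix_inv P ** (P ** Q) = mat 1"
      by (simp add: matrix_inv_cancel assms)
  qed
  then show ?thesis
    by (simp add: conj_by_def matrix_mul_assoc)
qed

lemma conj_by_one [simp]: "conj_by (mat 1) A = A"
  using matrix_inv_eqI [of "mat 1" "mat 1"] by (simp add: conj_by_def)

lemma invertible_matrix_inv: "invertible P \<Longrightarrow> invertible (matrix_inv P)" for P :: mat2
  using matrix_inv_cancel by (auto simp: invertible_def)

lemma conj_by_inv_cancel:
  assumes "invertible P"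
  shows "conj_by (matrix_inv P) (conj_by P A) = A" "conj_by P (conj_by (matrix_inv P) A) = A"
  using assms by (simp_all add: conj_by_conj_by invertible_matrix_inv matrix_inv_cancel)

lemma conj_by_scale_frame:
  assumes "r \<noteq> 0" "invertible P"
  shows "conj_by (r *\<^sub>R P) A = conj_by P A"
proof -
  have "matrix_inv (r *\<^sub>R P) = (1 / r) *\<^sub>R matrix_inv P"
    by (rule matrix_inv_eqI) (use assms in \<open>simp_all add: matrix_inv_cancel\<close>)
  then show ?thesis
    using assms by (simp add: conj_by_def)
qed

text \<open>The determinant is positive, so it can be normalised by a positive real factor, and real factors do not
affect conjugation.\<close>

lemma conj_by_SL2H:
  assumes "invertible P"
  obtains Q where "Q \<in> SL2H" "\<And>A. conj_by Q A = conj_by P A"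
proof -
  define r where "r = root 4 (1 / sq_det P)"
  have pos: "0 < sq_det P"
    using assms sq_det_nonneg [of P] by (simp add: invertible_iff_sq_det)
  then have r: "0 < r" "r ^ 4 = 1 / sq_det P"
    by (simp_all add: r_def real_root_pow_pos2)
  then have "r *\<^sub>R P \<in> SL2H"
    using pos by (simp add: SL2H_iff sq_det_scaleR)
  then show thesis
    using that r(1) conj_by_scale_frame [OF _ assms] by (metis less_irrefl)
qed

section \<open>The traces as polynomials on pairs of matrices\<close>

text \<open>The function \<^const>\<open>vector\<close> fills the components in the cyclic order of the index type, starting at
index 1.\<close>

lemma vector_nth_of_nat:
  fixes xs :: "'a::zero list"
  assumes "length xs \<le> CHAR('n)" "k < length xs"
  shows "(vector xs :: 'a^'n::{comm_ring_1,finite}) $ (1 + of_nat k) = xs ! k"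
proof -
  have "foldr (\<lambda>x f n. (f (n + 1))(n := x)) xs (\<lambda>n x. 0) (m :: 'n) (m + of_nat k) = xs ! k" for m
    using assms
  proof (induction xs arbitrary: m k)
    case Nil
    then show ?case by simp
  next
    case (Cons x xs)
    show ?case
    proof (cases k)
      case 0
      then show ?thesis by simp
    next
      case (Suc l)
      have "of_nat k \<noteq> (0 :: 'n)"
        unfolding of_nat_eq_0_iff_char_dvd using Cons.prems Suc by (auto dest: dvd_imp_le)
      moreover have "m + of_nat k = (m + 1) + of_nat l"
        by (simp add: Suc add.assoc)
      ultimately show ?thesis
        using Cons.IH [of l "m + 1"] Cons.prems Suc by (simp add: add.assoc)
    qed
  qed
  then show ?thesis
    by (simp add: vector_def add.commute)
qed

text \<open>The position in \<^const>\<open>trace_words\<close> of a component, the components being numbered 1, ..., 14, 15 = 0.\<close>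

definition word_index :: "15 \<Rightarrow> nat"
  where "word_index j = (SOME k. k < 15 \<and> j = 1 + of_nat k)"

lemma word_index: "word_index j < 15 \<and> j = 1 + of_nat (word_index j)"
proof -
  have inj: "inj_on (\<lambda>k. 1 + of_nat k :: 15) {..<15}"
  proof (rule inj_onI)
    fix k l :: nat assume kl: "k \<in> {..<15}" "l \<in> {..<15}" "1 + of_nat k = (1 + of_nat l :: 15)"
    have *: "k = l" if "k \<le> l" "l < 15" "of_nat k = (of_nat l :: 15)" for k l :: nat
    proof -
      have "of_nat (l - k) = (0 :: 15)"
        using that by (simp add: of_nat_diff)
      then have "15 dvd l - k"
        unfolding of_nat_eq_0_iff_char_dvd by simp
      then show ?thesis
        using that by (auto dest: dvd_imp_le)
    qed
    show "k = l"
      using kl *[of k l] *[of l k] by (cases "k \<le> l") auto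
  qed
  have "(\<lambda>k. 1 + of_nat k :: 15) ` {..<15} = UNIV"
    by (rule card_subset_eq) (simp_all add: card_image [OF inj])
  then have "j \<in> (\<lambda>k. 1 + of_nat k :: 15) ` {..<15}"
    by (simp only: UNIV_I)
  then have "\<exists>k. k < 15 \<and> j = 1 + of_nat k"
    by blast
  then show ?thesis
    unfolding word_index_def by (rule someI_ex)
qed

lemma trace_map_nth: "trace_map m $ j = trace_fun (trace_words ! word_index j) m"
proof -
  have "length trace_words = 15" by (simp add: trace_words_def)
  then have "trace_map m $ (1 + of_nat (word_index j)) = trace_fun (trace_words ! word_index j) m"
    unfolding trace_map_def using conjunct1 [OF word_index [of j]] by (subst vector_nth_of_nat) simp_all
  then show ?thesis
    by (simp only: conjunct2 [OF word_index [of j], symmetric])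
qed

text \<open>Inverses are letters of their own, for which both inverses and adjugates can be substituted.\<close>

definition formal_words :: "(mat2 \<Rightarrow> mat2 \<Rightarrow> mat2 \<Rightarrow> mat2 \<Rightarrow> mat2) list"
  where "formal_words =
   [\<lambda>A a B b. A,
    \<lambda>A a B b. a,
    \<lambda>A a B b. A ** A,
    \<lambda>A a B b. B,
    \<lambda>A a B b. b,
    \<lambda>A a B b. B ** B,
    \<lambda>A a B b. A ** B,
    \<lambda>A a B b. A ** b,
    \<lambda>A a B b. a ** B,
    \<lambda>A a B b. a ** b,
    \<lambda>A a B b. A ** A ** B,
    \<lambda>A a B b. A ** B ** B,
    \<lambda>A a B b. A ** A ** B ** B,
    \<lambda>A a B b. A ** B ** A ** b,
    \<lambda>A a B b. A ** B ** a ** b]"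

lemma trace_words_formal:
  "trace_words = map (\<lambda>f A B. f A (matrix_inv A) B (matrix_inv B)) formal_words"
  by (simp add: trace_words_def formal_words_def)

lemma length_formal_words: "length formal_words = 15"
  by (simp add: formal_words_def)

text \<open>On \<open>SL(2,H)\<close> adjugates are inverses, so that the first fifteen components are the traces of the words,
and the last two components cut out the pairs in \<open>SL(2,H)\<close>.\<close>

definition ext_trace :: "mpair \<Rightarrow> real^(15 + bool)"
  where "ext_trace p = (\<chi> i. case i of
      Inl j \<Rightarrow> tr2 ((formal_words ! word_index j) (fst p) (adj2 (fst p)) (snd p) (adj2 (snd p)))
    | Inr b \<Rightarrow> sq_det (if b then fst p else snd p))"

lemma formal_word_mem: "formal_words ! word_index j \<in> set formal_words"
  using conjunct1 [OF word_index [of j]] by (simp add: length_formal_words)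

lemma ext_trace_SL2H:
  assumes "A \<in> SL2H" "B \<in> SL2H"
  shows "ext_trace (A, B) = (\<chi> i. case i of Inl j \<Rightarrow> trace_map (pair_class (A, B)) $ j | Inr b \<Rightarrow> 1)"
proof -
  have inv: "invertible A" "invertible B" and adj: "adj2 A = matrix_inv A" "adj2 B = matrix_inv B"
    using assms by (simp_all add: SL2H_iff invertible_iff_sq_det matrix_inv_eq_adj2)
  have "trace_map (pair_class (A, B)) $ j
      = tr2 ((formal_words ! word_index j) A (matrix_inv A) B (matrix_inv B))" for j
  proof -
    have "trace_words ! word_index j \<in> set trace_words"
      using conjunct1 [OF word_index [of j]] by (simp add: trace_words_formal length_formal_words)
    from trace_fun_pair_class [OF this inv] show ?thesis
      using conjunct1 [OF word_index [of j]] by (simp add: trace_map_nth trace_words_formal length_formal_words)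
  qed
  then show ?thesis
    using assms by (auto simp: ext_trace_def vec_eq_iff adj SL2H_iff split: sum.split)
qed

lemma ext_trace_conj_by:
  assumes P: "invertible P" and A: "invertible A" and B: "invertible B"
  shows "ext_trace (conj_by P A, conj_by P B) = ext_trace (A, B)"
proof -
  have word: "f (conj_by P A) (conj_by P a) (conj_by P B) (conj_by P b) = conj_by P (f A a B b)"
    if "f \<in> set formal_words" for f and A a B b
    using that by (auto simp: formal_words_def conj_by_mult [OF P])
  then show ?thesis
    unfolding ext_trace_def
    by (intro arg_cong [of _ _ vec_lambda] ext)
      (simp add: adj2_conj_by P A B word [OF formal_word_mem] tr2_conj_by sq_det_conj_by split: sum.split)
qed

lemma tr2_scaleR: "tr2 (r *\<^sub>R A) = r * tr2 A"
  by (cases A rule: mat2_cases) (simp add: distrib_left)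

text \<open>Every component is homogeneous in each of the two matrices, so the rank of the derivative can be
studied at pairs of matrices whose determinants are not normalised.\<close>

lemma ext_trace_scale:
  assumes "r \<noteq> 0" "s \<noteq> 0"
  obtains \<kappa> where "\<And>i. \<kappa> i \<noteq> 0" "\<And>A B i. ext_trace (r *\<^sub>R A, s *\<^sub>R B) $ i = \<kappa> i * ext_trace (A, B) $ i"
proof -
  \<comment> \<open>The degrees of the words in the two matrices; an adjugate counts with degree 3.\<close>
  define weights :: "(nat \<times> nat) list" where "weights =
    [(1, 0), (3, 0), (2, 0), (0, 1), (0, 3), (0, 2), (1, 1), (1, 3), (3, 1), (3, 3), (2, 1), (1, 2), (2, 2), (2, 4), (4, 4)]"
  have "list_all2 (\<lambda>f (m, n). \<forall>A a B b. f (r *\<^sub>R A) (r ^ 3 *\<^sub>R a) (s *\<^sub>R B) (s ^ 3 *\<^sub>R b) = (r ^ m * s ^ n) *\<^sub>R f A a B b)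
      formal_words weights"
    unfolding formal_words_def weights_def
    by (simp add: power2_eq_square power3_eq_cube power4_eq_xxxx mult_ac)
  then have w: "(formal_words ! k) (r *\<^sub>R A) (r ^ 3 *\<^sub>R a) (s *\<^sub>R B) (s ^ 3 *\<^sub>R b)
      = (r ^ fst (weights ! k) * s ^ snd (weights ! k)) *\<^sub>R (formal_words ! k) A a B b" if "k < 15" for k A a B b
    using that by (auto simp: list_all2_conv_all_nth length_formal_words case_prod_unfold)
  define \<kappa> :: "15 + bool \<Rightarrow> real" where "\<kappa> i = (case i of
      Inl j \<Rightarrow> r ^ fst (weights ! word_index j) * s ^ snd (weights ! word_index j) | Inr b \<Rightarrow> (if b then r else s) ^ 4)" for i
  show thesis
  proof (rule that)
    show "\<kappa> i \<noteq> 0" for i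
      using assms by (auto simp: \<kappa>_def split: sum.split)
    show "ext_trace (r *\<^sub>R A, s *\<^sub>R B) $ i = \<kappa> i * ext_trace (A, B) $ i" for A B i
      using conjunct1 [OF word_index] by (auto simp: ext_trace_def \<kappa>_def adj2_scaleR w tr2_scaleR sq_det_scaleR split: sum.split)
  qed
qed

section \<open>Polynomial dependence on the entries\<close>

lemma bounded_linear_nth2: "bounded_linear (\<lambda>A :: mat2. A $ i $ j)"
  by (intro bounded_linear_compose [OF bounded_linear_vec_nth] bounded_linear_vec_nth)

lemma bounded_linear_quat_cnj: "bounded_linear quat_cnj"
  by (rule linear_conv_bounded_linear [THEN iffD1]) (auto intro!: linearI simp: quat_eq_iff)

lemma bounded_linear_Re0: "bounded_linear Re0"
  by (rule linear_conv_bounded_linear [THEN iffD1]) (auto intro!: linearI)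

lemma polynomial_function_linear_image:
  fixes f :: "'x::real_normed_vector \<Rightarrow> 'a::real_normed_vector"
  assumes "bounded_linear h" "polynomial_function f"
  shows "polynomial_function (\<lambda>x. h (f x))"
  using polynomial_function_compose [OF assms(2) polynomial_function_bounded_linear [OF assms(1)]] by (simp add: o_def)

lemmas polynomial_quat_intros =
  polynomial_function_linear_image [OF bounded_linear_nth2]
  polynomial_function_linear_image [OF bounded_linear_quat_cnj]
  polynomial_function_linear_image [OF bounded_linear_Re0]
  polynomial_function_bilinear [OF bounded_bilinear_mult]
  polynomial_function_add polynomial_function_diff polynomial_function_const

lemma polynomial_norm_sq:
  fixes f :: "'x::real_normed_vector \<Rightarrow> quat"
  assumes "polynomial_function f"
  shows "polynomial_function (\<lambda>x. (norm (f x))\<^sup>2)"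
  unfolding power2_norm_eq_inner by (rule polynomial_function_bilinear [OF bounded_bilinear_inner assms assms])

lemma polynomial_sq_det:
  assumes "polynomial_function f"
  shows "polynomial_function (\<lambda>x. sq_det (f x))"
  unfolding sq_det_def Let_def by (intro polynomial_quat_intros polynomial_norm_sq assms)

lemma polynomial_mat2:
  fixes a b c d :: "'x::real_normed_vector \<Rightarrow> quat"
  assumes "polynomial_function a" "polynomial_function b" "polynomial_function c" "polynomial_function d"
  shows "polynomial_function (\<lambda>x. mat2 (a x) (b x) (c x) (d x))"
proof -
  have l: "bounded_linear (\<lambda>a. mat2 a 0 0 0)" "bounded_linear (\<lambda>a. mat2 0 a 0 0)"
    "bounded_linear (\<lambda>a. mat2 0 0 a 0)" "bounded_linear (\<lambda>a. mat2 0 0 0 a)"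
    by (rule linear_conv_bounded_linear [THEN iffD1], rule linearI, simp_all)+
  have "polynomial_function (\<lambda>x. mat2 (a x) 0 0 0 + mat2 0 (b x) 0 0 + mat2 0 0 (c x) 0 + mat2 0 0 0 (d x))"
    by (intro polynomial_function_add polynomial_function_linear_image [OF l(1) assms(1)]
        polynomial_function_linear_image [OF l(2) assms(2)] polynomial_function_linear_image [OF l(3) assms(3)]
        polynomial_function_linear_image [OF l(4) assms(4)])
  then show ?thesis
    by simp
qed

lemma polynomial_adj2:
  assumes "polynomial_function f"
  shows "polynomial_function (\<lambda>x. adj2 (f x))"
  unfolding adj2_def Let_def
  by (intro polynomial_mat2 polynomial_quat_intros polynomial_norm_sq polynomial_function_mult assms)

lemma polynomial_tr2:
  assumes "polynomial_function f"
  shows "polynomial_function (\<lambda>x. tr2 (f x))"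
  unfolding tr2_def by (intro polynomial_quat_intros assms)

lemma polynomial_matrix_mult:
  fixes f g :: "'x::real_normed_vector \<Rightarrow> mat2"
  assumes "polynomial_function f" "polynomial_function g"
  shows "polynomial_function (\<lambda>x. f x ** g x)"
  by (rule polynomial_function_bilinear [OF bounded_bilinear_matrix_mult assms])

lemma polynomial_ext_trace: "polynomial_function ext_trace"
proof -
  have fs: "polynomial_function (fst :: mpair \<Rightarrow> mat2)" "polynomial_function (snd :: mpair \<Rightarrow> mat2)"
    by (intro polynomial_function_bounded_linear bounded_linear_fst bounded_linear_snd)+
  have word: "polynomial_function (\<lambda>p. f (fst p) (adj2 (fst p)) (snd p) (adj2 (snd p)))"
    if "f \<in> set formal_words" for f
    using that fs by (auto simp: formal_words_def intro!: polynomial_matrix_mult polynomial_adj2)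
  have comp: "polynomial_function (\<lambda>p. ext_trace p $ i)" for i
  proof (cases i)
    case (Inl j)
    then show ?thesis
      by (simp add: ext_trace_def polynomial_tr2 word formal_word_mem)
  next
    case (Inr b)
    then show ?thesis
      using fs by (cases b) (simp_all add: ext_trace_def polynomial_sq_det)
  qed
  have "polynomial_function (\<lambda>p. ext_trace p \<bullet> b)" if "b \<in> Basis" for b
  proof -
    obtain i where "b = axis i 1"
      using \<open>b \<in> Basis\<close> by (auto simp: Basis_vec_def)
    then show ?thesis
      using comp [of i] by (simp add: inner_axis)
  qed
  then show ?thesis
    unfolding polynomial_function_iff_Basis_inner [of ext_trace] real_polynomial_function_eq by blast
qed

lemma real_polynomial_derivative:
  fixes f :: "'a::real_normed_vector \<Rightarrow> real"
  assumes "real_polynomial_function f"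
  shows "\<exists>D. (\<forall>p. (f has_derivative D p) (at p)) \<and> (\<forall>v. real_polynomial_function (\<lambda>p. D p v))"
  using assms
proof (induction f rule: real_polynomial_function.induct)
  case (linear f)
  then show ?case
    by (intro exI [of _ "\<lambda>p. f"]) (auto intro: bounded_linear_imp_has_derivative)
next
  case (const c)
  then show ?case
    by (intro exI [of _ "\<lambda>p v. 0"]) auto
next
  case (add f g)
  then obtain D E where "\<forall>p. (f has_derivative D p) (at p)" "\<forall>v. real_polynomial_function (\<lambda>p. D p v)"
    "\<forall>p. (g has_derivative E p) (at p)" "\<forall>v. real_polynomial_function (\<lambda>p. E p v)" by blast
  then show ?case
    by (intro exI [of _ "\<lambda>p v. D p v + E p v"]) (auto intro!: derivative_intros)
next
  case (mult f g)
  then obtain D E where "\<forall>p. (f has_derivative D p) (at p)" "\<forall>v. real_polynomial_function (\<lambda>p. D p v)"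
    "\<forall>p. (g has_derivative E p) (at p)" "\<forall>v. real_polynomial_function (\<lambda>p. E p v)" by blast
  with mult.hyps show ?case
    by (intro exI [of _ "\<lambda>p v. f p * E p v + D p v * g p"] conjI allI has_derivative_mult
        real_polynomial_function.intros(3) real_polynomial_function.intros(4)) simp_all
qed

abbreviation ext_trace_deriv :: "mpair \<Rightarrow> mpair \<Rightarrow> real^(15 + bool)"
  where "ext_trace_deriv p \<equiv> frechet_derivative ext_trace (at p)"

lemma has_derivative_ext_trace: "(ext_trace has_derivative ext_trace_deriv p) (at p)"
  using differentiable_at_polynomial_function [OF polynomial_ext_trace] by (simp add: frechet_derivative_works)

lemma polynomial_ext_trace_deriv: "real_polynomial_function (\<lambda>p. ext_trace_deriv p v $ i)"
proof -
  have "real_polynomial_function (\<lambda>p. ext_trace p $ i)"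
    using polynomial_function_linear_image [OF bounded_linear_vec_nth polynomial_ext_trace]
    by (simp add: real_polynomial_function_eq)
  then obtain D where D: "\<And>p. ((\<lambda>p. ext_trace p $ i) has_derivative D p) (at p)" "\<And>v. real_polynomial_function (\<lambda>p. D p v)"
    using real_polynomial_derivative by blast
  have "D p v = ext_trace_deriv p v $ i" for p
    using has_derivative_unique [OF D(1) bounded_linear.has_derivative [OF bounded_linear_vec_nth has_derivative_ext_trace]]
    by metis
  with D(2) [of v] show ?thesis by simp
qed

section \<open>The conjugation action to first order\<close>

lemma continuous_sq_det: "continuous_on S sq_det"
  by (rule continuous_on_polymonial_function) (rule polynomial_sq_det [OF polynomial_function_id])

lemma open_sq_det_nonzero: "open {A. sq_det A \<noteq> 0}"
  by (intro open_Collect_neq continuous_sq_det continuous_on_const)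

lemma continuous_on_matrix_inv: "continuous_on {A. sq_det A \<noteq> 0} (matrix_inv :: mat2 \<Rightarrow> mat2)"
proof -
  have "continuous_on {A. sq_det A \<noteq> 0} (\<lambda>A. (1 / sq_det A) *\<^sub>R adj2 A)"
    by (intro continuous_intros continuous_sq_det
        continuous_on_polymonial_function [OF polynomial_adj2 [OF polynomial_function_id]]) simp
  then show ?thesis
    by (rule continuous_on_cong [THEN iffD1, rotated -1]) (simp_all add: matrix_inv_eq_adj2)
qed

text \<open>The inverse is differentiable because it is a quotient of polynomials; its derivative then follows from
\<open>A ** matrix_inv A = mat 1\<close>.\<close>

lemma has_derivative_matrix_inv: "((matrix_inv :: mat2 \<Rightarrow> mat2) has_derivative uminus) (at (mat 1))"
proof -
  have "(\<lambda>A. (1 / sq_det A) *\<^sub>R adj2 A) differentiable (at (mat 1))"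
    by (intro derivative_intros differentiable_at_polynomial_function
        differentiable_at_polynomial_function [OF polynomial_adj2 [OF polynomial_function_id]]
        differentiable_at_polynomial_function [OF polynomial_sq_det [OF polynomial_function_id]]) simp
  then obtain E where E: "((\<lambda>A. (1 / sq_det A) *\<^sub>R adj2 A) has_derivative E) (at (mat 1))"
    by (auto simp: differentiable_def)
  have inv: "(matrix_inv has_derivative E) (at (mat 1 :: mat2))"
    by (rule has_derivative_transform_within_open [OF E open_sq_det_nonzero]) (simp_all add: matrix_inv_eq_adj2)
  have inv1: "matrix_inv (mat 1) = (mat 1 :: mat2)"
    by (rule matrix_inv_eqI) simp_all
  have "((\<lambda>A :: mat2. A ** matrix_inv A) has_derivative (\<lambda>X. mat 1 ** E X + X ** matrix_inv (mat 1))) (at (mat 1))"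
    by (rule bounded_bilinear.FDERIV [OF bounded_bilinear_matrix_mult has_derivative_ident inv])
  then have "((\<lambda>A :: mat2. mat 1) has_derivative (\<lambda>X. mat 1 ** E X + X ** matrix_inv (mat 1))) (at (mat 1 :: mat2))"
    by (rule has_derivative_transform_within_open [OF _ open_sq_det_nonzero])
      (simp_all add: matrix_inv_cancel invertible_iff_sq_det)
  then have "(\<lambda>X. mat 1 ** E X + X ** matrix_inv (mat 1)) = (\<lambda>X. 0)"
    by (rule has_derivative_unique) (rule has_derivative_const)
  then have "E X + X = 0" for X
    by (simp add: fun_eq_iff inv1)
  then have "E = uminus"
    by (simp add: fun_eq_iff eq_neg_iff_add_eq_0)
  with inv show ?thesis by simp
qed

lemma has_derivative_conj_by:
  assumes g: "(g has_derivative g') (at z within S)" "g z = mat 1"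
    and q: "(q has_derivative q') (at z within S)"
  shows "((\<lambda>z. conj_by (g z) (q z)) has_derivative (\<lambda>h. g' h ** q z - q z ** g' h + q' h)) (at z within S)"
proof -
  have "((\<lambda>z. matrix_inv (g z)) has_derivative (\<lambda>h. - g' h)) (at z within S)"
    using has_derivative_compose [OF g(1), of matrix_inv uminus] has_derivative_matrix_inv g(2) by simp
  note bounded_bilinear.FDERIV [OF bounded_bilinear_matrix_mult
      bounded_bilinear.FDERIV [OF bounded_bilinear_matrix_mult g(1) q] this]
  moreover have inv1: "matrix_inv (mat 1) = (mat 1 :: mat2)"
    by (rule matrix_inv_eqI) simp_all
  moreover have "q z ** - g' h = - (q z ** g' h)" for h
    by (simp add: bounded_bilinear.minus_right [OF bounded_bilinear_matrix_mult])
  ultimately show ?thesis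
    unfolding conj_by_def by (simp add: g(2) algebra_simps)
qed

lemma continuous_on_conj_by:
  assumes "continuous_on T g" "continuous_on T q" "\<And>z. z \<in> T \<Longrightarrow> sq_det (g z) \<noteq> 0"
  shows "continuous_on T (\<lambda>z. conj_by (g z) (q z))"
  unfolding conj_by_def
  by (intro bounded_bilinear.continuous_on [OF bounded_bilinear_matrix_mult] assms(1,2)
      continuous_on_compose2 [OF continuous_on_matrix_inv assms(1)]) (use assms(3) in auto)

text \<open>The direction is tangent to the curve of conjugates by \<open>mat 1 + t *\<^sub>R X\<close>, along which \<^const>\<open>ext_trace\<close>
is constant.\<close>

lemma ext_trace_deriv_orbit:
  assumes "invertible A" "invertible B"
  shows "ext_trace_deriv (A, B) (X ** A - A ** X, X ** B - B ** X) = 0"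
proof -
  define g where "g t = mat 1 + t *\<^sub>R X" for t :: real
  have g: "(g has_derivative (\<lambda>t. t *\<^sub>R X)) (at 0)" "g 0 = mat 1"
    by (auto simp: g_def [abs_def] intro!: derivative_eq_intros)
  have "((\<lambda>t. (conj_by (g t) A, conj_by (g t) B)) has_derivative
      (\<lambda>t. (t *\<^sub>R X ** A - A ** (t *\<^sub>R X) + 0, t *\<^sub>R X ** B - B ** (t *\<^sub>R X) + 0))) (at 0)"
    by (intro has_derivative_Pair has_derivative_conj_by g has_derivative_const)
  then have "((\<lambda>t. ext_trace (conj_by (g t) A, conj_by (g t) B)) has_derivative
      (\<lambda>t. ext_trace_deriv (A, B) (t *\<^sub>R X ** A - A ** (t *\<^sub>R X) + 0, t *\<^sub>R X ** B - B ** (t *\<^sub>R X) + 0))) (at 0)"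
    by (rule has_derivative_compose) (simp add: g(2) has_derivative_ext_trace)
  moreover have "((\<lambda>t. ext_trace (conj_by (g t) A, conj_by (g t) B)) has_derivative (\<lambda>t. 0)) (at 0)"
  proof (rule has_derivative_transform_within_open [where f = "\<lambda>t. ext_trace (A, B)"])
    have "continuous_on UNIV (\<lambda>t. sq_det (g t))"
      unfolding g_def [abs_def]
      by (intro continuous_intros continuous_on_compose2 [OF continuous_sq_det [of UNIV]]) auto
    then show "open {t. sq_det (g t) \<noteq> 0}"
      by (intro open_Collect_neq continuous_on_const)
    show "ext_trace (A, B) = ext_trace (conj_by (g t) A, conj_by (g t) B)" if "t \<in> {t. sq_det (g t) \<noteq> 0}" for t
      using that assms by (simp add: ext_trace_conj_by invertible_iff_sq_det)
  qed (auto simp: g(2))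
  ultimately have "(\<lambda>t. ext_trace_deriv (A, B) (t *\<^sub>R X ** A - A ** (t *\<^sub>R X) + 0, t *\<^sub>R X ** B - B ** (t *\<^sub>R X) + 0)) = (\<lambda>t. 0)"
    by (rule has_derivative_unique)
  from fun_cong [OF this, of 1] show ?thesis by simp
qed

section \<open>A pair at which the traces are independent\<close>

lemmas has_derivative_matrix_mult = bounded_bilinear.FDERIV [OF bounded_bilinear_matrix_mult]

text \<open>The derivatives of \<^const>\<open>formal_words\<close> when only \<open>B\<close> and \<open>b\<close> vary, with velocities \<open>B'\<close> and
\<open>b'\<close>.\<close>

definition word_derivs :: "(mat2 \<Rightarrow> mat2 \<Rightarrow> mat2 \<Rightarrow> mat2 \<Rightarrow> mat2 \<Rightarrow> mat2 \<Rightarrow> mat2) list"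
  where "word_derivs =
   [\<lambda>A a B b B' b'. 0,
    \<lambda>A a B b B' b'. 0,
    \<lambda>A a B b B' b'. 0,
    \<lambda>A a B b B' b'. B',
    \<lambda>A a B b B' b'. b',
    \<lambda>A a B b B' b'. B ** B' + B' ** B,
    \<lambda>A a B b B' b'. A ** B',
    \<lambda>A a B b B' b'. A ** b',
    \<lambda>A a B b B' b'. a ** B',
    \<lambda>A a B b B' b'. a ** b',
    \<lambda>A a B b B' b'. A ** A ** B',
    \<lambda>A a B b B' b'. A ** B ** B' + A ** B' ** B,
    \<lambda>A a B b B' b'. A ** A ** B ** B' + A ** A ** B' ** B,
    \<lambda>A a B b B' b'. A ** B ** A ** b' + A ** B' ** A ** b,
    \<lambda>A a B b B' b'. A ** B ** a ** b' + A ** B' ** a ** b]"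

lemma has_derivative_formal_word:
  fixes U V :: "real \<Rightarrow> mat2"
  assumes U: "(U has_derivative U') (at t)" and V: "(V has_derivative V') (at t)" and k: "k < 15"
  shows "((\<lambda>t. (formal_words ! k) A a (U t) (V t)) has_derivative
    (\<lambda>h. (word_derivs ! k) A a (U t) (V t) (U' h) (V' h))) (at t)"
proof -
  have l: "((\<lambda>t. M ** W t) has_derivative (\<lambda>h. M ** W' h)) (at t)"
    if "(W has_derivative W') (at t)" for M :: mat2 and W W' :: "real \<Rightarrow> mat2"
    using bounded_linear.has_derivative [OF bounded_bilinear.bounded_linear_right [OF bounded_bilinear_matrix_mult] that] .
  have r: "((\<lambda>t. W t ** M) has_derivative (\<lambda>h. W' h ** M)) (at t)"
    if "(W has_derivative W') (at t)" for M :: mat2 and W W' :: "real \<Rightarrow> mat2"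
    using bounded_linear.has_derivative [OF bounded_bilinear.bounded_linear_left [OF bounded_bilinear_matrix_mult] that] .
  have "list_all2 (\<lambda>f g. ((\<lambda>t. f A a (U t) (V t)) has_derivative (\<lambda>h. g A a (U t) (V t) (U' h) (V' h))) (at t))
      formal_words word_derivs"
    unfolding formal_words_def word_derivs_def
    by (simp add: has_derivative_const U V l r has_derivative_matrix_mult [OF U U]
        has_derivative_matrix_mult [OF l [OF U] U] has_derivative_matrix_mult [OF r [OF l [OF U]] V])
  then show ?thesis
    using k by (simp add: list_all2_conv_all_nth length_formal_words)
qed

lemma bij_word_index: "bij_betw word_index UNIV {..<15}"
  unfolding bij_betw_def
proof
  show inj: "inj word_index"
    by (rule injI) (metis word_index)
  show "range word_index = {..<15}"
    by (rule card_subset_eq) (use conjunct1 [OF word_index] in \<open>auto simp: card_image [OF inj]\<close>)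
qed

lemma sum_word_index: "(\<Sum>j\<in>UNIV. f (word_index j)) = (\<Sum>k<15. f k)"
  by (rule sum.reindex_bij_betw [OF bij_word_index])

lemma sum_UNIV_ext: "(\<Sum>i\<in>(UNIV :: (15 + bool) set). f i) = (\<Sum>j\<in>UNIV. f (Inl j)) + f (Inr True) + f (Inr False)"
  by (simp add: UNIV_Plus_UNIV [symmetric] sum.Plus UNIV_bool add_ac del: UNIV_Plus_UNIV)

lemma word_index_inverse: "k < 15 \<Longrightarrow> word_index (inv word_index k) = k"
  using bij_word_index by (metis bij_betw_imp_surj_on f_inv_into_f lessThan_iff)

lemma quat_numeric:
  "Quat a b c d * Quat e f g h = Quat (a*e - b*f - c*g - d*h) (a*f + b*e + c*h - d*g) (a*g - b*h + c*e + d*f) (a*h + b*g - c*f + d*e)"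
  "Quat a b c d + Quat e f g h = Quat (a + e) (b + f) (c + g) (d + h)"
  "Quat a b c d - Quat e f g h = Quat (a - e) (b - f) (c - g) (d - h)"
  "- Quat a b c d = Quat (- a) (- b) (- c) (- d)"
  "r *\<^sub>R Quat a b c d = Quat (r * a) (r * b) (r * c) (r * d)"
  "quat_cnj (Quat a b c d) = Quat a (- b) (- c) (- d)"
  "(norm (Quat a b c d))\<^sup>2 = a\<^sup>2 + b\<^sup>2 + c\<^sup>2 + d\<^sup>2"
  "(1::quat) = Quat 1 0 0 0" "(0::quat) = Quat 0 0 0 0"
  by (simp_all add: quat_eq_iff quat_norm_sq)

text \<open>A pair with small integer coordinates, so that the linear algebra below stays small. Both squared determinants
are 2, and the squared determinant of the frame is 1.\<close>

definition ref_A :: mat2 where "ref_A = mat2 (Quat 0 0 (-1) 1) 0 0 (Quat 0 (-1) 0 0)"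
definition ref_frame :: mat2 where "ref_frame = mat2 1 (Quat 1 1 0 0) 1 1"
definition ref_B :: mat2
  where "ref_B = ref_frame ** mat2 (Quat (-1) 0 (-1) 0) 0 0 (Quat 0 0 0 1) ** adj2 ref_frame"

lemma ref_A_num:
  "ref_A = mat2 (Quat 0 0 (-1) 1) (Quat 0 0 0 0) (Quat 0 0 0 0) (Quat 0 (-1) 0 0)"
  "adj2 ref_A = mat2 (Quat 0 0 1 (-1)) (Quat 0 0 0 0) (Quat 0 0 0 0) (Quat 0 2 0 0)"
  by (simp_all add: ref_A_def adj2_mat2 quat_numeric)

lemma ref_B_num:
  "ref_B = mat2 (Quat 0 (-1) (-1) 0) (Quat (-1) 1 0 0) (Quat 0 (-1) (-1) 1) (Quat (-1) 1 0 (-1))"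
  "adj2 ref_B = mat2 (Quat 0 (-1) 2 1) (Quat (-1) 1 (-1) (-1)) (Quat 0 (-1) 2 (-1)) (Quat (-1) 1 (-1) 1)"
proof -
  show B: "ref_B = mat2 (Quat 0 (-1) (-1) 0) (Quat (-1) 1 0 0) (Quat 0 (-1) (-1) 1) (Quat (-1) 1 0 (-1))"
    by (simp add: ref_B_def ref_frame_def adj2_mat2 quat_numeric)
  show "adj2 ref_B = mat2 (Quat 0 (-1) 2 1) (Quat (-1) 1 (-1) (-1)) (Quat 0 (-1) 2 (-1)) (Quat (-1) 1 (-1) 1)"
    unfolding B adj2_mat2 by (simp add: quat_numeric)
qed

lemma mat2_zero [simp]: "mat2 0 0 0 0 = 0"
  by (simp add: mat2_eq_iff)

lemma tr2_zero [simp]: "tr2 0 = 0"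
  by (simp add: tr2_def)

lemma bounded_linear_tr2: "bounded_linear tr2"
  unfolding tr2_def [abs_def]
  by (intro bounded_linear_compose [OF bounded_linear_Re0] bounded_linear_add bounded_linear_nth2)

lemma sum_lessThan_15:
  fixes f :: "nat \<Rightarrow> real"
  shows "(\<Sum>k<15. f k) = f 0 + f 1 + f 2 + f 3 + f 4 + f 5 + f 6 + f 7 + f 8 + f 9
    + f 10 + f 11 + f 12 + f 13 + f 14"
  by (simp add: numeral_eq_Suc lessThan_Suc)

text \<open>Let \<open>c\<close> be orthogonal to the range. Then the pairing of \<open>c\<close> with \<^const>\<open>ext_trace\<close> has derivative zero
along every curve through the pair. Conjugating \<open>B\<close> alone leaves the words in a single letter and the
determinants invariant and so gives linear equations for the coefficients of the nine mixed words only. Once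
these coefficients are known to vanish, varying the two eigenvalues of \<open>A\<close> gives four equations for the
coefficients belonging to \<open>A\<close>, and likewise for \<open>B\<close>.\<close>

lemma ref_surj: "surj (ext_trace_deriv (ref_A, ref_B))"
proof -
  define D where "D = ext_trace_deriv (ref_A, ref_B)"
  have D: "(ext_trace has_derivative D) (at (ref_A, ref_B))"
    unfolding D_def by (rule has_derivative_ext_trace)
  then have linD: "linear D"
    by (rule has_derivative_linear)
  have detA: "sq_det ref_A = 2" and detB: "sq_det ref_B = 2"
    by (simp_all only: ref_A_num ref_B_num sq_det_mat2 quat_numeric) simp_all
  have zero: "c = 0" if c: "\<And>v. c \<bullet> D v = 0" for c
  proof -
    define C where "C k = c $ Inl (inv word_index k)" for k
    define word where "word k p = (formal_words ! k) (fst p) (adj2 (fst p)) (snd p) (adj2 (snd p))" for k p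
    have inner_eq: "c \<bullet> ext_trace p = (\<Sum>k<15. C k * tr2 (word k p))
        + c $ Inr True * sq_det (fst p) + c $ Inr False * sq_det (snd p)" for p
    proof -
      have "c $ Inl j = C (word_index j)" for j
        using bij_word_index by (simp add: C_def bij_betw_def)
      then have "c \<bullet> ext_trace p = (\<Sum>j\<in>UNIV. C (word_index j) * tr2 (word (word_index j) p))
        + c $ Inr True * sq_det (fst p) + c $ Inr False * sq_det (snd p)"
        by (simp add: inner_vec_def sum_UNIV_ext ext_trace_def word_def)
      then show ?thesis
        by (simp add: sum_word_index [of "\<lambda>k. C k * tr2 (word k p)"])
    qed
    have curve: "((\<lambda>t. c \<bullet> ext_trace (U t)) has_real_derivative 0) (at 0)"
      if "(U has_derivative U') (at 0)" "U 0 = (ref_A, ref_B)" for U U'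
    proof -
      have "((\<lambda>t. c \<bullet> ext_trace (U t)) has_derivative (\<lambda>h. c \<bullet> D (U' h))) (at 0)"
        using has_derivative_compose [OF that(1)] D that(2)
        by (intro has_derivative_inner_right) simp
      then show ?thesis
        by (simp add: c has_field_derivative_def lambda_zero)
    qed
    have "(\<Sum>k<15. C k * tr2 ((word_derivs ! k) ref_A (adj2 ref_A) ref_B (adj2 ref_B)
        (Y ** ref_B - ref_B ** Y) (Y ** adj2 ref_B - adj2 ref_B ** Y))) = 0" for Y
    proof -
      define g where "g t = mat 1 + t *\<^sub>R Y" for t :: real
      have g: "(g has_derivative (\<lambda>t. t *\<^sub>R Y)) (at 0)" "g 0 = mat 1"
        by (auto simp: g_def [abs_def] intro!: derivative_eq_intros)
      define V where "V M t = conj_by (g t) M" for M t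
      have V: "(V M has_derivative (\<lambda>t. t *\<^sub>R (Y ** M - M ** Y))) (at 0)" "V M 0 = M" for M
        using has_derivative_conj_by [OF g has_derivative_const, of M] g(2)
        by (simp_all add: V_def [abs_def] scaleR_diff_right)
      have "((\<lambda>t. (ref_A, V ref_B t)) has_derivative (\<lambda>t. (0, t *\<^sub>R (Y ** ref_B - ref_B ** Y)))) (at 0)"
        by (intro has_derivative_Pair has_derivative_const V)
      from curve [OF this] have "((\<lambda>t. c \<bullet> ext_trace (ref_A, V ref_B t)) has_derivative (\<lambda>h. 0)) (at 0)"
        by (simp add: V(2) has_field_derivative_def lambda_zero)
      moreover have "((\<lambda>t. c \<bullet> ext_trace (ref_A, V ref_B t)) has_derivative (\<lambda>h. \<Sum>k<15. C k * tr2 ((word_derivs ! k) ref_A (adj2 ref_A)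
          (V ref_B 0) (V (adj2 ref_B) 0) (h *\<^sub>R (Y ** ref_B - ref_B ** Y)) (h *\<^sub>R (Y ** adj2 ref_B - adj2 ref_B ** Y))))) (at 0)"
      proof (rule has_derivative_transform_within_open)
        have "((\<lambda>t. (\<Sum>k<15. C k * tr2 ((formal_words ! k) ref_A (adj2 ref_A) (V ref_B t) (V (adj2 ref_B) t)))
            + (c $ Inr True * sq_det ref_A + c $ Inr False * sq_det ref_B)) has_derivative
          (\<lambda>h. (\<Sum>k<15. C k * tr2 ((word_derivs ! k) ref_A (adj2 ref_A)
          (V ref_B 0) (V (adj2 ref_B) 0) (h *\<^sub>R (Y ** ref_B - ref_B ** Y)) (h *\<^sub>R (Y ** adj2 ref_B - adj2 ref_B ** Y)))) + 0)) (at 0)"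
          by (intro has_derivative_add has_derivative_const has_derivative_sum has_derivative_mult_right
              bounded_linear.has_derivative [OF bounded_linear_tr2] has_derivative_formal_word V) simp
        then show "((\<lambda>t. (\<Sum>k<15. C k * tr2 ((formal_words ! k) ref_A (adj2 ref_A) (V ref_B t) (V (adj2 ref_B) t)))
            + (c $ Inr True * sq_det ref_A + c $ Inr False * sq_det ref_B)) has_derivative
          (\<lambda>h. (\<Sum>k<15. C k * tr2 ((word_derivs ! k) ref_A (adj2 ref_A)
          (V ref_B 0) (V (adj2 ref_B) 0) (h *\<^sub>R (Y ** ref_B - ref_B ** Y)) (h *\<^sub>R (Y ** adj2 ref_B - adj2 ref_B ** Y)))))) (at 0)"
          by simp
        have "continuous_on UNIV (\<lambda>t. sq_det (g t))"
          unfolding g_def [abs_def]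
          by (intro continuous_intros continuous_on_compose2 [OF continuous_sq_det [of UNIV]]) auto
        then show "open {t. sq_det (g t) \<noteq> 0}"
          by (intro open_Collect_neq continuous_on_const)
        show "(\<Sum>k<15. C k * tr2 ((formal_words ! k) ref_A (adj2 ref_A) (V ref_B t) (V (adj2 ref_B) t)))
            + (c $ Inr True * sq_det ref_A + c $ Inr False * sq_det ref_B) = c \<bullet> ext_trace (ref_A, V ref_B t)"
          if "t \<in> {t. sq_det (g t) \<noteq> 0}" for t
          using that detB by (simp add: inner_eq word_def V_def adj2_conj_by sq_det_conj_by invertible_iff_sq_det)
      qed (simp add: g(2))
      ultimately have "(\<lambda>h. 0) = (\<lambda>h. \<Sum>k<15. C k * tr2 ((word_derivs ! k) ref_A (adj2 ref_A)
          (V ref_B 0) (V (adj2 ref_B) 0) (h *\<^sub>R (Y ** ref_B - ref_B ** Y)) (h *\<^sub>R (Y ** adj2 ref_B - adj2 ref_B ** Y))))"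
        by (rule has_derivative_unique)
      from fun_cong [OF this, of 1] show ?thesis
        by (simp add: V(2))
    qed
    note mixed = this [unfolded sum_lessThan_15]
    note mixed_num = mixed [unfolded ref_A_num(2) ref_B_num(2), unfolded ref_A_num(1) ref_B_num(1), unfolded word_derivs_def]
    \<comment> \<open>Each direction \<open>Y\<close> yields one equation for the coefficients of the mixed words. The combinations that
      follow are the rows of the inverse of this nine by nine system, with denominators cleared.\<close>
    let ?e1 = "2 * C 6 + 2 * C 7 - 2 * C 8 - 2 * C 9 - 2 * C 11 + 4 * C 13 - 6 * C 14"
    have e1: "?e1 = 0"
      using mixed_num [of "mat2 (Quat 0 0 1 0) 0 0 0"] by (simp add: quat_numeric)
    let ?e2 = "1 * C 6 + 1 * C 7 - 2 * C 8 - 2 * C 9 - 1 * C 10 - 1 * C 11 + 1 * C 12 - 3 * C 13 + 4 * C 14"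
    have e2: "?e2 = 0"
      using mixed_num [of "mat2 0 0 (Quat 1 0 0 0) 0"] by (simp add: quat_numeric)
    let ?e3 = "1 * C 6 - 1 * C 7 - 2 * C 8 + 1 * C 10 + 3 * C 11 - 1 * C 12 - 1 * C 13 - 6 * C 14"
    have e3: "?e3 = 0"
      using mixed_num [of "mat2 0 0 (Quat 0 1 0 0) 0"] by (simp add: quat_numeric)
    let ?e4 = "-1 * C 7 + 2 * C 9 + 2 * C 11 + 2 * C 12 + 5 * C 13 - 4 * C 14"
    have e4: "?e4 = 0"
      using mixed_num [of "mat2 0 0 (Quat 0 0 0 1) 0"] by (simp add: quat_numeric)
    let ?e5 = "-1 * C 6 + 4 * C 7 - 5 * C 9 + 1 * C 11 - 1 * C 13 - 7 * C 14"
    have e5: "?e5 = 0"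
      using mixed_num [of "mat2 0 (Quat 1 0 0 0) 0 0"] by (simp add: quat_numeric)
    let ?e6 = "1 * C 7 - 1 * C 9 + 1 * C 10 - 2 * C 11 - 1 * C 12 - 8 * C 13 + 1 * C 14"
    have e6: "?e6 = 0"
      using mixed_num [of "mat2 0 (Quat 0 1 0 0) 0 0"] by (simp add: quat_numeric)
    let ?e7 = "2 * C 7 + 1 * C 8 - 3 * C 9 + 1 * C 10 + 1 * C 11 + 7 * C 13 - 9 * C 14"
    have e7: "?e7 = 0"
      using mixed_num [of "mat2 0 (Quat 0 0 1 0) 0 0"] by (simp add: quat_numeric)
    let ?e8 = "3 * C 7 + 1 * C 8 - 5 * C 9 - 1 * C 10 - 1 * C 11 + 2 * C 12 - 2 * C 13 + 3 * C 14"
    have e8: "?e8 = 0"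
      using mixed_num [of "mat2 0 (Quat 0 0 0 1) 0 0"] by (simp add: quat_numeric)
    let ?e9 = "-2 * C 7 + 4 * C 9 + 4 * C 11 + 4 * C 14"
    have e9: "?e9 = 0"
      using mixed_num [of "mat2 0 0 0 (Quat 0 0 0 1)"] by (simp add: quat_numeric)
    have "310 * C 6 = 189 * (?e1) - 257 * (?e2) + 113 * (?e3) - 45 * (?e4) - 76 * (?e5) - 14 * (?e6) - 133 * (?e7) + 223 * (?e8) + 69 * (?e9)"
      by (simp add: algebra_simps)
    then have C6: "C 6 = 0"
      by (simp only: e1 e2 e3 e4 e5 e6 e7 e8 e9 mult_zero_right add_0_right diff_0_right mult_eq_0_iff, simp?)
    have "310 * C 7 = 74 * (?e1) + 26 * (?e2) - 106 * (?e3) + 6 * (?e4) + 68 * (?e5) + 68 * (?e6) + 26 * (?e7) - 38 * (?e8) + 121 * (?e9)"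
      by (simp add: algebra_simps)
    then have C7: "C 7 = 0"
      by (simp only: e1 e2 e3 e4 e5 e6 e7 e8 e9 mult_zero_right add_0_right diff_0_right mult_eq_0_iff, simp?)
    have "62 * C 8 = 19 * (?e1) - 57 * (?e2) + 13 * (?e3) - 6 * (?e4) - 6 * (?e5) - 6 * (?e6) - 26 * (?e7) + 38 * (?e8) + 3 * (?e9)"
      by (simp add: algebra_simps)
    then have C8: "C 8 = 0"
      by (simp only: e1 e2 e3 e4 e5 e6 e7 e8 e9 mult_zero_right add_0_right diff_0_right mult_eq_0_iff, simp?)
    have "62 * C 9 = 14 * (?e1) - 11 * (?e2) - 10 * (?e3) + 7 * (?e4) + 7 * (?e5) + 7 * (?e6) - 11 * (?e7) - 3 * (?e8) + 12 * (?e9)"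
      by (simp add: algebra_simps)
    then have C9: "C 9 = 0"
      by (simp only: e1 e2 e3 e4 e5 e6 e7 e8 e9 mult_zero_right add_0_right diff_0_right mult_eq_0_iff, simp?)
    have "62 * C 10 = -36 * (?e1) + 77 * (?e2) - 23 * (?e3) + 13 * (?e4) - 18 * (?e5) + 44 * (?e6) + 77 * (?e7) - 41 * (?e8) + 9 * (?e9)"
      by (simp add: algebra_simps)
    then have C10: "C 10 = 0"
      by (simp only: e1 e2 e3 e4 e5 e6 e7 e8 e9 mult_zero_right add_0_right diff_0_right mult_eq_0_iff, simp?)
    have "620 * C 11 = -2 * (?e1) - 25 * (?e2) + 59 * (?e3) - 32 * (?e4) + 30 * (?e5) - 32 * (?e6) + 6 * (?e7) + 58 * (?e8) + 109 * (?e9)"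
      by (simp add: algebra_simps)
    then have C11: "C 11 = 0"
      by (simp only: e1 e2 e3 e4 e5 e6 e7 e8 e9 mult_zero_right add_0_right diff_0_right mult_eq_0_iff, simp?)
    have "620 * C 12 = -92 * (?e1) + 183 * (?e2) - 45 * (?e3) + 264 * (?e4) - 46 * (?e5) + 140 * (?e6) + 90 * (?e7) + 2 * (?e8) - 39 * (?e9)"
      by (simp add: algebra_simps)
    then have C12: "C 12 = 0"
      by (simp only: e1 e2 e3 e4 e5 e6 e7 e8 e9 mult_zero_right add_0_right diff_0_right mult_eq_0_iff, simp?)
    have "62 * C 13 = -4 * (?e1) + 12 * (?e2) - 6 * (?e3) - 2 * (?e4) - 2 * (?e5) - 2 * (?e6) + 12 * (?e7) - 8 * (?e8) + 1 * (?e9)"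
      by (simp add: algebra_simps)
    then have C13: "C 13 = 0"
      by (simp only: e1 e2 e3 e4 e5 e6 e7 e8 e9 mult_zero_right add_0_right diff_0_right mult_eq_0_iff, simp?)
    have "620 * C 14 = -64 * (?e1) + 161 * (?e2) - 65 * (?e3) - 32 * (?e4) - 32 * (?e5) + 30 * (?e6) + 130 * (?e7) - 66 * (?e8) + 47 * (?e9)"
      by (simp add: algebra_simps)
    then have C14: "C 14 = 0"
      by (simp only: e1 e2 e3 e4 e5 e6 e7 e8 e9 mult_zero_right add_0_right diff_0_right mult_eq_0_iff, simp?)
    note C = C6 C7 C8 C9 C10 C11 C12 C13 C14
    have pure: "c \<bullet> ext_trace (M, N) = C 0 * tr2 M + C 1 * tr2 (adj2 M) + C 2 * tr2 (M ** M)
        + c $ Inr True * sq_det M + (C 3 * tr2 N + C 4 * tr2 (adj2 N) + C 5 * tr2 (N ** N) + c $ Inr False * sq_det N)" for M N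
      unfolding inner_eq sum_lessThan_15 C by (simp add: word_def formal_words_def)
    \<comment> \<open>What remains is a sum of a function of the first and a function of the second matrix, each
      of which depends only on the eigenvalues.\<close>
    define \<phi> where "\<phi> k0 k1 k2 k3 p q = k0 * tr2 (mat2 p 0 0 q) + k1 * tr2 (adj2 (mat2 p 0 0 q))
        + k2 * tr2 (mat2 p 0 0 q ** mat2 p 0 0 q) + k3 * sq_det (mat2 p 0 0 q)" for k0 k1 k2 k3 p q
    define KA where "KA = C 3 * tr2 ref_B + C 4 * tr2 (adj2 ref_B) + C 5 * tr2 (ref_B ** ref_B) + c $ Inr False * sq_det ref_B"
    have A_dir: "((\<lambda>t. \<phi> (C 0) (C 1) (C 2) (c $ Inr True) (Quat 0 0 (-1) 1 + t *\<^sub>R u) (Quat 0 (-1) 0 0 + t *\<^sub>R v)) has_real_derivative 0) (at 0)" for u v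
    proof -
      have "((\<lambda>t. (ref_A + t *\<^sub>R mat2 u 0 0 v, ref_B)) has_derivative (\<lambda>t. (t *\<^sub>R mat2 u 0 0 v, 0))) (at 0)"
        by (auto simp del: mat2_scaleR intro!: derivative_eq_intros)
      then have "((\<lambda>t. c \<bullet> ext_trace (ref_A + t *\<^sub>R mat2 u 0 0 v, ref_B)) has_real_derivative 0) (at 0)"
        by (rule curve) simp
      then have "((\<lambda>t. c \<bullet> ext_trace (ref_A + t *\<^sub>R mat2 u 0 0 v, ref_B) - KA) has_real_derivative 0) (at 0)"
        by (auto intro!: derivative_eq_intros)
      then show ?thesis
        unfolding pure by (simp add: \<phi>_def KA_def ref_A_def)
    qed
    define KB where "KB = C 0 * tr2 ref_A + C 1 * tr2 (adj2 ref_A) + C 2 * tr2 (ref_A ** ref_A) + c $ Inr True * sq_det ref_A"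
    have frame: "sq_det ref_frame = 1"
      by (simp only: ref_frame_def sq_det_mat2 quat_numeric) simp
    then have conj_frame: "ref_frame ** M ** adj2 ref_frame = conj_by ref_frame M" for M
      by (simp add: conj_by_def matrix_inv_eq_adj2)
    have B_dir: "((\<lambda>t. \<phi> (C 3) (C 4) (C 5) (c $ Inr False) (Quat (-1) 0 (-1) 0 + t *\<^sub>R u) (Quat 0 0 0 1 + t *\<^sub>R v)) has_real_derivative 0) (at 0)" for u v
    proof -
      define N where "N t = mat2 (Quat (-1) 0 (-1) 0) 0 0 (Quat 0 0 0 1) + t *\<^sub>R mat2 u 0 0 v" for t :: real
      have B0: "conj_by ref_frame (N 0) = ref_B"
        unfolding N_def by (simp only: conj_frame [symmetric] ref_B_def) simp
      have "bounded_linear (conj_by ref_frame)"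
        unfolding conj_by_def [abs_def]
        by (intro bounded_linear_compose [OF bounded_bilinear.bounded_linear_left [OF bounded_bilinear_matrix_mult]]
            bounded_bilinear.bounded_linear_right [OF bounded_bilinear_matrix_mult])
      moreover have "(N has_derivative (\<lambda>t. t *\<^sub>R mat2 u 0 0 v)) (at 0)"
        unfolding N_def [abs_def] by (auto simp del: mat2_scaleR mat2_add intro!: derivative_eq_intros)
      ultimately have "((\<lambda>t. conj_by ref_frame (N t)) has_derivative (\<lambda>t. conj_by ref_frame (t *\<^sub>R mat2 u 0 0 v))) (at 0)"
        by (rule bounded_linear.has_derivative)
      from has_derivative_Pair [OF has_derivative_const this, of ref_A]
      have "((\<lambda>t. c \<bullet> ext_trace (ref_A, conj_by ref_frame (N t))) has_real_derivative 0) (at 0)"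
        by (rule curve) (simp add: B0)
      then have "((\<lambda>t. c \<bullet> ext_trace (ref_A, conj_by ref_frame (N t)) - KB) has_real_derivative 0) (at 0)"
        by (auto intro!: derivative_eq_intros)
      then have *: "((\<lambda>t. c \<bullet> ext_trace (ref_A, conj_by ref_frame (N t)) - KB) has_derivative (\<lambda>h. 0)) (at 0)"
        by (simp add: has_field_derivative_def lambda_zero)
      have "((\<lambda>t. \<phi> (C 3) (C 4) (C 5) (c $ Inr False) (Quat (-1) 0 (-1) 0 + t *\<^sub>R u) (Quat 0 0 0 1 + t *\<^sub>R v)) has_derivative (\<lambda>h. 0)) (at 0)"
      proof (rule has_derivative_transform_within_open [OF *])
        have "continuous_on UNIV (\<lambda>t. sq_det (N t))"
          unfolding N_def
          by (intro continuous_intros continuous_on_compose2 [OF continuous_sq_det [of UNIV]]) auto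
        then show "open {t. sq_det (N t) \<noteq> 0}"
          by (intro open_Collect_neq continuous_on_const)
        have "sq_det (N 0) = 2"
          using detB sq_det_conj_by [of ref_frame "N 0"] frame by (simp add: B0 invertible_iff_sq_det)
        then show "0 \<in> {t. sq_det (N t) \<noteq> 0}" by simp
        show "c \<bullet> ext_trace (ref_A, conj_by ref_frame (N t)) - KB =
            \<phi> (C 3) (C 4) (C 5) (c $ Inr False) (Quat (-1) 0 (-1) 0 + t *\<^sub>R u) (Quat 0 0 0 1 + t *\<^sub>R v)"
          if "t \<in> {t. sq_det (N t) \<noteq> 0}" for t
        proof -
          have inv: "invertible ref_frame" "invertible (N t)"
            using that frame by (simp_all add: invertible_iff_sq_det)
          have "c \<bullet> ext_trace (ref_A, conj_by ref_frame (N t)) - KB = C 3 * tr2 (N t) + C 4 * tr2 (adj2 (N t))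
              + C 5 * tr2 (N t ** N t) + c $ Inr False * sq_det (N t)"
            unfolding pure by (simp add: adj2_conj_by inv tr2_conj_by conj_by_mult sq_det_conj_by KB_def)
          moreover have "N t = mat2 (Quat (-1) 0 (-1) 0 + t *\<^sub>R u) 0 0 (Quat 0 0 0 1 + t *\<^sub>R v)"
            by (simp add: N_def)
          ultimately show ?thesis
            by (simp only: \<phi>_def)
        qed
      qed
      then show ?thesis
        by (simp add: has_field_derivative_def lambda_zero)
    qed
    have \<phi>_num: "\<phi> k0 k1 k2 k3 (Quat p0 p1 p2 p3) (Quat q0 q1 q2 q3) =
        k0 * (p0 + q0) + k1 * ((q0\<^sup>2 + q1\<^sup>2 + q2\<^sup>2 + q3\<^sup>2) * p0 + (p0\<^sup>2 + p1\<^sup>2 + p2\<^sup>2 + p3\<^sup>2) * q0)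
        + k2 * (p0\<^sup>2 - p1\<^sup>2 - p2\<^sup>2 - p3\<^sup>2 + q0\<^sup>2 - q1\<^sup>2 - q2\<^sup>2 - q3\<^sup>2)
        + k3 * ((p0\<^sup>2 + p1\<^sup>2 + p2\<^sup>2 + p3\<^sup>2) * (q0\<^sup>2 + q1\<^sup>2 + q2\<^sup>2 + q3\<^sup>2))" for k0 k1 k2 k3 p0 p1 p2 p3 q0 q1 q2 q3
      unfolding \<phi>_def adj2_mat2 sq_det_mat2 mat2_mult tr2_mat2 quat_norm_sq
      by (simp add: power2_eq_square)
    have \<phi>_deriv: "((\<lambda>t. \<phi> k0 k1 k2 k3 (Quat p0 p1 p2 p3 + t *\<^sub>R Quat ua ub uc ud) (Quat q0 q1 q2 q3 + t *\<^sub>R Quat va vb vc vd))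
        has_real_derivative k0 * (ua + va)
        + k1 * (2 * (q0 * va + q1 * vb + q2 * vc + q3 * vd) * p0 + (q0\<^sup>2 + q1\<^sup>2 + q2\<^sup>2 + q3\<^sup>2) * ua
          + 2 * (p0 * ua + p1 * ub + p2 * uc + p3 * ud) * q0 + (p0\<^sup>2 + p1\<^sup>2 + p2\<^sup>2 + p3\<^sup>2) * va)
        + k2 * (2 * (p0 * ua - p1 * ub - p2 * uc - p3 * ud) + 2 * (q0 * va - q1 * vb - q2 * vc - q3 * vd))
        + k3 * (2 * (p0 * ua + p1 * ub + p2 * uc + p3 * ud) * (q0\<^sup>2 + q1\<^sup>2 + q2\<^sup>2 + q3\<^sup>2)
          + (p0\<^sup>2 + p1\<^sup>2 + p2\<^sup>2 + p3\<^sup>2) * (2 * (q0 * va + q1 * vb + q2 * vc + q3 * vd)))) (at 0)"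
      for k0 k1 k2 k3 p0 p1 p2 p3 ua ub uc ud q0 q1 q2 q3 va vb vc vd
      unfolding quat_numeric \<phi>_num
      by (rule derivative_eq_intros refl | simp)+ (simp add: algebra_simps power2_eq_square)
    have "C 0 + C 1 = 0" "C 0 + 2 * C 1 = 0" "2 * C 2 = 2 * c $ Inr True" "2 * C 2 = 4 * c $ Inr True"
      using 
        DERIV_unique [OF \<phi>_deriv A_dir [of "Quat 1 0 0 0" "Quat 0 0 0 0"]] 
        DERIV_unique [OF \<phi>_deriv A_dir [of "Quat 0 0 0 0" "Quat 1 0 0 0"]] 
        DERIV_unique [OF \<phi>_deriv A_dir [of "Quat 0 0 1 0" "Quat 0 0 0 0"]] 
        DERIV_unique [OF \<phi>_deriv A_dir [of "Quat 0 0 0 0" "Quat 0 1 0 0"]]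
      by simp_all
    then have CA: "C 0 = 0" "C 1 = 0" "C 2 = 0" "c $ Inr True = 0"
      by linarith+
    have "C 3 + C 4 = 2 * C 5 + 2 * c $ Inr False" "C 3 + 2 * C 4 = 0" "2 * C 5 = 2 * c $ Inr False"
      "4 * c $ Inr False = 2 * C 4 + 2 * C 5"
      using 
        DERIV_unique [OF \<phi>_deriv B_dir [of "Quat 1 0 0 0" "Quat 0 0 0 0"]] 
        DERIV_unique [OF \<phi>_deriv B_dir [of "Quat 0 0 0 0" "Quat 1 0 0 0"]] 
        DERIV_unique [OF \<phi>_deriv B_dir [of "Quat 0 0 1 0" "Quat 0 0 0 0"]] 
        DERIV_unique [OF \<phi>_deriv B_dir [of "Quat 0 0 0 0" "Quat 0 0 0 1"]]
      by simp_all
    then have CB: "C 3 = 0" "C 4 = 0" "C 5 = 0" "c $ Inr False = 0"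
      by linarith+
    have Ck: "C k = 0" if "k < 15" for k
    proof -
      have "k = 0 \<or> k = 1 \<or> k = 2 \<or> k = 3 \<or> k = 4 \<or> k = 5 \<or> k = 6 \<or> k = 7 \<or> k = 8 \<or> k = 9
          \<or> k = 10 \<or> k = 11 \<or> k = 12 \<or> k = 13 \<or> k = 14"
        using that by (simp add: numeral_eq_Suc less_Suc_eq)
      then show ?thesis
        using C CA CB by (elim disjE) (simp_all only:)
    qed
    have "c $ i = 0" for i
    proof (cases i)
      case (Inl j)
      have "c $ Inl j = C (word_index j)"
        using bij_word_index by (simp add: C_def bij_betw_def)
      then show ?thesis
        using Ck word_index [of j] Inl by simp
    next
      case (Inr b)
      then show ?thesis using CA CB by (cases b) simp_all
    qed
    then show "c = 0"
      by (simp add: vec_eq_iff)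
  qed
  have "range D = UNIV"
  proof (rule ccontr)
    assume "range D \<noteq> UNIV"
    moreover have span: "span (range D) = range D"
      by (rule span_eq_iff [THEN iffD2]) (rule linear_subspace_image [OF linD subspace_UNIV])
    ultimately have "span (range D) \<subset> span UNIV"
      unfolding span span_UNIV by blast
    then obtain x where "x \<noteq> 0" "\<And>y. y \<in> span (range D) \<Longrightarrow> orthogonal x y"
      by (rule orthogonal_to_subspace_exists_gen) blast
    then show False
      using zero [of x] by (auto simp: span orthogonal_def)
  qed
  then show ?thesis
    by (simp add: D_def)
qed

section \<open>Conjugation of pairs\<close>

definition conj_pair :: "mat2 \<Rightarrow> mpair \<Rightarrow> mpair"
  where "conj_pair P p = (conj_by P (fst p), conj_by P (snd p))"

lemma SL2H_mult: "P \<in> SL2H \<Longrightarrow> Q \<in> SL2H \<Longrightarrow> P ** Q \<in> SL2H"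
  by (simp add: SL2H_iff sq_det_mult)

lemma SL2H_invertible: "P \<in> SL2H \<Longrightarrow> invertible P"
  by (simp add: SL2H_def)

lemma SL2H_one: "mat 1 \<in> SL2H"
  by (simp add: SL2H_iff)

lemma sq_det_matrix_inv: "invertible P \<Longrightarrow> sq_det P * sq_det (matrix_inv P) = 1"
  by (simp flip: sq_det_mult add: matrix_inv_cancel)

lemma SL2H_matrix_inv: "P \<in> SL2H \<Longrightarrow> matrix_inv P \<in> SL2H"
  using sq_det_matrix_inv [of P] by (simp add: SL2H_iff SL2H_invertible invertible_iff_sq_det)

lemma conj_pair_conj_pair: "invertible P \<Longrightarrow> invertible Q \<Longrightarrow> conj_pair P (conj_pair Q p) = conj_pair (P ** Q) p"
  by (simp add: conj_pair_def conj_by_conj_by)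

lemma conj_pair_one [simp]: "conj_pair (mat 1) p = p"
  by (simp add: conj_pair_def)

lemma pair_class_eq: "pair_class p = {conj_pair P p | P. P \<in> SL2H}"
  by (simp add: pair_class_def conj_pair_def)

lemma pair_class_refl: "p \<in> pair_class p"
  unfolding pair_class_eq using SL2H_one conj_pair_one by force

lemma pair_class_conj_SL2H: "P \<in> SL2H \<Longrightarrow> pair_class (conj_pair P p) = pair_class p"
proof (intro set_eqI iffI)
  fix q assume P: "P \<in> SL2H"
  {
    assume "q \<in> pair_class (conj_pair P p)"
    then obtain Q where "Q \<in> SL2H" "q = conj_pair Q (conj_pair P p)"
      by (auto simp: pair_class_eq)
    then show "q \<in> pair_class p"
      using P by (auto simp: pair_class_eq conj_pair_conj_pair SL2H_invertible intro: SL2H_mult)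
  next
    assume "q \<in> pair_class p"
    then obtain Q where Q: "Q \<in> SL2H" "q = conj_pair Q p"
      by (auto simp: pair_class_eq)
    have "conj_pair (Q ** matrix_inv P) (conj_pair P p) = conj_pair (Q ** (matrix_inv P ** P)) p"
      using P Q by (simp add: conj_pair_conj_pair SL2H_invertible SL2H_mult SL2H_matrix_inv matrix_mul_assoc)
    then have "q = conj_pair (Q ** matrix_inv P) (conj_pair P p)"
      using P Q by (simp add: matrix_inv_cancel SL2H_invertible)
    then show "q \<in> pair_class (conj_pair P p)"
      using P Q unfolding pair_class_eq by (blast intro: SL2H_mult SL2H_matrix_inv)
  }
qed

lemma pair_class_conj:
  assumes "invertible P"
  shows "pair_class (conj_pair P p) = pair_class p"
proof -
  obtain Q where "Q \<in> SL2H" "\<And>A. conj_by Q A = conj_by P A"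
    using conj_by_SL2H [OF assms] by blast
  then show ?thesis
    using pair_class_conj_SL2H [of Q p] by (simp add: conj_pair_def)
qed

lemma pair_class_eqD:
  assumes "pair_class p = pair_class q"
  obtains P where "P \<in> SL2H" "p = conj_pair P q"
  using pair_class_refl [of p] assms by (auto simp: pair_class_eq)

section \<open>Polar form of quaternions\<close>

definition nonreal :: "quat \<Rightarrow> bool"
  where "nonreal q \<longleftrightarrow> q \<noteq> of_real (Re0 q)"

definition complex_quat :: "quat \<Rightarrow> bool"
  where "complex_quat q \<longleftrightarrow> Im2 q = 0 \<and> Im3 q = 0"

lemma nonreal_iff: "nonreal q \<longleftrightarrow> Im1 q \<noteq> 0 \<or> Im2 q \<noteq> 0 \<or> Im3 q \<noteq> 0"
  by (auto simp: nonreal_def quat_eq_iff)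

lemma imag_units_iff: "I \<in> \<S>\<^sup>2 \<longleftrightarrow> Re0 I = 0 \<and> (Im1 I)\<^sup>2 + (Im2 I)\<^sup>2 + (Im3 I)\<^sup>2 = 1"
proof
  assume "I \<in> \<S>\<^sup>2"
  then have eq: "Re0 I * Re0 I - Im1 I * Im1 I - Im2 I * Im2 I - Im3 I * Im3 I = -1"
    "Re0 I * Im1 I = 0" "Re0 I * Im2 I = 0" "Re0 I * Im3 I = 0"
    by (auto simp: imag_units_def quat_eq_iff)
  have "Re0 I = 0"
  proof (rule ccontr)
    assume "Re0 I \<noteq> 0"
    then have "Re0 I * Re0 I = -1"
      using eq by simp
    then show False
      using zero_le_square [of "Re0 I"] by linarith
  qed
  then show "Re0 I = 0 \<and> (Im1 I)\<^sup>2 + (Im2 I)\<^sup>2 + (Im3 I)\<^sup>2 = 1"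
    using eq by (simp add: power2_eq_square)
qed (simp add: imag_units_def quat_eq_iff power2_eq_square)

text \<open>The imaginary unit is the normalised imaginary part, so it is \<open>i\<close> or \<open>- i\<close> only for complex
numbers.\<close>

lemma polar_form:
  assumes "nonreal q"
  obtains I \<theta> where "I \<in> \<S>\<^sup>2" "\<theta> \<in> {0<..<pi}" "q = of_real (norm q) * quat_cis I \<theta>"
    "I \<in> {quat_i, - quat_i} \<longrightarrow> complex_quat q"
proof -
  define s where "s = sqrt ((Im1 q)\<^sup>2 + (Im2 q)\<^sup>2 + (Im3 q)\<^sup>2)"
  have "0 < (Im1 q)\<^sup>2 + (Im2 q)\<^sup>2 + (Im3 q)\<^sup>2"
    using assms by (auto simp: nonreal_iff add_pos_nonneg add_nonneg_pos)
  then have s: "0 < s" "s\<^sup>2 = (Im1 q)\<^sup>2 + (Im2 q)\<^sup>2 + (Im3 q)\<^sup>2"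
    by (simp_all add: s_def)
  have nsq: "(norm q)\<^sup>2 = (Re0 q)\<^sup>2 + s\<^sup>2"
    by (simp add: s quat_norm_sq)
  then have "norm q \<noteq> 0"
    using s(1) by (auto simp: sum_power2_eq_zero_iff)
  then have n: "0 < norm q"
    by simp
  define \<theta> where "\<theta> = arccos (Re0 q / norm q)"
  have "\<bar>Re0 q\<bar> < norm q"
    by (rule power2_less_imp_less) (simp_all only: power2_abs nsq norm_ge_zero, use s(1) in simp)
  then have "\<bar>Re0 q / norm q\<bar> < 1"
    using n by (simp add: abs_divide)
  then have lt: "- 1 < Re0 q / norm q" "Re0 q / norm q < 1"
    unfolding abs_less_iff by linarith+
  have \<theta>: "\<theta> \<in> {0<..<pi}"
    unfolding \<theta>_def using arccos_lt_bounded [of "Re0 q / norm q"] lt by simp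
  have cos: "cos \<theta> = Re0 q / norm q"
    unfolding \<theta>_def using lt by (intro cos_arccos) simp_all
  have "(sin \<theta>)\<^sup>2 = (s / norm q)\<^sup>2"
  proof -
    have "(Re0 q / norm q)\<^sup>2 + (s / norm q)\<^sup>2 = (norm q)\<^sup>2 / (norm q)\<^sup>2"
      unfolding nsq power_divide add_divide_distrib ..
    also have "\<dots> = 1"
      using n by simp
    finally show ?thesis
      by (simp add: sin_squared_eq cos)
  qed
  then have sin: "sin \<theta> = s / norm q"
  proof (rule power2_eq_imp_eq)
    show "0 \<le> sin \<theta>"
      using \<theta> by (intro sin_ge_zero) simp_all
    show "0 \<le> s / norm q"
      using s(1) n by simp
  qed
  define I where "I = Quat 0 (Im1 q / s) (Im2 q / s) (Im3 q / s)"
  have I: "I \<in> \<S>\<^sup>2"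
    unfolding imag_units_iff I_def using s(1) by (simp add: power_divide flip: add_divide_distrib s(2))
  have "q = of_real (norm q) * quat_cis I \<theta>"
    using n s(1) by (simp add: quat_cis_def quat_eq_iff cos sin I_def del: of_real_divide)
  moreover have "I \<in> {quat_i, - quat_i} \<longrightarrow> complex_quat q"
    using s(1) by (auto simp: I_def complex_quat_def quat_i_def uminus_quat_def)
  ultimately show thesis
    using that I \<theta> by blast
qed

lemma of_polar_form:
  assumes "I \<in> \<S>\<^sup>2" "\<theta> \<in> {0<..<pi}" "0 < r"
  shows "norm (of_real r * quat_cis I \<theta>) = r" "nonreal (of_real r * quat_cis I \<theta>)"
    "complex_quat (of_real r * quat_cis I \<theta>) \<Longrightarrow> I \<in> {quat_i, - quat_i}"
proof -
  have I: "Re0 I = 0" "(Im1 I)\<^sup>2 + (Im2 I)\<^sup>2 + (Im3 I)\<^sup>2 = 1"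
    using assms(1) by (simp_all add: imag_units_iff)
  have s: "0 < sin \<theta>"
    using assms(2) by (simp add: sin_gt_zero)
  have "(norm (quat_cis I \<theta>))\<^sup>2 = (cos \<theta>)\<^sup>2 + ((Im1 I)\<^sup>2 + (Im2 I)\<^sup>2 + (Im3 I)\<^sup>2) * (sin \<theta>)\<^sup>2"
    by (simp add: quat_norm_sq quat_cis_def I(1) power_mult_distrib algebra_simps)
  then have "norm (quat_cis I \<theta>) = 1"
    by (simp add: I(2) power2_eq_1_iff) (use norm_ge_zero [of "quat_cis I \<theta>"] in linarith)
  then show "norm (of_real r * quat_cis I \<theta>) = r"
    using assms(3) by (simp add: norm_mult)
  have ne: "Im1 I \<noteq> 0 \<or> Im2 I \<noteq> 0 \<or> Im3 I \<noteq> 0"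
    using I(2) by auto
  then show "nonreal (of_real r * quat_cis I \<theta>)"
    using s assms(3) by (auto simp: nonreal_iff quat_cis_def)
  assume "complex_quat (of_real r * quat_cis I \<theta>)"
  then have z: "Im2 I = 0" "Im3 I = 0"
    using s assms(3) by (auto simp: complex_quat_def quat_cis_def)
  with I(2) have "Im1 I = 1 \<or> Im1 I = -1"
    by (simp add: power2_eq_1_iff)
  then show "I \<in> {quat_i, - quat_i}"
    using z I(1) by (auto simp: quat_eq_iff quat_i_def)
qed

lemma complex_quat_commute: "complex_quat w \<Longrightarrow> complex_quat q \<Longrightarrow> q * w = w * q"
  by (simp add: complex_quat_def quat_eq_iff)

lemma commute_complex_quat: "complex_quat w \<Longrightarrow> Im1 w \<noteq> 0 \<Longrightarrow> q * w = w * q \<Longrightarrow> complex_quat q"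
  by (auto simp: complex_quat_def quat_eq_iff)

lemma nonreal_conj: "v \<noteq> 0 \<Longrightarrow> nonreal (v * q * inverse v) = nonreal q"
proof -
  have *: "nonreal (u * p * inverse u)" if "u \<noteq> 0" "nonreal p" for u p :: quat
  proof (rule ccontr)
    assume "\<not> nonreal (u * p * inverse u)"
    then obtain r where "u * p * inverse u = of_real r"
      unfolding nonreal_def by blast
    then have "u * p * inverse u * u = of_real r * u"
      by simp
    also have "of_real r * u = u * of_real r"
      by (simp add: quat_eq_iff)
    finally have "p = of_real r"
      using that(1) by (simp add: mult.assoc)
    then show False
      using that(2) by (simp add: nonreal_def)
  qed
  assume v: "v \<noteq> 0"
  show ?thesis
  proof
    assume "nonreal (v * q * inverse v)"
    from * [OF _ this, of "inverse v"] show "nonreal q"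
      using v by (simp add: mult.assoc) (simp flip: mult.assoc)
  qed (rule * [OF v])
qed

text \<open>With \<open>s\<close> the norm of the imaginary part \<open>p\<close> of \<open>q\<close>, the quaternion \<open>i p - s\<close> conjugates \<open>p\<close> to
\<open>s i\<close>. It vanishes for \<open>p = - s i\<close>; for complex \<open>q\<close> one takes 1 or \<open>j\<close> instead.\<close>

lemma conj_to_complex:
  assumes "nonreal q"
  obtains v where "v \<noteq> 0" "complex_quat (v * q * inverse v)" "0 < Im1 (v * q * inverse v)"
proof -
  define s where "s = sqrt ((Im1 q)\<^sup>2 + (Im2 q)\<^sup>2 + (Im3 q)\<^sup>2)"
  have "0 < (Im1 q)\<^sup>2 + (Im2 q)\<^sup>2 + (Im3 q)\<^sup>2"
    using assms by (auto simp: nonreal_iff add_pos_nonneg add_nonneg_pos)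
  then have s: "0 < s" "s * s = Im1 q * Im1 q + Im2 q * Im2 q + Im3 q * Im3 q"
    by (simp_all add: s_def power2_eq_square flip: real_sqrt_mult)
  define z where "z = Quat (Re0 q) s 0 0"
  have "\<exists>v. v \<noteq> 0 \<and> v * q = z * v"
  proof (cases "Im2 q = 0 \<and> Im3 q = 0")
    case True
    then have "Im1 q = s \<or> Im1 q = - s"
      using s(2) by (auto simp: square_eq_iff)
    then show ?thesis
    proof
      assume "Im1 q = s"
      then show ?thesis
        using True by (intro exI [of _ 1]) (simp add: z_def quat_eq_iff)
    next
      assume "Im1 q = - s"
      then show ?thesis
        using True by (intro exI [of _ quat_j]) (simp add: z_def quat_eq_iff quat_j_def)
    qed
  next
    case False
    define v where "v = Quat (- Im1 q - s) 0 (- Im3 q) (Im2 q)"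
    have "v \<noteq> 0"
      using False by (auto simp: v_def quat_eq_iff)
    moreover have "v * q = z * v"
      using s(2) by (simp add: v_def z_def quat_eq_iff algebra_simps)
    ultimately show ?thesis by blast
  qed
  then obtain v where v: "v \<noteq> 0" "v * q = z * v" by blast
  then have eq: "v * q * inverse v = z"
    by (simp add: mult.assoc)
  show thesis
  proof (rule that [OF v(1)])
    show "complex_quat (v * q * inverse v)" "0 < Im1 (v * q * inverse v)"
      unfolding eq using s(1) by (simp_all add: z_def complex_quat_def)
  qed
qed

section \<open>Normal pairs in terms of eigenvalues\<close>

text \<open>Conjugation does not see the factor in \<^const>\<open>fix_matrix\<close> that normalises the determinant; without it the
matrix is a polynomial in \<open>w\<close>.\<close>

definition frame :: "quat \<Rightarrow> mat2"
  where "frame w = mat2 1 w 1 1"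

lemma sq_det_frame: "sq_det (frame w) = (norm (1 - w))\<^sup>2"
  by (simp add: frame_def sq_det_eq dieudonne_det_mat2)

definition normal_pair :: "quat \<Rightarrow> quat \<Rightarrow> quat \<Rightarrow> quat \<Rightarrow> quat \<Rightarrow> mpair"
  where "normal_pair \<alpha> \<beta> \<gamma> \<delta> w = (mat2 \<alpha> 0 0 \<beta>, conj_by (frame w) (mat2 \<gamma> 0 0 \<delta>))"

text \<open>The parameters of \<^const>\<open>normal_pairs\<close> in terms of the four eigenvalues instead of their polar
coordinates. All conditions are open, except for those on the products of norms and on \<open>w\<close>.\<close>

definition normal_data :: "quat \<Rightarrow> quat \<Rightarrow> quat \<Rightarrow> quat \<Rightarrow> quat \<Rightarrow> bool"
  where "normal_data \<alpha> \<beta> \<gamma> \<delta> w \<longleftrightarrow>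
    1 < norm \<alpha> \<and> norm \<alpha> * norm \<beta> = 1 \<and> 1 < norm \<gamma> \<and> norm \<gamma> * norm \<delta> = 1 \<and>
    nonreal \<alpha> \<and> nonreal \<beta> \<and> nonreal \<gamma> \<and> nonreal \<delta> \<and>
    \<not> (complex_quat \<alpha> \<and> complex_quat \<beta> \<and> complex_quat \<gamma> \<and> complex_quat \<delta>) \<and>
    complex_quat w \<and> 0 < Im1 w"

lemma lox_diag_polar:
  assumes "nonreal \<alpha>" "nonreal \<beta>" "1 < norm \<alpha>" "norm \<alpha> * norm \<beta> = 1"
  obtains I \<theta> J \<phi> where "mat2 \<alpha> 0 0 \<beta> = lox_diag (norm \<alpha>) I \<theta> J \<phi>" "I \<in> \<S>\<^sup>2" "J \<in> \<S>\<^sup>2" "\<theta> \<in> {0<..<pi}" "\<phi> \<in> {0<..<pi}"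
    "I \<in> {quat_i, - quat_i} \<longrightarrow> complex_quat \<alpha>" "J \<in> {quat_i, - quat_i} \<longrightarrow> complex_quat \<beta>"
proof -
  obtain I \<theta> where I: "I \<in> \<S>\<^sup>2" "\<theta> \<in> {0<..<pi}" "\<alpha> = of_real (norm \<alpha>) * quat_cis I \<theta>" "I \<in> {quat_i, - quat_i} \<longrightarrow> complex_quat \<alpha>"
    using polar_form [OF assms(1)] by blast
  obtain J \<phi> where J: "J \<in> \<S>\<^sup>2" "\<phi> \<in> {0<..<pi}" "\<beta> = of_real (norm \<beta>) * quat_cis J \<phi>" "J \<in> {quat_i, - quat_i} \<longrightarrow> complex_quat \<beta>"
    using polar_form [OF assms(2)] by blast
  have "norm \<beta> = inverse (norm \<alpha>)"
    using inverse_unique [OF assms(4)] by simp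
  then have "mat2 \<alpha> 0 0 \<beta> = lox_diag (norm \<alpha>) I \<theta> J \<phi>"
    using I(3) J(3) by (simp add: lox_diag_def)
  then show thesis
    using that I J by blast
qed

lemma normal_data_frame: "normal_data \<alpha> \<beta> \<gamma> \<delta> w \<Longrightarrow> w \<noteq> 1 \<and> w \<noteq> 0 \<and> invertible (frame w)"
  by (auto simp: normal_data_def invertible_iff_sq_det sq_det_frame)

lemma conj_by_fix_matrix:
  assumes "w \<noteq> 1"
  shows "conj_by (fix_matrix w) A = conj_by (frame w) A" "fix_matrix w \<in> SL2H"
proof -
  define r where "r = 1 / sqrt (norm (1 - w))"
  have r: "r \<noteq> 0" "r ^ 4 * (norm (1 - w))\<^sup>2 = 1"
  proof -
    have "(sqrt (norm (1 - w))) ^ 4 = (norm (1 - w))\<^sup>2"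
      by (simp add: power4_eq_xxxx power2_eq_square mult.assoc [symmetric])
    then show "r ^ 4 * (norm (1 - w))\<^sup>2 = 1"
      using assms by (simp add: r_def power_divide)
  qed (use assms in \<open>simp add: r_def\<close>)
  have eq: "fix_matrix w = r *\<^sub>R frame w"
    by (simp add: fix_matrix_def frame_def r_def)
  have "invertible (frame w)"
    using assms by (simp add: invertible_iff_sq_det sq_det_frame)
  then show "conj_by (fix_matrix w) A = conj_by (frame w) A"
    unfolding eq by (rule conj_by_scale_frame [OF r(1)])
  show "fix_matrix w \<in> SL2H"
    unfolding eq SL2H_iff sq_det_scaleR sq_det_frame by (rule r(2))
qed

lemma normal_pair_mem:
  assumes n: "normal_data \<alpha> \<beta> \<gamma> \<delta> w"
  shows "normal_pair \<alpha> \<beta> \<gamma> \<delta> w \<in> normal_pairs"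
proof -
  note n' = n [unfolded normal_data_def]
  obtain I \<theta> J \<phi> where I: "mat2 \<alpha> 0 0 \<beta> = lox_diag (norm \<alpha>) I \<theta> J \<phi>" "I \<in> \<S>\<^sup>2" "J \<in> \<S>\<^sup>2" "\<theta> \<in> {0<..<pi}" "\<phi> \<in> {0<..<pi}"
    "I \<in> {quat_i, - quat_i} \<longrightarrow> complex_quat \<alpha>" "J \<in> {quat_i, - quat_i} \<longrightarrow> complex_quat \<beta>"
    using lox_diag_polar [of \<alpha> \<beta>] n' by blast
  obtain K \<theta>' L \<phi>' where K: "mat2 \<gamma> 0 0 \<delta> = lox_diag (norm \<gamma>) K \<theta>' L \<phi>'" "K \<in> \<S>\<^sup>2" "L \<in> \<S>\<^sup>2" "\<theta>' \<in> {0<..<pi}" "\<phi>' \<in> {0<..<pi}"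
    "K \<in> {quat_i, - quat_i} \<longrightarrow> complex_quat \<gamma>" "L \<in> {quat_i, - quat_i} \<longrightarrow> complex_quat \<delta>"
    using lox_diag_polar [of \<gamma> \<delta>] n' by blast
  have w: "w = of_real (Re0 w) + of_real (Im1 w) * quat_i"
    using n' by (simp add: quat_eq_iff complex_quat_def quat_i_def)
  have ijkl: "\<not> {I, J, K, L} \<subseteq> {quat_i, - quat_i}"
    using I(6,7) K(6,7) n' by blast
  have "normal_pair \<alpha> \<beta> \<gamma> \<delta> w = (lox_diag (norm \<alpha>) I \<theta> J \<phi>, conj_by (fix_matrix w) (lox_diag (norm \<gamma>) K \<theta>' L \<phi>'))"
    using normal_data_frame [OF n] by (simp add: normal_pair_def I(1) K(1) conj_by_fix_matrix)
  moreover have "norm \<alpha> > 1 \<and> norm \<gamma> > 1 \<and> {\<theta>, \<phi>, \<theta>', \<phi>'} \<subseteq> {0<..<pi} \<and>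
      {I, J, K, L} \<subseteq> \<S>\<^sup>2 \<and> \<not> {I, J, K, L} \<subseteq> {quat_i, - quat_i} \<and>
      w = of_real (Re0 w) + of_real (Im1 w) * quat_i \<and> Im1 w > 0"
    using I(2-5) K(2-5) ijkl w n' by blast
  ultimately show ?thesis
    unfolding normal_pairs_def mem_Collect_eq
    by - (rule exI [of _ "norm \<alpha>"], rule exI [of _ "norm \<gamma>"], rule exI [of _ \<theta>], rule exI [of _ \<phi>],
        rule exI [of _ \<theta>'], rule exI [of _ \<phi>'], rule exI [of _ I], rule exI [of _ J], rule exI [of _ K],
        rule exI [of _ L], rule exI [of _ w], rule exI [of _ "Re0 w"], rule exI [of _ "Im1 w"], rule conjI)
qed

lemma normal_pairs_cases:
  assumes "n \<in> normal_pairs"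
  obtains \<alpha> \<beta> \<gamma> \<delta> w where "normal_data \<alpha> \<beta> \<gamma> \<delta> w" "n = normal_pair \<alpha> \<beta> \<gamma> \<delta> w"
proof -
  obtain r s \<theta> \<phi> \<theta>' \<phi>' I J K L w x y where
    n: "n = (lox_diag r I \<theta> J \<phi>, conj_by (fix_matrix w) (lox_diag s K \<theta>' L \<phi>'))"
    and "r > 1 \<and> s > 1 \<and> {\<theta>, \<phi>, \<theta>', \<phi>'} \<subseteq> {0<..<pi} \<and>
      {I, J, K, L} \<subseteq> \<S>\<^sup>2 \<and> \<not> {I, J, K, L} \<subseteq> {quat_i, - quat_i} \<and>
      w = of_real x + of_real y * quat_i \<and> y > 0"
    using assms unfolding normal_pairs_def mem_Collect_eq by (elim exE conjE) blast
  then have a: "r > 1" "s > 1" "\<theta> \<in> {0<..<pi}" "\<phi> \<in> {0<..<pi}" "\<theta>' \<in> {0<..<pi}" "\<phi>' \<in> {0<..<pi}"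
    "I \<in> \<S>\<^sup>2" "J \<in> \<S>\<^sup>2" "K \<in> \<S>\<^sup>2" "L \<in> \<S>\<^sup>2" "\<not> {I, J, K, L} \<subseteq> {quat_i, - quat_i}"
    and w: "w = of_real x + of_real y * quat_i" "y > 0"
    by auto
  define \<alpha> \<beta> \<gamma> \<delta> where "\<alpha> = of_real r * quat_cis I \<theta>" "\<beta> = of_real (inverse r) * quat_cis J \<phi>"
    "\<gamma> = of_real s * quat_cis K \<theta>'" "\<delta> = of_real (inverse s) * quat_cis L \<phi>'"
  have pos: "0 < r" "0 < inverse r" "0 < s" "0 < inverse s"
    using a(1,2) by auto
  note pol = of_polar_form [OF a(7,3) pos(1)] of_polar_form [OF a(8,4) pos(2)]
    of_polar_form [OF a(9,5) pos(3)] of_polar_form [OF a(10,6) pos(4)]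
  have Im1w: "complex_quat w" "Im1 w = y"
    by (simp_all add: w complex_quat_def quat_i_def)
  have d: "normal_data \<alpha> \<beta> \<gamma> \<delta> w"
    unfolding normal_data_def \<alpha>_\<beta>_\<gamma>_\<delta>_def using pol a(1,2,11) pos Im1w w(2) by auto
  have "w \<noteq> 1"
    using normal_data_frame [OF d] by blast
  then have "n = normal_pair \<alpha> \<beta> \<gamma> \<delta> w"
    by (simp add: n normal_pair_def \<alpha>_\<beta>_\<gamma>_\<delta>_def lox_diag_def conj_by_fix_matrix)
  with d show thesis by (rule that)
qed

section \<open>Normal pairs are regular\<close>

text \<open>The columns form a right vector space, in which an eigenvalue acts from the right.\<close>

definition eigenvector :: "mat2 \<Rightarrow> quat^2 \<Rightarrow> bool"
  where "eigenvector A v \<longleftrightarrow> v \<noteq> 0 \<and> (\<exists>\<mu>. A *v v = (\<chi> i. v $ i * \<mu>))"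

lemma mat2_mult_vec: "(A *v v) $ i = A $ i $ 1 * v $ 1 + A $ i $ 2 * v $ 2" for A :: mat2
  by (simp add: matrix_vector_mult_def sum_2)

lemma fixed_point_eigenvector:
  assumes "p \<in> fixed_points A"
  shows "eigenvector A (case p of None \<Rightarrow> vector [1, 0] | Some z \<Rightarrow> vector [z, 1])"
proof (cases p)
  case None
  then have "A $ 2 $ 1 = 0"
    using assms by (auto simp: fixed_points_def moebius_def Let_def split: if_splits)
  then show ?thesis
    unfolding eigenvector_def using None
    by (auto simp: vec_eq_iff forall_2 mat2_mult_vec intro!: exI [of _ "A $ 1 $ 1"])
next
  case (Some z)
  define \<mu> where "\<mu> = A $ 2 $ 1 * z + A $ 2 $ 2"
  have \<mu>: "\<mu> \<noteq> 0" "(A $ 1 $ 1 * z + A $ 1 $ 2) * inverse \<mu> = z"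
    using assms Some by (auto simp: fixed_points_def moebius_def Let_def \<mu>_def split: if_splits)
  then have "A $ 1 $ 1 * z + A $ 1 $ 2 = z * \<mu>"
    by (metis mult.assoc left_inverse mult.right_neutral)
  then show ?thesis
    unfolding eigenvector_def using Some
    by (auto simp: vec_eq_iff forall_2 mat2_mult_vec \<mu>_def exI [of _ \<mu>])
qed

lemma eigenvector_conj_by:
  assumes P: "invertible P" and v: "eigenvector (conj_by P A) v"
  shows "eigenvector A (matrix_inv P *v v)"
proof -
  obtain \<mu> where \<mu>: "v \<noteq> 0" "conj_by P A *v v = (\<chi> i. v $ i * \<mu>)"
    using v by (auto simp: eigenvector_def)
  have "matrix_inv P *v (conj_by P A *v v) = A *v (matrix_inv P *v v)"
    by (simp add: conj_by_def matrix_vector_mul_assoc matrix_mul_assoc matrix_inv_cancel [OF P])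
  moreover have "matrix_inv P *v (\<chi> i. v $ i * \<mu>) = (\<chi> i. (matrix_inv P *v v) $ i * \<mu>)"
    by (simp add: vec_eq_iff mat2_mult_vec distrib_right mult.assoc)
  moreover have "matrix_inv P *v v \<noteq> 0"
  proof
    assume "matrix_inv P *v v = 0"
    then have "P *v (matrix_inv P *v v) = 0"
      by (simp add: vec_eq_iff mat2_mult_vec)
    then show False
      using \<mu>(1) by (simp add: matrix_vector_mul_assoc matrix_inv_cancel [OF P])
  qed
  ultimately have "matrix_inv P *v v \<noteq> 0 \<and> A *v (matrix_inv P *v v) = (\<chi> i. (matrix_inv P *v v) $ i * \<mu>)"
    using \<mu>(2) by simp
  then show ?thesis
    unfolding eigenvector_def by blast
qed

text \<open>If both components were nonzero, both eigenvalues would have the norm of \<open>\<mu>\<close>.\<close>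

lemma eigenvector_diag:
  assumes "norm \<alpha> \<noteq> norm \<beta>" "eigenvector (mat2 \<alpha> 0 0 \<beta>) v"
  shows "(v $ 1 = 0) \<noteq> (v $ 2 = 0)"
proof -
  obtain \<mu> where \<mu>: "v \<noteq> 0" "\<alpha> * v $ 1 = v $ 1 * \<mu>" "\<beta> * v $ 2 = v $ 2 * \<mu>"
    using assms(2) by (auto simp: eigenvector_def vec_eq_iff forall_2 mat2_mult_vec)
  have "norm \<alpha> * norm (v $ 1) = norm (v $ 1) * norm \<mu>" "norm \<beta> * norm (v $ 2) = norm (v $ 2) * norm \<mu>"
    using arg_cong [OF \<mu>(2), of norm] arg_cong [OF \<mu>(3), of norm] by (simp_all add: norm_mult)
  then have "v $ 1 = 0 \<or> v $ 2 = 0"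
    using assms(1) by (metis mult.commute mult_cancel_left norm_eq_zero)
  then show ?thesis
    using \<mu>(1) by (auto simp: vec_eq_iff forall_2)
qed

lemma normal_data_norms: "normal_data \<alpha> \<beta> \<gamma> \<delta> w \<Longrightarrow> norm \<alpha> \<noteq> norm \<beta> \<and> norm \<gamma> \<noteq> norm \<delta>"
  by (auto simp: normal_data_def) (metis less_1_mult order_less_irrefl)+

lemma matrix_inv_frame:
  assumes "w \<noteq> 1" "complex_quat w"
  shows "matrix_inv (frame w) = mat2 (inverse (1 - w)) (- w * inverse (1 - w)) (- inverse (1 - w)) (inverse (1 - w))"
proof -
  have comm: "w * inverse (1 - w) = inverse (1 - w) * w"
    using assms by (simp add: complex_quat_commute complex_quat_def inverse_quat_def)
  have l: "inverse (1 - w) * (1 - w) = 1" "(1 - w) * inverse (1 - w) = 1"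
    using assms(1) by simp_all
  show ?thesis
    by (rule matrix_inv_eqI)
      (use comm l in \<open>simp_all add: frame_def mat2_one algebra_simps\<close>)
qed

text \<open>The eigenlines of the first matrix are the coordinate axes, those of the second one are spanned by the
columns of the frame, which are not on the axes.\<close>

lemma normal_pair_no_common_eigenvector:
  assumes n: "normal_data \<alpha> \<beta> \<gamma> \<delta> w" and v: "eigenvector (fst (normal_pair \<alpha> \<beta> \<gamma> \<delta> w)) v" "eigenvector (snd (normal_pair \<alpha> \<beta> \<gamma> \<delta> w)) v"
  shows False
proof -
  define s where "s = inverse (1 - w)"
  have w: "w \<noteq> 1" "w \<noteq> 0" "complex_quat w" "invertible (frame w)" and s: "s \<noteq> 0"
    using n normal_data_frame [OF n] by (auto simp: normal_data_def s_def)
  note norms = normal_data_norms [OF n]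
  have "(v $ 1 = 0) \<noteq> (v $ 2 = 0)"
    by (rule eigenvector_diag [OF conjunct1 [OF norms]]) (use v(1) in \<open>simp add: normal_pair_def\<close>)
  moreover have "eigenvector (mat2 \<gamma> 0 0 \<delta>) (matrix_inv (frame w) *v v)"
    using eigenvector_conj_by [OF w(4)] v(2) by (simp add: normal_pair_def)
  then have "((matrix_inv (frame w) *v v) $ 1 = 0) \<noteq> ((matrix_inv (frame w) *v v) $ 2 = 0)"
    by (rule eigenvector_diag [OF conjunct2 [OF norms]])
  ultimately show False
    using w s by (auto simp: matrix_inv_frame mat2_mult_vec s_def)
qed

lemma regular_conj_normal_pair:
  assumes n: "normal_data \<alpha> \<beta> \<gamma> \<delta> w" and P: "P \<in> SL2H"
  shows "conj_pair P (normal_pair \<alpha> \<beta> \<gamma> \<delta> w) \<in> regular_pairs"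
proof -
  note n' = n [unfolded normal_data_def]
  have w: "w \<noteq> 1" using normal_data_frame [OF n] by blast
  have reg: "regular_loxodromic (conj_by Q (mat2 a 0 0 b))"
    if hyp: "Q \<in> SL2H" "nonreal a" "nonreal b" "1 < norm a" "norm a * norm b = 1" for Q a b
  proof -
    have "sq_det (conj_by Q (mat2 a 0 0 b)) = (norm a * norm b)\<^sup>2"
      using hyp(1) by (simp add: sq_det_conj_by SL2H_invertible sq_det_mat2 power_mult_distrib)
    then have "conj_by Q (mat2 a 0 0 b) \<in> SL2H"
      by (simp add: SL2H_iff hyp(5))
    moreover have "\<exists>r>1. \<exists>\<theta>\<in>{0<..<pi}. \<exists>\<phi>\<in>{0<..<pi}. \<exists>I\<in>\<S>\<^sup>2. \<exists>J\<in>\<S>\<^sup>2. mat2 a 0 0 b = lox_diag r I \<theta> J \<phi>"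
    proof (rule lox_diag_polar [OF hyp(2-5)])
      fix I \<theta> J \<phi>
      assume "mat2 a 0 0 b = lox_diag (norm a) I \<theta> J \<phi>" "I \<in> \<S>\<^sup>2" "J \<in> \<S>\<^sup>2" "\<theta> \<in> {0<..<pi}" "\<phi> \<in> {0<..<pi}"
      then show ?thesis
        using hyp(4) by blast
    qed
    ultimately show ?thesis
      unfolding regular_loxodromic_def using hyp(1) by metis
  qed
  have "regular_loxodromic (conj_by P (mat2 \<alpha> 0 0 \<beta>))"
    using reg [OF P] n' by blast
  moreover have "conj_by P (snd (normal_pair \<alpha> \<beta> \<gamma> \<delta> w)) = conj_by (P ** fix_matrix w) (mat2 \<gamma> 0 0 \<delta>)"
    using w P by (simp add: normal_pair_def conj_by_fix_matrix conj_by_conj_by SL2H_invertible flip: conj_by_fix_matrix(1))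
  then have "regular_loxodromic (conj_by P (snd (normal_pair \<alpha> \<beta> \<gamma> \<delta> w)))"
    using reg [OF SL2H_mult [OF P conj_by_fix_matrix(2) [OF w]]] n' by simp
  moreover have False
    if "p \<in> fixed_points (conj_by P (fst (normal_pair \<alpha> \<beta> \<gamma> \<delta> w)))" "p \<in> fixed_points (conj_by P (snd (normal_pair \<alpha> \<beta> \<gamma> \<delta> w)))" for p
    using normal_pair_no_common_eigenvector [OF n] eigenvector_conj_by [OF SL2H_invertible [OF P]]
      fixed_point_eigenvector [OF that(1)] fixed_point_eigenvector [OF that(2)] by blast
  ultimately show ?thesis
    unfolding regular_pairs_def conj_pair_def by (auto simp: normal_pair_def)
qed

lemma normal_pair_regular: "normal_data \<alpha> \<beta> \<gamma> \<delta> w \<Longrightarrow> normal_pair \<alpha> \<beta> \<gamma> \<delta> w \<in> regular_pairs"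
  using regular_conj_normal_pair [OF _ SL2H_one] by simp

lemma normal_pair_Mreg_star: "normal_data \<alpha> \<beta> \<gamma> \<delta> w \<Longrightarrow> pair_class (normal_pair \<alpha> \<beta> \<gamma> \<delta> w) \<in> Mreg_star"
  unfolding Mreg_star_def using normal_pair_regular normal_pair_mem pair_class_refl by blast

lemma Mreg_star_cases:
  assumes "m \<in> Mreg_star"
  obtains \<alpha> \<beta> \<gamma> \<delta> w where "normal_data \<alpha> \<beta> \<gamma> \<delta> w" "m = pair_class (normal_pair \<alpha> \<beta> \<gamma> \<delta> w)"
proof -
  obtain p n where "m = pair_class p" "n \<in> pair_class p" "n \<in> normal_pairs"
    using assms by (auto simp: Mreg_star_def)
  then obtain P where "P \<in> SL2H" "n = conj_pair P p"
    by (auto simp: pair_class_eq)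
  then have "pair_class n = m"
    using pair_class_conj_SL2H \<open>m = pair_class p\<close> by simp
  with normal_pairs_cases [OF \<open>n \<in> normal_pairs\<close>] that show thesis by metis
qed

section \<open>Normal pairs have scalar centraliser\<close>

lemma commute_diag:
  assumes "norm \<alpha> \<noteq> norm \<beta>" "X ** mat2 \<alpha> 0 0 \<beta> = mat2 \<alpha> 0 0 \<beta> ** X"
  obtains x y where "X = mat2 x 0 0 y" "x * \<alpha> = \<alpha> * x" "y * \<beta> = \<beta> * y"
proof (cases X rule: mat2_cases)
  case (1 x u v y)
  then have eq: "x * \<alpha> = \<alpha> * x" "u * \<beta> = \<alpha> * u" "v * \<alpha> = \<beta> * v" "y * \<beta> = \<beta> * y"
    using assms(2) by simp_all
  have "norm u * norm \<beta> = norm \<alpha> * norm u" "norm v * norm \<alpha> = norm \<beta> * norm v"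
    using arg_cong [OF eq(2), of norm] arg_cong [OF eq(3), of norm] by (simp_all add: norm_mult)
  then have "u = 0" "v = 0"
    using assms(1) by auto
  with 1 eq that show thesis by blast
qed

text \<open>A matrix commuting with both members is diagonal, and it is still diagonal when it is read in the frame of
the second one. This forces it to be a quaternion \<open>x\<close> times the identity that commutes with \<open>w\<close> and
with the four eigenvalues. As \<open>w\<close> is complex but not real, \<open>x\<close> is complex; if \<open>x\<close> were not real, the
eigenvalues would all be complex.\<close>

lemma normal_pair_centraliser:
  assumes n: "normal_data \<alpha> \<beta> \<gamma> \<delta> w" and AB: "normal_pair \<alpha> \<beta> \<gamma> \<delta> w = (A, B)"
    and X: "X ** A = A ** X" "X ** B = B ** X"
  obtains r where "X = r *\<^sub>R mat 1"
proof -
  note n' = n [unfolded normal_data_def]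
  note norms = normal_data_norms [OF n]
  define s where "s = inverse (1 - w)"
  have w: "w \<noteq> 1" "w \<noteq> 0" "complex_quat w" "0 < Im1 w" and F: "invertible (frame w)" and s: "s \<noteq> 0"
    using n' normal_data_frame [OF n] by (auto simp: s_def)
  have A: "A = mat2 \<alpha> 0 0 \<beta>" and B: "B = conj_by (frame w) (mat2 \<gamma> 0 0 \<delta>)"
    using AB by (simp_all add: normal_pair_def)
  obtain x y where xy: "X = mat2 x 0 0 y" "x * \<alpha> = \<alpha> * x" "y * \<beta> = \<beta> * y"
    using commute_diag [of \<alpha> \<beta> X] norms X(1) A by blast
  define Y where "Y = conj_by (matrix_inv (frame w)) X"
  have Fi: "invertible (matrix_inv (frame w))"
    by (rule invertible_matrix_inv [OF F])
  have "Y ** mat2 \<gamma> 0 0 \<delta> = mat2 \<gamma> 0 0 \<delta> ** Y"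
  proof -
    have "conj_by (matrix_inv (frame w)) (X ** B) = conj_by (matrix_inv (frame w)) (B ** X)"
      by (simp add: X(2))
    then show ?thesis
      unfolding conj_by_mult [OF Fi, symmetric] B conj_by_inv_cancel(1) [OF F] Y_def .
  qed
  then obtain x' y' where xy': "Y = mat2 x' 0 0 y'" "x' * \<gamma> = \<gamma> * x'" "y' * \<delta> = \<delta> * y'"
    using commute_diag [of \<gamma> \<delta> Y] norms by blast
  have "X = conj_by (frame w) Y"
    unfolding Y_def by (simp add: conj_by_inv_cancel(2) [OF F])
  then have "X ** frame w = frame w ** Y"
    unfolding conj_by_def by (simp add: matrix_mul_assoc [symmetric] matrix_inv_cancel [OF F])
  then have "x = x' \<and> x * w = w * y' \<and> y = x' \<and> y = y'"
    unfolding xy(1) xy'(1) frame_def by auto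
  then have c: "x * w = w * x" "x * \<alpha> = \<alpha> * x" "x * \<beta> = \<beta> * x" "x * \<gamma> = \<gamma> * x" "x * \<delta> = \<delta> * x" and yx: "y = x"
    using xy(2,3) xy'(2,3) by auto
  have cx: "complex_quat x"
    using commute_complex_quat [OF w(3)] w(4) c(1) by simp
  have "Im1 x = 0"
  proof (rule ccontr)
    assume "Im1 x \<noteq> 0"
    then have "complex_quat q" if "x * q = q * x" for q
      using commute_complex_quat [OF cx] that by simp
    then show False
      using c n' by blast
  qed
  then have "x = of_real (Re0 x)"
    using cx by (simp add: quat_eq_iff complex_quat_def)
  then have "X = Re0 x *\<^sub>R mat 1"
    using xy(1) yx by (simp add: mat2_one of_real_def)
  then show thesis by (rule that)
qed

section \<open>Normal pairs fill an open set\<close>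

lemma sylvester:
  fixes a b m :: quat
  assumes "norm a \<noteq> norm b"
  obtains x where "x * b - a * x = m"
proof -
  define f where "f x = x * b - a * x" for x
  have lin: "linear f"
    by (rule linearI) (simp_all add: f_def distrib_right distrib_left scaleR_diff_right)
  have "inj f"
    unfolding linear_injective_0 [OF lin]
  proof (intro allI impI)
    fix x assume "f x = 0"
    then have "norm (x * b) = norm (a * x)"
      by (simp add: f_def)
    then show "x = 0"
      using assms by (auto simp: norm_mult mult.commute)
  qed
  then have "surj f"
    by (rule eucl.linear_inj_imp_surj [OF lin])
  then obtain x where "m = f x"
    by (rule surjE)
  then show thesis
    by (intro that [of x]) (simp only: f_def)
qed

lemma linear_surj_bounded_right_inverse:
  fixes f :: "'a::euclidean_space \<Rightarrow> 'b::euclidean_space"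
  assumes "linear f" "surj f"
  obtains g where "bounded_linear g" "f \<circ> g = id" "\<And>y. f (g y) = y"
proof -
  obtain g where "linear g" "f \<circ> g = id"
    using linear_surjective_right_inverse [OF assms] by blast
  then show thesis
    using that [of g] by (simp add: linear_conv_bounded_linear fun_eq_iff)
qed

text \<open>The derivative of \<open>conj_by g (mat2 a 0 0 b)\<close> in \<open>(g, a, b)\<close> at \<open>g = mat 1\<close> is onto: the diagonal
entries come from \<open>a\<close> and \<open>b\<close>, the others from solutions of Sylvester equations. So the map is open
there. The open set \<open>W\<close> keeps the diagonalisation close to the given one.\<close>

lemma diag_frame_open:
  assumes ne: "norm \<alpha> \<noteq> norm \<beta>" and W: "open W" "(mat 1, \<alpha>, \<beta>) \<in> W"
  obtains N where "open N" "mat2 \<alpha> 0 0 \<beta> \<in> N"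
    "\<And>A. A \<in> N \<Longrightarrow> \<exists>g a b. (g, a, b) \<in> W \<and> sq_det g \<noteq> 0 \<and> A = conj_by g (mat2 a 0 0 b)"
proof -
  define D where "D = mat2 \<alpha> 0 0 \<beta>"
  define q where "q z = mat2 (fst (snd z)) 0 0 (snd (snd z))" for z :: "mat2 \<times> quat \<times> quat"
  define f where "f z = conj_by (fst z) (q z)" for z
  define S where "S = {z :: mat2 \<times> quat \<times> quat. sq_det (fst z) \<noteq> 0}"
  define f' where "f' h = fst h ** D - D ** fst h + q h" for h
  have q: "bounded_linear q"
    unfolding linear_conv_bounded_linear [symmetric] by (rule linearI) (simp_all add: q_def)
  have S: "open S"
    unfolding S_def by (intro open_Collect_neq continuous_on_const
        continuous_on_compose2 [OF continuous_sq_det [of UNIV]] continuous_on_fst continuous_on_id) auto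
  have cont: "continuous_on S f"
    unfolding f_def [abs_def] using linear_continuous_on [OF q]
    by (intro continuous_on_conj_by continuous_on_fst continuous_on_id) (auto simp: S_def)
  have z: "(mat 1, \<alpha>, \<beta>) \<in> S"
    by (simp add: S_def)
  have qz: "q (mat 1, \<alpha>, \<beta>) = D"
    by (simp add: q_def D_def)
  have der: "(f has_derivative f') (at (mat 1, \<alpha>, \<beta>))"
    using has_derivative_conj_by [OF bounded_linear_imp_has_derivative [OF bounded_linear_fst] _
        bounded_linear_imp_has_derivative [OF q], of "(mat 1, \<alpha>, \<beta>)"]
    by (simp add: f_def [abs_def] f'_def [abs_def] qz)
  have "surj f'"
    unfolding surj_def
  proof
    fix M :: mat2
    obtain x where x: "x * \<beta> - \<alpha> * x = M $ 1 $ 2" using sylvester [OF ne] by blast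
    obtain y where y: "y * \<alpha> - \<beta> * y = M $ 2 $ 1" using sylvester [OF ne [symmetric]] by blast
    have "M = f' (mat2 0 x y 0, M $ 1 $ 1, M $ 2 $ 2)"
      by (simp add: f'_def q_def D_def mat2_eq_iff x y)
    then show "\<exists>h. M = f' h" by blast
  qed
  then obtain g' where g': "bounded_linear g'" "f' \<circ> g' = id"
    using linear_surj_bounded_right_inverse [OF has_derivative_linear [OF der]] by blast
  have "f (mat 1, \<alpha>, \<beta>) \<in> interior (f ` (S \<inter> W))"
    by (rule sussmann_open_mapping [OF S cont z der g']) (use S W z in \<open>auto simp: interior_open open_Int\<close>)
  then have mem: "D \<in> interior (f ` (S \<inter> W))"
    by (simp add: f_def qz)
  show thesis
  proof (rule that [OF open_interior mem [unfolded D_def]])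
    fix A assume "A \<in> interior (f ` (S \<inter> W))"
    then obtain z where "z \<in> S" "z \<in> W" "A = f z"
      using interior_subset by blast
    then show "\<exists>g a b. (g, a, b) \<in> W \<and> sq_det g \<noteq> 0 \<and> A = conj_by g (mat2 a 0 0 b)"
      by (intro exI [of _ "fst z"] exI [of _ "fst (snd z)"] exI [of _ "snd (snd z)"]) (simp add: S_def f_def q_def)
  qed
qed

lemma conj_by_diag:
  assumes "x \<noteq> 0" "y \<noteq> 0"
  shows "conj_by (mat2 x 0 0 y) (mat2 a 0 0 b) = mat2 (x * a * inverse x) 0 0 (y * b * inverse y)"
proof -
  have "matrix_inv (mat2 x 0 0 y) = mat2 (inverse x) 0 0 (inverse y)"
    by (rule matrix_inv_eqI) (use assms in \<open>simp_all add: mat2_one\<close>)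
  then show ?thesis
    by (simp add: conj_by_def)
qed

lemma quat_conj_commute:
  assumes "u \<noteq> 0" "(u * p * inverse u) * (u * q * inverse u) = (u * q * inverse u) * (u * p * inverse u)"
  shows "p * q = q * (p :: quat)"
proof -
  have *: "(u * p * inverse u) * (u * q * inverse u) = u * (p * q) * inverse u" for p q
    using assms(1) by (simp add: mult.assoc) (simp flip: mult.assoc)
  show ?thesis
    using assms unfolding * by simp
qed

lemma norm_quat_conj: "u \<noteq> 0 \<Longrightarrow> norm (u * q * inverse u) = norm (q :: quat)"
  by (simp add: norm_mult norm_inverse)

lemma bounded_linear_conj_by: "bounded_linear (conj_by P)"
  unfolding conj_by_def [abs_def]
  by (intro bounded_linear_compose [OF bounded_bilinear.bounded_linear_left [OF bounded_bilinear_matrix_mult]]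
      bounded_bilinear.bounded_linear_right [OF bounded_bilinear_matrix_mult])

text \<open>A diagonal change of frame only conjugates the eigenvalues. So the two diagonal factors around \<open>frame w'\<close>
can be absorbed, and a common conjugation moves \<open>w'\<close> into the upper half-plane. The commutation
hypothesis says, in a form invariant under these changes, that the eigenvalues are not all complex.\<close>

lemma normal_pair_of_frames:
  assumes w': "nonreal w'" and a: "1 < norm a" "norm a * norm b = 1" "1 < norm c" "norm c * norm d = 1"
    and nr: "nonreal a" "nonreal b" "nonreal c" "nonreal d"
    and ne: "x \<noteq> 0" "y \<noteq> 0" "\<sigma> \<noteq> 0"
    and nc: "\<not> ((inverse x * a * x) * w' = w' * (inverse x * a * x) \<and> (inverse y * b * y) * w' = w' * (inverse y * b * y) \<and>
        c * w' = w' * c \<and> (\<sigma> * d * inverse \<sigma>) * w' = w' * (\<sigma> * d * inverse \<sigma>))"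
    and g: "invertible g"
  obtains P \<alpha> \<beta> \<gamma> \<delta> w where "P \<in> SL2H" "normal_data \<alpha> \<beta> \<gamma> \<delta> w"
    "(conj_by g (mat2 a 0 0 b), conj_by (g ** (mat2 x 0 0 y ** frame w' ** mat2 1 0 0 \<sigma>)) (mat2 c 0 0 d))
      = conj_pair P (normal_pair \<alpha> \<beta> \<gamma> \<delta> w)"
proof -
  obtain v where v: "v \<noteq> 0" "complex_quat (v * w' * inverse v)" "0 < Im1 (v * w' * inverse v)"
    using conj_to_complex [OF w'] by blast
  define w where "w = v * w' * inverse v"
  define E where "E = mat2 (x * inverse v) 0 0 (y * inverse v)"
  define E' where "E' = mat2 (v * inverse x) 0 0 (v * inverse y)"
  define U where "U = mat2 v 0 0 (v * \<sigma>)"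
  define \<alpha> \<beta> \<gamma> \<delta> where "\<alpha> = (v * inverse x) * a * inverse (v * inverse x)"
    "\<beta> = (v * inverse y) * b * inverse (v * inverse y)" "\<gamma> = v * c * inverse v" "\<delta> = (v * \<sigma>) * d * inverse (v * \<sigma>)"
  have ne': "v * inverse x \<noteq> 0" "v * inverse y \<noteq> 0" "v * \<sigma> \<noteq> 0"
    using ne v(1) by simp_all
  have \<alpha>': "\<alpha> = v * (inverse x * a * x) * inverse v" "\<beta> = v * (inverse y * b * y) * inverse v"
    "\<delta> = v * (\<sigma> * d * inverse \<sigma>) * inverse v"
    unfolding \<alpha>_\<beta>_\<gamma>_\<delta>_def using ne v(1) by (simp_all add: nonzero_inverse_mult_distrib mult.assoc)
  have "\<not> (complex_quat \<alpha> \<and> complex_quat \<beta> \<and> complex_quat \<gamma> \<and> complex_quat \<delta>)"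
  proof
    assume "complex_quat \<alpha> \<and> complex_quat \<beta> \<and> complex_quat \<gamma> \<and> complex_quat \<delta>"
    then have "\<alpha> * w = w * \<alpha>" "\<beta> * w = w * \<beta>" "\<gamma> * w = w * \<gamma>" "\<delta> * w = w * \<delta>"
      using complex_quat_commute [of w] v(2) by (simp_all add: w_def)
    then show False
      using nc quat_conj_commute [OF v(1)] unfolding \<alpha>' \<alpha>_\<beta>_\<gamma>_\<delta>_def(3) w_def by blast
  qed
  then have data: "normal_data \<alpha> \<beta> \<gamma> \<delta> w"
    unfolding normal_data_def \<alpha>_\<beta>_\<gamma>_\<delta>_def norm_quat_conj [OF ne'(1)] norm_quat_conj [OF ne'(2)]
      norm_quat_conj [OF ne'(3)] norm_quat_conj [OF v(1)] nonreal_conj [OF ne'(1)] nonreal_conj [OF ne'(2)]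
      nonreal_conj [OF ne'(3)] nonreal_conj [OF v(1)]
    using a nr v(2,3) by (simp add: w_def)
  have E: "invertible E" "invertible E'" "E ** E' = mat 1" and U: "invertible U"
    using ne v(1) by (simp_all add: E_def E'_def U_def invertible_iff_sq_det sq_det_mat2 mat2_one mult.assoc)
      (simp_all flip: mult.assoc)
  have F: "invertible (frame w)"
    using normal_data_frame [OF data] by blast
  have A: "conj_by (g ** E) (mat2 \<alpha> 0 0 \<beta>) = conj_by g (mat2 a 0 0 b)"
  proof -
    have "mat2 \<alpha> 0 0 \<beta> = conj_by E' (mat2 a 0 0 b)"
      unfolding E'_def \<alpha>_\<beta>_\<gamma>_\<delta>_def by (rule conj_by_diag [OF ne'(1,2), symmetric])
    then have "conj_by E (mat2 \<alpha> 0 0 \<beta>) = mat2 a 0 0 b"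
      using E by (simp add: conj_by_conj_by)
    then show ?thesis
      by (simp add: conj_by_conj_by [OF g E(1), symmetric])
  qed
  have B: "conj_by (g ** E) (conj_by (frame w) (mat2 \<gamma> 0 0 \<delta>))
      = conj_by (g ** (mat2 x 0 0 y ** frame w' ** mat2 1 0 0 \<sigma>)) (mat2 c 0 0 d)"
  proof -
    have "mat2 \<gamma> 0 0 \<delta> = conj_by U (mat2 c 0 0 d)"
      unfolding U_def \<alpha>_\<beta>_\<gamma>_\<delta>_def by (rule conj_by_diag [OF v(1) ne'(3), symmetric])
    moreover have "E ** (frame w ** U) = mat2 x 0 0 y ** frame w' ** mat2 1 0 0 \<sigma>"
      using v(1) by (simp add: E_def U_def frame_def w_def mult.assoc) (simp flip: mult.assoc)
    moreover have "invertible (frame w ** U)"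
      using F U by (simp add: invertible_iff_sq_det sq_det_mult)
    moreover have "invertible (E ** (frame w ** U))"
      using E F U by (simp add: invertible_iff_sq_det sq_det_mult)
    ultimately show ?thesis
      using g E F U by (simp add: conj_by_conj_by [symmetric])
        (simp add: conj_by_conj_by invertible_iff_sq_det sq_det_mult matrix_mul_assoc)
  qed
  have gE: "invertible (g ** E)"
    using g E by (simp add: invertible_iff_sq_det sq_det_mult)
  obtain P where P: "P \<in> SL2H" "\<And>A. conj_by P A = conj_by (g ** E) A"
    using conj_by_SL2H [OF gE] by blast
  show thesis
    by (rule that [OF P(1) data]) (simp add: conj_pair_def normal_pair_def P(2) A B)
qed

lemma tendsto_matrix_inv:
  assumes "(f \<longlongrightarrow> (M :: mat2)) F" "sq_det M \<noteq> 0"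
  shows "((\<lambda>x. matrix_inv (f x)) \<longlongrightarrow> matrix_inv M) F"
proof -
  have "isCont (matrix_inv :: mat2 \<Rightarrow> mat2) M"
    using continuous_on_matrix_inv open_sq_det_nonzero assms(2) by (simp add: continuous_on_eq_continuous_at)
  then show ?thesis
    by (rule isCont_tendsto_compose) (rule assms(1))
qed

lemmas tendsto_matrix_mult = bounded_bilinear.tendsto [OF bounded_bilinear_matrix_mult]

lemma eventually_nonreal:
  assumes "(f \<longlongrightarrow> q) F" "nonreal q"
  shows "eventually (\<lambda>x. nonreal (f x)) F"
proof -
  have "((\<lambda>x. f x - of_real (Re0 (f x))) \<longlongrightarrow> q - of_real (Re0 q)) F"
    by (intro tendsto_intros assms(1) bounded_linear.tendsto [OF bounded_linear_Re0])
  then have "eventually (\<lambda>x. f x - of_real (Re0 (f x)) \<noteq> 0) F"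
    by (rule tendsto_imp_eventually_ne) (use assms(2) in \<open>simp add: nonreal_def\<close>)
  then show ?thesis
    by (simp add: nonreal_def)
qed

text \<open>Near the given pair both members can be diagonalised, in frames \<open>g\<close> and \<open>frame w ** h\<close> with \<open>g\<close> and \<open>h\<close>
close to the identity. The relative frame \<open>K\<close> is close to \<open>frame w\<close>, so three of its entries are
nonzero and it factors as a diagonal matrix times some \<open>frame w'\<close> times a diagonal matrix. The open
conditions of \<^const>\<open>normal_data\<close> persist, and the determinants yield the products of norms.\<close>

lemma normal_pair_open:
  assumes n: "normal_data \<alpha> \<beta> \<gamma> \<delta> w"
  obtains N where "open N" "normal_pair \<alpha> \<beta> \<gamma> \<delta> w \<in> N"
    "\<And>p. p \<in> N \<Longrightarrow> fst p \<in> SL2H \<Longrightarrow> snd p \<in> SL2H \<Longrightarrow>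
      \<exists>P \<alpha>' \<beta>' \<gamma>' \<delta>' w'. P \<in> SL2H \<and> normal_data \<alpha>' \<beta>' \<gamma>' \<delta>' w' \<and> p = conj_pair P (normal_pair \<alpha>' \<beta>' \<gamma>' \<delta>' w')"
proof -
  note n' = n [unfolded normal_data_def]
  note norms = normal_data_norms [OF n]
  define Fw where "Fw = frame w"
  have F: "invertible Fw" and w0: "w \<noteq> 0"
    using normal_data_frame [OF n] by (simp_all add: Fw_def)
  define K where "K z = matrix_inv (fst (fst z)) ** Fw ** fst (snd z)" for z :: "(mat2 \<times> quat \<times> quat) \<times> (mat2 \<times> quat \<times> quat)"
  define w' where "w' z = inverse (K z $ 1 $ 1) * K z $ 1 $ 2 * inverse (K z $ 2 $ 2) * K z $ 2 $ 1" for z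
  define \<sigma> where "\<sigma> z = inverse (K z $ 2 $ 1) * K z $ 2 $ 2" for z
  define a where "a z = fst (snd (fst z))" for z :: "(mat2 \<times> quat \<times> quat) \<times> (mat2 \<times> quat \<times> quat)"
  define b where "b z = snd (snd (fst z))" for z :: "(mat2 \<times> quat \<times> quat) \<times> (mat2 \<times> quat \<times> quat)"
  define c where "c z = fst (snd (snd z))" for z :: "(mat2 \<times> quat \<times> quat) \<times> (mat2 \<times> quat \<times> quat)"
  define d where "d z = snd (snd (snd z))" for z :: "(mat2 \<times> quat \<times> quat) \<times> (mat2 \<times> quat \<times> quat)"
  define cm where "cm q z = norm (q * w' z - w' z * q)" for q z
  \<comment> \<open>It vanishes exactly when the four eigenvalues, carried back to the frame of \<open>w'\<close>, all commute with
    \<open>w'\<close>, which is the condition excluded for normal data.\<close>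
  define \<Phi> where "\<Phi> z = cm (inverse (K z $ 1 $ 1) * a z * K z $ 1 $ 1) z + cm (inverse (K z $ 2 $ 1) * b z * K z $ 2 $ 1) z
    + cm (c z) z + cm (\<sigma> z * d z * inverse (\<sigma> z)) z" for z
  define z0 where "z0 = ((mat 1 :: mat2, \<alpha>, \<beta>), (mat 1 :: mat2, \<gamma>, \<delta>))"
  have id: "((\<lambda>z. z) \<longlongrightarrow> z0) (nhds z0)"
    by (rule filterlim_ident)
  have inv1: "matrix_inv (mat 1) = (mat 1 :: mat2)"
    by (rule matrix_inv_eqI) simp_all
  have K0: "(K \<longlongrightarrow> Fw) (nhds z0)"
  proof -
    have "(K \<longlongrightarrow> matrix_inv (fst (fst z0)) ** Fw ** fst (snd z0)) (nhds z0)"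
      unfolding K_def [abs_def]
      by (intro tendsto_matrix_mult tendsto_matrix_inv tendsto_fst tendsto_snd tendsto_const id) (simp add: z0_def)
    then show ?thesis
      by (simp add: z0_def inv1)
  qed
  have k: "((\<lambda>z. K z $ 1 $ 1) \<longlongrightarrow> 1) (nhds z0)" "((\<lambda>z. K z $ 1 $ 2) \<longlongrightarrow> w) (nhds z0)"
    "((\<lambda>z. K z $ 2 $ 1) \<longlongrightarrow> 1) (nhds z0)" "((\<lambda>z. K z $ 2 $ 2) \<longlongrightarrow> 1) (nhds z0)"
    using bounded_linear.tendsto [OF bounded_linear_nth2 K0, of 1 1] bounded_linear.tendsto [OF bounded_linear_nth2 K0, of 1 2]
      bounded_linear.tendsto [OF bounded_linear_nth2 K0, of 2 1] bounded_linear.tendsto [OF bounded_linear_nth2 K0, of 2 2]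
    by (simp_all add: Fw_def frame_def)
  have abcd: "(a \<longlongrightarrow> \<alpha>) (nhds z0)" "(b \<longlongrightarrow> \<beta>) (nhds z0)" "(c \<longlongrightarrow> \<gamma>) (nhds z0)" "(d \<longlongrightarrow> \<delta>) (nhds z0)"
    using tendsto_fst [OF tendsto_snd [OF tendsto_fst [OF id]]] tendsto_snd [OF tendsto_snd [OF tendsto_fst [OF id]]]
      tendsto_fst [OF tendsto_snd [OF tendsto_snd [OF id]]] tendsto_snd [OF tendsto_snd [OF tendsto_snd [OF id]]]
    by (simp_all add: a_def [abs_def] b_def [abs_def] c_def [abs_def] d_def [abs_def] z0_def)
  have w't: "(w' \<longlongrightarrow> w) (nhds z0)"
  proof -
    have "(w' \<longlongrightarrow> inverse 1 * w * inverse 1 * 1) (nhds z0)"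
      unfolding w'_def [abs_def] by (intro tendsto_mult tendsto_inverse k) simp_all
    then show ?thesis by simp
  qed
  have \<sigma>t: "(\<sigma> \<longlongrightarrow> 1) (nhds z0)"
  proof -
    have "(\<sigma> \<longlongrightarrow> inverse 1 * 1) (nhds z0)"
      unfolding \<sigma>_def [abs_def] by (intro tendsto_mult tendsto_inverse k) simp_all
    then show ?thesis by simp
  qed
  have "(\<Phi> \<longlongrightarrow> norm (inverse 1 * \<alpha> * 1 * w - w * (inverse 1 * \<alpha> * 1)) + norm (inverse 1 * \<beta> * 1 * w - w * (inverse 1 * \<beta> * 1))
      + norm (\<gamma> * w - w * \<gamma>) + norm (1 * \<delta> * inverse 1 * w - w * (1 * \<delta> * inverse 1))) (nhds z0)"
    unfolding \<Phi>_def [abs_def] cm_def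
    by (intro tendsto_add tendsto_norm tendsto_diff tendsto_mult tendsto_inverse k abcd w't \<sigma>t) simp_all
  moreover have "norm (inverse 1 * \<alpha> * 1 * w - w * (inverse 1 * \<alpha> * 1)) + norm (inverse 1 * \<beta> * 1 * w - w * (inverse 1 * \<beta> * 1))
      + norm (\<gamma> * w - w * \<gamma>) + norm (1 * \<delta> * inverse 1 * w - w * (1 * \<delta> * inverse 1)) \<noteq> 0"
  proof
    assume "norm (inverse 1 * \<alpha> * 1 * w - w * (inverse 1 * \<alpha> * 1)) + norm (inverse 1 * \<beta> * 1 * w - w * (inverse 1 * \<beta> * 1))
      + norm (\<gamma> * w - w * \<gamma>) + norm (1 * \<delta> * inverse 1 * w - w * (1 * \<delta> * inverse 1)) = 0"
    then have "\<alpha> * w = w * \<alpha>" "\<beta> * w = w * \<beta>" "\<gamma> * w = w * \<gamma>" "\<delta> * w = w * \<delta>"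
      by (simp_all add: add_nonneg_eq_0_iff del: quat_mult_sel)
    then show False
      using n' commute_complex_quat [of w] by auto
  qed
  ultimately have e\<Phi>: "eventually (\<lambda>z. \<Phi> z \<noteq> 0) (nhds z0)"
    by (rule tendsto_imp_eventually_ne)
  have ev: "eventually (\<lambda>z. \<Phi> z \<noteq> 0 \<and> nonreal (w' z) \<and> 1 < norm (a z) \<and> 1 < norm (c z) \<and>
      nonreal (a z) \<and> nonreal (b z) \<and> nonreal (c z) \<and> nonreal (d z) \<and>
      K z $ 1 $ 1 \<noteq> 0 \<and> K z $ 2 $ 1 \<noteq> 0 \<and> K z $ 2 $ 2 \<noteq> 0) (nhds z0)"
  proof (intro eventually_conj)
    show "\<forall>\<^sub>F z in nhds z0. \<Phi> z \<noteq> 0"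
      by (rule e\<Phi>)
    show "\<forall>\<^sub>F z in nhds z0. 1 < norm (a z)" "\<forall>\<^sub>F z in nhds z0. 1 < norm (c z)"
      using order_tendstoD(1) [OF tendsto_norm [OF abcd(1)], of 1] order_tendstoD(1) [OF tendsto_norm [OF abcd(3)], of 1] n'
      by blast+
    show "\<forall>\<^sub>F z in nhds z0. K z $ 1 $ 1 \<noteq> 0" "\<forall>\<^sub>F z in nhds z0. K z $ 2 $ 1 \<noteq> 0" "\<forall>\<^sub>F z in nhds z0. K z $ 2 $ 2 \<noteq> 0"
      using tendsto_imp_eventually_ne [OF k(1), of 0] tendsto_imp_eventually_ne [OF k(3), of 0]
        tendsto_imp_eventually_ne [OF k(4), of 0] by simp_all
    show "\<forall>\<^sub>F z in nhds z0. nonreal (a z)" "\<forall>\<^sub>F z in nhds z0. nonreal (b z)"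
      "\<forall>\<^sub>F z in nhds z0. nonreal (c z)" "\<forall>\<^sub>F z in nhds z0. nonreal (d z)"
      using eventually_nonreal [OF abcd(1)] eventually_nonreal [OF abcd(2)] eventually_nonreal [OF abcd(3)]
        eventually_nonreal [OF abcd(4)] n' by blast+
    have "nonreal w"
      using n' by (simp add: nonreal_iff)
    then show "\<forall>\<^sub>F z in nhds z0. nonreal (w' z)"
      by (rule eventually_nonreal [OF w't])
  qed
  then obtain S where S: "open S" "z0 \<in> S" and cond: "\<And>z. z \<in> S \<Longrightarrow> \<Phi> z \<noteq> 0 \<and> nonreal (w' z) \<and> 1 < norm (a z) \<and> 1 < norm (c z) \<and>
      nonreal (a z) \<and> nonreal (b z) \<and> nonreal (c z) \<and> nonreal (d z) \<and>
      K z $ 1 $ 1 \<noteq> 0 \<and> K z $ 2 $ 1 \<noteq> 0 \<and> K z $ 2 $ 2 \<noteq> 0"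
    unfolding eventually_nhds by blast
  obtain S1 S2 where S12: "open S1" "open S2" "z0 \<in> S1 \<times> S2" "S1 \<times> S2 \<subseteq> S"
    using open_prod_elim [OF S] by blast
  obtain N1 where N1: "open N1" "mat2 \<alpha> 0 0 \<beta> \<in> N1"
    "\<And>A. A \<in> N1 \<Longrightarrow> \<exists>g a b. (g, a, b) \<in> S1 \<and> sq_det g \<noteq> 0 \<and> A = conj_by g (mat2 a 0 0 b)"
    using diag_frame_open [of \<alpha> \<beta> S1] norms S12 by (auto simp: z0_def)
  obtain N2 where N2: "open N2" "mat2 \<gamma> 0 0 \<delta> \<in> N2"
    "\<And>A. A \<in> N2 \<Longrightarrow> \<exists>g a b. (g, a, b) \<in> S2 \<and> sq_det g \<noteq> 0 \<and> A = conj_by g (mat2 a 0 0 b)"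
    using diag_frame_open [of \<gamma> \<delta> S2] norms S12 by (auto simp: z0_def)
  define N where "N = N1 \<times> (conj_by (matrix_inv Fw) -` N2)"
  show thesis
  proof (rule that)
    show "open N"
      unfolding N_def
      by (intro open_Times N1(1) open_vimage N2(1) linear_continuous_on bounded_linear_conj_by)
    show "normal_pair \<alpha> \<beta> \<gamma> \<delta> w \<in> N"
      using N1(2) N2(2) by (simp add: N_def normal_pair_def conj_by_inv_cancel [OF F] flip: Fw_def)
    fix p assume p: "p \<in> N" and SL: "fst p \<in> SL2H" "snd p \<in> SL2H"
    have pN: "fst p \<in> N1" "conj_by (matrix_inv Fw) (snd p) \<in> N2"
      using p by (auto simp: N_def)
    obtain g ga gb where g: "(g, ga, gb) \<in> S1" "sq_det g \<noteq> 0" "fst p = conj_by g (mat2 ga 0 0 gb)"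
      using N1(3) [OF pN(1)] by blast
    obtain h hc hd where h: "(h, hc, hd) \<in> S2" "sq_det h \<noteq> 0" "conj_by (matrix_inv Fw) (snd p) = conj_by h (mat2 hc 0 0 hd)"
      using N2(3) [OF pN(2)] by blast
    define z where "z = ((g, ga, gb), (h, hc, hd))"
    have z: "z \<in> S" using g(1) h(1) S12(4) by (auto simp: z_def)
    note cz = cond [OF z]
    have abz: "a z = ga" "b z = gb" "c z = hc" "d z = hd"
      by (simp_all add: z_def a_def b_def c_def d_def)
    have gi: "invertible g" and hi: "invertible h"
      using g(2) h(2) by (simp_all add: invertible_iff_sq_det)
    have "K z = mat2 (K z $ 1 $ 1) 0 0 (K z $ 2 $ 1) ** frame (w' z) ** mat2 1 0 0 (\<sigma> z)"
      using cz by (simp add: mat2_eq_iff frame_def w'_def \<sigma>_def mult.assoc) (simp flip: mult.assoc)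
    moreover have gK: "g ** K z = Fw ** h"
      by (simp add: K_def z_def matrix_mul_assoc matrix_inv_cancel [OF gi])
    have "snd p = conj_by Fw (conj_by (matrix_inv Fw) (snd p))"
      by (simp add: conj_by_inv_cancel [OF F])
    then have "snd p = conj_by (g ** K z) (mat2 hc 0 0 hd)"
      by (simp add: h(3) conj_by_conj_by F hi gK)
    ultimately have snd_p: "snd p = conj_by (g ** (mat2 (K z $ 1 $ 1) 0 0 (K z $ 2 $ 1) ** frame (w' z) ** mat2 1 0 0 (\<sigma> z))) (mat2 hc 0 0 hd)"
      by simp
    have nn: "norm x * norm y = 1" if "conj_by Q (mat2 x 0 0 y) \<in> SL2H" "invertible Q" for Q x y
    proof -
      have "(norm x * norm y)\<^sup>2 = 1"
        using that by (simp add: SL2H_iff sq_det_conj_by sq_det_mat2 power_mult_distrib)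
      then have "norm x * norm y = 1 \<or> norm x * norm y = - 1"
        by (rule power2_eq_1_iff [THEN iffD1])
      moreover have "0 \<le> norm x * norm y" by simp
      ultimately show ?thesis
        by linarith
    qed
    have n1: "norm ga * norm gb = 1"
      by (rule nn [OF _ gi]) (use g(3) SL(1) in simp)
    have n2: "norm hc * norm hd = 1"
    proof (rule nn)
      show "conj_by (Fw ** h) (mat2 hc 0 0 hd) \<in> SL2H"
        using SL(2) \<open>snd p = conj_by (g ** K z) (mat2 hc 0 0 hd)\<close> gK by simp
      show "invertible (Fw ** h)"
        using F hi by (simp add: invertible_iff_sq_det sq_det_mult)
    qed
    have "\<sigma> z \<noteq> 0"
      using cz by (simp add: \<sigma>_def)
    moreover have "\<not> ((inverse (K z $ 1 $ 1) * ga * K z $ 1 $ 1) * w' z = w' z * (inverse (K z $ 1 $ 1) * ga * K z $ 1 $ 1)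
        \<and> (inverse (K z $ 2 $ 1) * gb * K z $ 2 $ 1) * w' z = w' z * (inverse (K z $ 2 $ 1) * gb * K z $ 2 $ 1)
        \<and> hc * w' z = w' z * hc \<and> (\<sigma> z * hd * inverse (\<sigma> z)) * w' z = w' z * (\<sigma> z * hd * inverse (\<sigma> z)))"
      using cz unfolding \<Phi>_def cm_def abz by auto
    ultimately have "\<exists>P \<alpha>' \<beta>' \<gamma>' \<delta>' v'. P \<in> SL2H \<and> normal_data \<alpha>' \<beta>' \<gamma>' \<delta>' v' \<and>
      (conj_by g (mat2 ga 0 0 gb), conj_by (g ** (mat2 (K z $ 1 $ 1) 0 0 (K z $ 2 $ 1) ** frame (w' z) ** mat2 1 0 0 (\<sigma> z))) (mat2 hc 0 0 hd))
        = conj_pair P (normal_pair \<alpha>' \<beta>' \<gamma>' \<delta>' v')"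
      using cz n1 n2 gi unfolding abz
      by - (rule normal_pair_of_frames [of "w' z" ga gb hc hd "K z $ 1 $ 1" "K z $ 2 $ 1" "\<sigma> z" g], (blast | assumption)+)
    moreover have "p = (conj_by g (mat2 ga 0 0 gb), conj_by (g ** (mat2 (K z $ 1 $ 1) 0 0 (K z $ 2 $ 1) ** frame (w' z) ** mat2 1 0 0 (\<sigma> z))) (mat2 hc 0 0 hd))"
      by (rule prod_eqI) (simp_all only: g(3) [symmetric] snd_p [symmetric] fst_conv snd_conv)
    ultimately show "\<exists>P \<alpha>' \<beta>' \<gamma>' \<delta>' w'. P \<in> SL2H \<and> normal_data \<alpha>' \<beta>' \<gamma>' \<delta>' w' \<and> p = conj_pair P (normal_pair \<alpha>' \<beta>' \<gamma>' \<delta>' w')"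
      by simp
  qed
qed

section \<open>Independence of the traces is a dense condition\<close>

lemma surj_ext_trace_deriv_scale:
  assumes surj: "surj (ext_trace_deriv (A, B))" and rs: "r \<noteq> 0" "s \<noteq> 0"
  shows "surj (ext_trace_deriv (r *\<^sub>R A, s *\<^sub>R B))"
  unfolding surj_def
proof
  fix y
  obtain \<kappa> where \<kappa>: "\<And>i. \<kappa> i \<noteq> 0" "\<And>A B i. ext_trace (r *\<^sub>R A, s *\<^sub>R B) $ i = \<kappa> i * ext_trace (A, B) $ i"
    using ext_trace_scale [OF rs] by blast
  define S where "S p = (r *\<^sub>R fst p, s *\<^sub>R snd p)" for p :: mpair
  have S: "bounded_linear S"
    unfolding linear_conv_bounded_linear [symmetric] S_def [abs_def]
    by (rule linearI) (simp_all add: scaleR_right_distrib mult.commute)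
  have eq: "\<kappa> i * ext_trace_deriv (A, B) v $ i = ext_trace_deriv (r *\<^sub>R A, s *\<^sub>R B) (S v) $ i" for i v
  proof -
    have "((\<lambda>p. \<kappa> i * ext_trace p $ i) has_derivative (\<lambda>v. \<kappa> i * ext_trace_deriv (A, B) v $ i)) (at (A, B))"
      by (intro has_derivative_mult_right bounded_linear.has_derivative [OF bounded_linear_vec_nth] has_derivative_ext_trace)
    moreover have "((\<lambda>p. ext_trace (S p)) has_derivative (\<lambda>v. ext_trace_deriv (r *\<^sub>R A, s *\<^sub>R B) (S v))) (at (A, B))"
      by (rule has_derivative_compose [OF bounded_linear_imp_has_derivative [OF S]])
        (simp add: S_def has_derivative_ext_trace)
    from bounded_linear.has_derivative [OF bounded_linear_vec_nth this, of i]
    have "((\<lambda>p. \<kappa> i * ext_trace p $ i) has_derivative (\<lambda>v. ext_trace_deriv (r *\<^sub>R A, s *\<^sub>R B) (S v) $ i)) (at (A, B))"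
      by (simp add: S_def \<kappa>(2))
    ultimately show ?thesis
      by (rule has_derivative_unique [THEN fun_cong])
  qed
  obtain v where "(\<chi> i. y $ i / \<kappa> i) = ext_trace_deriv (A, B) v"
    using surj by (rule surjE)
  then have "ext_trace_deriv (A, B) v $ i = y $ i / \<kappa> i" for i
    by (metis vec_lambda_beta)
  then have "y = ext_trace_deriv (r *\<^sub>R A, s *\<^sub>R B) (S v)"
    using \<kappa>(1) by (simp add: vec_eq_iff eq [symmetric])
  then show "\<exists>x. y = ext_trace_deriv (r *\<^sub>R A, s *\<^sub>R B) x" by blast
qed

lemma polynomial_nonzero_eventually:
  fixes q :: "real \<Rightarrow> real"
  assumes "real_polynomial_function q" "q a \<noteq> 0"
  shows "eventually (\<lambda>t. q t \<noteq> 0) (at x)"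
proof -
  obtain c n where q: "q = (\<lambda>t. \<Sum>i\<le>n. c i * t ^ i)"
    using assms(1) real_polynomial_function_iff_sum by blast
  have "\<exists>k\<le>n. c k \<noteq> 0"
  proof (rule ccontr)
    assume "\<not> (\<exists>k\<le>n. c k \<noteq> 0)"
    then have "q a = 0" by (simp add: q)
    with assms(2) show False ..
  qed
  then have "finite {t. q t = 0}"
    using polyfun_finite_roots [of c n] by (simp add: q)
  then have "\<not> x islimpt {t. q t = 0}"
    by (rule islimpt_finite)
  then show ?thesis
    by (simp add: islimpt_iff_eventually)
qed

text \<open>Composed with a right inverse of the derivative at \<open>a\<close>, the derivative becomes a square matrix whose
determinant is a polynomial in \<open>t\<close> with value 1 at \<open>a\<close>.\<close>

lemma surj_ext_trace_deriv_eventually: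
  assumes raw: "polynomial_function raw" and a: "surj (ext_trace_deriv (raw a))"
  shows "eventually (\<lambda>t. surj (ext_trace_deriv (raw t))) (at (x::real))"
proof -
  have lin: "linear (ext_trace_deriv p)" for p
    by (rule has_derivative_linear [OF has_derivative_ext_trace])
  obtain R where R: "bounded_linear R" "\<And>y. ext_trace_deriv (raw a) (R y) = y"
    using linear_surj_bounded_right_inverse [OF lin a] by blast
  define M where "M t = matrix (\<lambda>y. ext_trace_deriv (raw t) (R y))" for t
  have linM: "linear (\<lambda>y. ext_trace_deriv (raw t) (R y))" for t
    using linear_compose [OF bounded_linear.linear [OF R(1)] lin, of "raw t"] by (simp add: o_def)
  have "real_polynomial_function (\<lambda>t. det (M t))"
  proof -
    have "real_polynomial_function (\<lambda>t. ext_trace_deriv (raw t) v $ i)" for v i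
      using real_polynomial_function_compose [OF raw polynomial_ext_trace_deriv] by (simp add: o_def)
    then show ?thesis
      unfolding det_def M_def matrix_def
      by (intro real_polynomial_function_sum finite_permutations finite_class.finite_UNIV
          real_polynomial_function.intros(4) real_polynomial_function.intros(2) real_polynomial_function_prod)
        simp_all
  qed
  moreover have "M a = mat 1"
    by (simp add: M_def R(2) matrix_id_mat_1 [unfolded id_def])
  then have "det (M a) \<noteq> 0"
    by simp
  ultimately have "eventually (\<lambda>t. det (M t) \<noteq> 0) (at x)"
    by (rule polynomial_nonzero_eventually)
  then show ?thesis
  proof (rule eventually_mono)
    fix t assume "det (M t) \<noteq> 0"
    then have "inj (\<lambda>y. ext_trace_deriv (raw t) (R y))"
      unfolding M_def by (simp add: det_nz_iff_inj [OF linM])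
    then have "surj (\<lambda>y. ext_trace_deriv (raw t) (R y))"
      by (rule eucl.linear_inj_imp_surj [OF linM])
    then show "surj (ext_trace_deriv (raw t))"
      unfolding surj_def by blast
  qed
qed

text \<open>The data are moved along a straight line towards those of the reference pair, and the two matrices are
rescaled so that their determinants stay 1.\<close>

lemma normal_pair_dense:
  assumes n: "normal_data \<alpha> \<beta> \<gamma> \<delta> w" and N: "open N" "normal_pair \<alpha> \<beta> \<gamma> \<delta> w \<in> N"
  obtains \<alpha>' \<beta>' \<gamma>' \<delta>' w' where "normal_data \<alpha>' \<beta>' \<gamma>' \<delta>' w'" "normal_pair \<alpha>' \<beta>' \<gamma>' \<delta>' w' \<in> N"
    "surj (ext_trace_deriv (normal_pair \<alpha>' \<beta>' \<gamma>' \<delta>' w'))"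
proof -
  note n' = n [unfolded normal_data_def]
  define path where "path x y t = x + t *\<^sub>R (y - x)" for x y :: quat and t :: real
  define a where "a = path \<alpha> (Quat 0 0 (-1) 1)"
  define b where "b = path \<beta> (Quat 0 (-1) 0 0)"
  define c where "c = path \<gamma> (Quat (-1) 0 (-1) 0)"
  define d where "d = path \<delta> (Quat 0 0 0 1)"
  define u where "u = path w (Quat 1 1 0 0)"
  \<comment> \<open>The adjugate of the frame in place of its inverse makes the path polynomial; it only changes the second
    matrix by a real factor.\<close>
  define raw where "raw t = (mat2 (a t) 0 0 (b t), frame (u t) ** mat2 (c t) 0 0 (d t) ** adj2 (frame (u t)))" for t
  have path: "polynomial_function (path x y)" "path x y 0 = x" "path x y 1 = y" for x y
    unfolding path_def [abs_def]
    by (intro polynomial_function_add polynomial_function_const polynomial_function_mult polynomial_function_id) simp_all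
  have path_lim: "(path x y \<longlongrightarrow> x) (at 0)" for x y
    using continuous_polymonial_function [OF path(1), of 0 x y] path(2) [of x y] by (simp add: isCont_def)
  have poly_raw: "polynomial_function raw"
  proof -
    have 1: "polynomial_function (\<lambda>t. mat2 (a t) 0 0 (b t))"
      unfolding a_def b_def by (intro polynomial_mat2 path polynomial_function_const)
    have 2: "polynomial_function (\<lambda>t. frame (u t) ** mat2 (c t) 0 0 (d t) ** adj2 (frame (u t)))"
      unfolding c_def d_def u_def frame_def
      by (intro polynomial_matrix_mult polynomial_adj2 polynomial_mat2 path polynomial_function_const)
    have l: "bounded_linear (\<lambda>M. (M, 0 :: mat2))" "bounded_linear (\<lambda>M. (0 :: mat2, M))"
      by (intro bounded_linear_Pair bounded_linear_ident bounded_linear_zero)+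
    have "raw = (\<lambda>t. (mat2 (a t) 0 0 (b t), 0) + (0, frame (u t) ** mat2 (c t) 0 0 (d t) ** adj2 (frame (u t))))"
      by (simp add: raw_def fun_eq_iff)
    then show ?thesis
      using polynomial_function_add [OF polynomial_function_linear_image [OF l(1) 1] polynomial_function_linear_image [OF l(2) 2]]
      by (simp only:)
  qed
  have "raw 1 = (ref_A, ref_B)"
    by (simp add: raw_def a_def b_def c_def d_def u_def path ref_A_def ref_B_def ref_frame_def frame_def)
  then have "surj (ext_trace_deriv (raw 1))"
    by (simp add: ref_surj)
  then have e_surj: "eventually (\<lambda>t. surj (ext_trace_deriv (raw t))) (at 0)"
    by (rule surj_ext_trace_deriv_eventually [OF poly_raw])
  \<comment> \<open>The straight line violates the condition that the product of the norms of the eigenvalues is 1.\<close>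
  define r where "r x y t = 1 / sqrt (norm (x t) * norm (y t))" for x y :: "real \<Rightarrow> quat" and t
  have lim: "(a \<longlongrightarrow> \<alpha>) (at 0)" "(b \<longlongrightarrow> \<beta>) (at 0)" "(c \<longlongrightarrow> \<gamma>) (at 0)" "(d \<longlongrightarrow> \<delta>) (at 0)" "(u \<longlongrightarrow> w) (at 0)"
    unfolding a_def b_def c_def d_def u_def by (rule path_lim)+
  have r_lim: "(r x y \<longlongrightarrow> 1) (at 0)" if "(x \<longlongrightarrow> x0) (at 0)" "(y \<longlongrightarrow> y0) (at 0)" "norm x0 * norm y0 = 1" for x y and x0 y0 :: quat
  proof -
    have "(r x y \<longlongrightarrow> 1 / sqrt (norm x0 * norm y0)) (at 0)"
      unfolding r_def [abs_def] by (intro tendsto_intros that(1,2)) (simp add: that(3))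
    then show ?thesis by (simp add: that(3))
  qed
  have ab: "norm \<alpha> * norm \<beta> = 1" and cd: "norm \<gamma> * norm \<delta> = 1"
    using n' by simp_all
  define a' b' c' d' where "a' t = r a b t *\<^sub>R a t" and "b' t = r a b t *\<^sub>R b t"
    and "c' t = r c d t *\<^sub>R c t" and "d' t = r c d t *\<^sub>R d t" for t
  have lim': "(a' \<longlongrightarrow> \<alpha>) (at 0)" "(b' \<longlongrightarrow> \<beta>) (at 0)" "(c' \<longlongrightarrow> \<gamma>) (at 0)" "(d' \<longlongrightarrow> \<delta>) (at 0)"
    using tendsto_scaleR [OF r_lim [OF lim(1,2) ab] lim(1)] tendsto_scaleR [OF r_lim [OF lim(1,2) ab] lim(2)]
      tendsto_scaleR [OF r_lim [OF lim(3,4) cd] lim(3)] tendsto_scaleR [OF r_lim [OF lim(3,4) cd] lim(4)]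
    by (simp_all add: a'_def [abs_def] b'_def [abs_def] c'_def [abs_def] d'_def [abs_def])
  have ne: "\<alpha> \<noteq> 0" "\<beta> \<noteq> 0" "\<gamma> \<noteq> 0" "\<delta> \<noteq> 0"
    using ab cd by auto
  have e_ne: "\<forall>\<^sub>F t in at 0. a t \<noteq> 0 \<and> b t \<noteq> 0 \<and> c t \<noteq> 0 \<and> d t \<noteq> 0"
    by (intro eventually_conj tendsto_imp_eventually_ne [OF lim(1) ne(1)] tendsto_imp_eventually_ne [OF lim(2) ne(2)]
        tendsto_imp_eventually_ne [OF lim(3) ne(3)] tendsto_imp_eventually_ne [OF lim(4) ne(4)])
  \<comment> \<open>The distance of a quaternion from the complex plane.\<close>
  define nc where "nc x = \<bar>Im2 x\<bar> + \<bar>Im3 x\<bar>" for x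
  have nc: "nc x = 0 \<longleftrightarrow> complex_quat x" "0 \<le> nc x" for x
    by (auto simp: nc_def complex_quat_def)
  have bl: "bounded_linear Im1" "bounded_linear Im2" "bounded_linear Im3"
    by (rule linear_conv_bounded_linear [THEN iffD1], rule linearI, simp_all)+
  have nc_lim: "((\<lambda>t. nc (x t)) \<longlongrightarrow> nc x0) (at 0)" if "(x \<longlongrightarrow> x0) (at 0)" for x :: "real \<Rightarrow> quat" and x0
    unfolding nc_def by (intro tendsto_intros bounded_linear.tendsto [OF bl(2)] bounded_linear.tendsto [OF bl(3)] that)
  have "nc \<alpha> + nc \<beta> + nc \<gamma> + nc \<delta> \<noteq> 0"
    using n' nc by (smt (verit))
  then have e_nc: "\<forall>\<^sub>F t in at 0. nc (a' t) + nc (b' t) + nc (c' t) + nc (d' t) \<noteq> 0"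
    by (intro tendsto_imp_eventually_ne [of _ "nc \<alpha> + nc \<beta> + nc \<gamma> + nc \<delta>"] tendsto_add nc_lim lim')
  have cu: "complex_quat (u t)" for t
    using n' by (simp add: u_def path_def complex_quat_def)
  have e_u: "\<forall>\<^sub>F t in at 0. 0 < Im1 (u t)"
    using order_tendstoD(1) [OF bounded_linear.tendsto [OF bl(1) lim(5)], of 0] n' by blast
  have e_norm: "\<forall>\<^sub>F t in at 0. 1 < norm (a' t)" "\<forall>\<^sub>F t in at 0. 1 < norm (c' t)"
    using order_tendstoD(1) [OF tendsto_norm [OF lim'(1)], of 1] order_tendstoD(1) [OF tendsto_norm [OF lim'(3)], of 1] n' by blast+
  have e_nr: "\<forall>\<^sub>F t in at 0. nonreal (a' t)" "\<forall>\<^sub>F t in at 0. nonreal (b' t)" "\<forall>\<^sub>F t in at 0. nonreal (c' t)" "\<forall>\<^sub>F t in at 0. nonreal (d' t)"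
    using eventually_nonreal [OF lim'(1)] eventually_nonreal [OF lim'(2)] eventually_nonreal [OF lim'(3)]
      eventually_nonreal [OF lim'(4)] n' by blast+
  have prod1: "norm (r x y t *\<^sub>R x t) * norm (r x y t *\<^sub>R y t) = 1" if "x t \<noteq> 0" "y t \<noteq> 0" for x y t
  proof -
    have "0 < norm (x t) * norm (y t)"
      using that by simp
    then have "r x y t * r x y t * (norm (x t) * norm (y t)) = 1" "0 \<le> r x y t"
      using that by (simp_all add: r_def)
    then show ?thesis
      using that by (simp add: mult_ac)
  qed
  have e_data: "\<forall>\<^sub>F t in at 0. normal_data (a' t) (b' t) (c' t) (d' t) (u t)"
    using e_ne e_nc e_u e_norm e_nr
  proof eventually_elim
    case (elim t)
    have "norm (a' t) * norm (b' t) = 1" "norm (c' t) * norm (d' t) = 1"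
      using elim(1) prod1 [of a t b] prod1 [of c t d] by (simp_all add: a'_def b'_def c'_def d'_def)
    moreover have "\<not> (complex_quat (a' t) \<and> complex_quat (b' t) \<and> complex_quat (c' t) \<and> complex_quat (d' t))"
      using elim(2) unfolding nc(1) [symmetric] by linarith
    ultimately show ?case
      unfolding normal_data_def using elim cu by blast
  qed
  define scale where "scale t = r c d t / sq_det (frame (u t))" for t
  have np: "normal_pair (a' t) (b' t) (c' t) (d' t) (u t) = (r a b t *\<^sub>R fst (raw t), scale t *\<^sub>R snd (raw t))"
    if "normal_data (a' t) (b' t) (c' t) (d' t) (u t)" for t
  proof -
    have "sq_det (frame (u t)) \<noteq> 0"
      using normal_data_frame [OF that] by (simp add: invertible_iff_sq_det)
    then have "conj_by (frame (u t)) (mat2 (c t) 0 0 (d t)) = (1 / sq_det (frame (u t))) *\<^sub>R snd (raw t)"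
      by (simp add: conj_by_def matrix_inv_eq_adj2 raw_def)
    moreover have "mat2 (c' t) 0 0 (d' t) = r c d t *\<^sub>R mat2 (c t) 0 0 (d t)"
      by (simp add: c'_def d'_def)
    ultimately have "conj_by (frame (u t)) (mat2 (c' t) 0 0 (d' t)) = scale t *\<^sub>R snd (raw t)"
      by (simp only: conj_by_scaleR) (simp add: scale_def)
    then show ?thesis
      by (simp add: normal_pair_def raw_def a'_def b'_def)
  qed
  have dw: "sq_det (frame w) \<noteq> 0"
    using normal_data_frame [OF n] by (simp add: invertible_iff_sq_det)
  have scale_lim: "(scale \<longlongrightarrow> 1 / sq_det (frame w)) (at 0)"
    unfolding scale_def [abs_def] sq_det_frame
    by (intro tendsto_intros r_lim [OF lim(3,4) cd] lim(5)) (use dw in \<open>simp add: sq_det_frame\<close>)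
  have raw_lim: "(raw \<longlongrightarrow> raw 0) (at 0)"
    using continuous_polymonial_function [OF poly_raw, of 0] by (simp add: isCont_def)
  have np_lim: "((\<lambda>t. (r a b t *\<^sub>R fst (raw t), scale t *\<^sub>R snd (raw t))) \<longlongrightarrow> (1 *\<^sub>R fst (raw 0), (1 / sq_det (frame w)) *\<^sub>R snd (raw 0))) (at 0)"
    by (intro tendsto_Pair tendsto_scaleR r_lim [OF lim(1,2) ab] scale_lim tendsto_fst tendsto_snd raw_lim)
  have np0: "(1 *\<^sub>R fst (raw 0), (1 / sq_det (frame w)) *\<^sub>R snd (raw 0)) = normal_pair \<alpha> \<beta> \<gamma> \<delta> w"
    using dw by (simp add: raw_def normal_pair_def conj_by_def matrix_inv_eq_adj2 a_def b_def c_def d_def u_def path)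
  have e_N: "\<forall>\<^sub>F t in at 0. (r a b t *\<^sub>R fst (raw t), scale t *\<^sub>R snd (raw t)) \<in> N"
    by (rule topological_tendstoD [OF np_lim N(1)]) (unfold np0, rule N(2))
  have "\<forall>\<^sub>F t in at (0::real). normal_data (a' t) (b' t) (c' t) (d' t) (u t) \<and> normal_pair (a' t) (b' t) (c' t) (d' t) (u t) \<in> N \<and>
      surj (ext_trace_deriv (normal_pair (a' t) (b' t) (c' t) (d' t) (u t)))"
    using e_data e_N e_surj e_ne
  proof eventually_elim
    case (elim t)
    have "r a b t \<noteq> 0" "scale t \<noteq> 0"
      using elim(4) normal_data_frame [OF elim(1)] by (simp_all add: r_def scale_def invertible_iff_sq_det)
    then have "surj (ext_trace_deriv (r a b t *\<^sub>R fst (raw t), scale t *\<^sub>R snd (raw t)))"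
      by (intro surj_ext_trace_deriv_scale) (use elim(3) in simp_all)
    then show ?case
      using elim(1,2) np [OF elim(1)] by simp
  qed
  then obtain t where "normal_data (a' t) (b' t) (c' t) (d' t) (u t)" "normal_pair (a' t) (b' t) (c' t) (d' t) (u t) \<in> N"
      "surj (ext_trace_deriv (normal_pair (a' t) (b' t) (c' t) (d' t) (u t)))"
    using eventually_happens' [OF at_neq_bot] by blast
  then show thesis by (rule that)
qed

section \<open>Charts given by the traces\<close>

lemma DIM_quat: "DIM(quat) = 4"
  by (simp add: Basis_quat_def quat_i_def quat_j_def quat_k_def one_quat_def)

lemma regular_pairs_SL2H: "p \<in> regular_pairs \<Longrightarrow> fst p \<in> SL2H \<and> snd p \<in> SL2H"
  by (auto simp: regular_pairs_def regular_loxodromic_def)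

lemma SL2H_conj_pair:
  assumes "invertible P"
  shows "fst (conj_pair P p) \<in> SL2H \<longleftrightarrow> fst p \<in> SL2H" "snd (conj_pair P p) \<in> SL2H \<longleftrightarrow> snd p \<in> SL2H"
  using assms by (simp_all add: conj_pair_def SL2H_iff sq_det_conj_by)

text \<open>The value of \<^const>\<open>ext_trace\<close> at the pairs in \<open>SL(2,H)\<close> with trace vector \<open>t\<close>.\<close>

definition slice_value :: "real^15 \<Rightarrow> real^(15 + bool)"
  where "slice_value t = (\<chi> i. case i of Inl j \<Rightarrow> t $ j | Inr b \<Rightarrow> 1)"

lemma ext_trace_SL2H_pair:
  "fst p \<in> SL2H \<Longrightarrow> snd p \<in> SL2H \<Longrightarrow> ext_trace p = slice_value (trace_map (pair_class p))"
  using ext_trace_SL2H [of "fst p" "snd p"] by (simp add: slice_value_def)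

lemma ext_trace_slice_value:
  assumes "ext_trace p = slice_value t"
  shows "fst p \<in> SL2H" "snd p \<in> SL2H" "trace_map (pair_class p) = t"
proof -
  have c: "ext_trace p $ i = slice_value t $ i" for i
    by (simp add: assms)
  show SL: "fst p \<in> SL2H" "snd p \<in> SL2H"
    using c [of "Inr True"] c [of "Inr False"] by (simp_all add: ext_trace_def slice_value_def SL2H_iff)
  have "slice_value (trace_map (pair_class p)) $ Inl j = slice_value t $ Inl j" for j
    using ext_trace_SL2H_pair [OF SL] c by simp
  then show "trace_map (pair_class p) = t"
    by (simp add: slice_value_def vec_eq_iff)
qed

lemma trace_map_ext_trace:
  assumes "p \<in> regular_pairs"
  shows "trace_map (pair_class p) = (\<chi> j. ext_trace p $ Inl j)"
  using ext_trace_SL2H_pair [of p] regular_pairs_SL2H [OF assms] by (simp add: slice_value_def vec_eq_iff)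

text \<open>The derivative of \<open>(X, s) \<mapsto> conj_pair (mat 1 + X) (p0 + R s)\<close> at the origin has only the pairs of a real
scalar \<open>X\<close> and \<open>s = 0\<close> in its kernel: on orbit directions the derivative of \<^const>\<open>ext_trace\<close> vanishes,
so \<open>s = 0\<close>, and then \<open>X\<close> commutes with both matrices. Adding the trace of \<open>X\<close> as a
coordinate makes it an injective map between spaces of the dimension 33. So the derivative itself is onto, and
the map is open at the origin.\<close>

lemma conj_slice_open:
  assumes n: "normal_data \<alpha> \<beta> \<gamma> \<delta> w" and p0: "p0 = normal_pair \<alpha> \<beta> \<gamma> \<delta> w"
    and R: "bounded_linear R" "\<And>y. ext_trace_deriv p0 (R y) = y" and \<eta>: "0 < \<eta>"
  obtains N where "open N" "p0 \<in> N"
    "\<And>p. p \<in> N \<Longrightarrow> \<exists>g s. invertible g \<and> norm s < \<eta> \<and> p = conj_pair g (p0 + R s)"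
proof -
  obtain A B where AB: "p0 = (A, B)" by (cases p0)
  have SL: "A \<in> SL2H" "B \<in> SL2H"
    using regular_pairs_SL2H [OF normal_pair_regular [OF n]] AB p0 by auto
  define f where "f z = conj_pair (mat 1 + fst z) (p0 + R (snd z))" for z :: "mat2 \<times> (real^(15 + bool))"
  define f' where "f' z = (fst z ** A - A ** fst z, fst z ** B - B ** fst z) + R (snd z)" for z :: "mat2 \<times> (real^(15 + bool))"
  define S where "S = {z :: mat2 \<times> (real^(15 + bool)). sq_det (mat 1 + fst z) \<noteq> 0}"
  have S: "open S" "0 \<in> S"
    unfolding S_def
    by (intro open_Collect_neq continuous_on_const continuous_on_compose2 [OF continuous_sq_det [of UNIV]]
        continuous_intros) auto
  note R_cont = continuous_on_compose2 [OF linear_continuous_on [OF R(1), of UNIV]]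
  have cont: "continuous_on S f"
    unfolding f_def [abs_def] conj_pair_def
    by (intro continuous_on_Pair continuous_on_conj_by continuous_intros R_cont) (auto simp: S_def)
  have g: "((\<lambda>z :: mat2 \<times> (real^(15 + bool)). mat 1 + fst z) has_derivative fst) (at 0)"
    by (auto intro!: derivative_eq_intros)
  have q: "((\<lambda>z :: mat2 \<times> (real^(15 + bool)). p0 + R (snd z)) has_derivative (\<lambda>z. R (snd z))) (at 0)"
    using bounded_linear.has_derivative [OF R(1) has_derivative_snd [OF has_derivative_ident]]
    by (auto intro!: derivative_eq_intros)
  have R0: "R 0 = 0"
    by (rule linear_0 [OF bounded_linear.linear [OF R(1)]])
  have der: "(f has_derivative f') (at 0)"
  proof -
    have g1: "mat 1 + fst (0 :: mat2 \<times> (real^(15 + bool))) = mat 1"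
      by simp
    have "(f has_derivative (\<lambda>h. (fst h ** A - A ** fst h + fst (R (snd h)), fst h ** B - B ** fst h + snd (R (snd h))))) (at 0)"
      using has_derivative_Pair [OF has_derivative_conj_by [OF g g1 has_derivative_fst [OF q]]
          has_derivative_conj_by [OF g g1 has_derivative_snd [OF q]]]
      by (simp add: f_def [abs_def] conj_pair_def R0 AB)
    also have "(\<lambda>h. (fst h ** A - A ** fst h + fst (R (snd h)), fst h ** B - B ** fst h + snd (R (snd h)))) = f'"
      by (simp add: f'_def fun_eq_iff prod_eq_iff)
    finally show ?thesis .
  qed
  have lin: "linear f'"
    by (rule has_derivative_linear [OF der])
  define F where "F z = (f' z, tr2 (fst z))" for z
  have linF: "linear F"
  proof (rule linearI)
    note tr = bounded_linear.linear [OF bounded_linear_tr2]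
    show "F (x + y) = F x + F y" for x y
      by (simp only: F_def fst_add linear_add [OF lin] linear_add [OF tr] add_Pair)
    show "F (r *\<^sub>R x) = r *\<^sub>R F x" for r x
      by (simp only: F_def fst_scaleR linear_cmul [OF lin] linear_cmul [OF tr] scaleR_Pair real_scaleR_def)
  qed
  have linD: "linear (ext_trace_deriv p0)"
    by (rule has_derivative_linear [OF has_derivative_ext_trace])
  have "inj F"
    unfolding linear_injective_0 [OF linF]
  proof (intro allI impI)
    fix z assume "F z = 0"
    then have z: "(fst z ** A - A ** fst z, fst z ** B - B ** fst z) + R (snd z) = 0" "tr2 (fst z) = 0"
      by (simp_all add: F_def f'_def zero_prod_def)
    have "ext_trace_deriv p0 (fst z ** A - A ** fst z, fst z ** B - B ** fst z) = 0"
      unfolding AB by (rule ext_trace_deriv_orbit) (use SL in \<open>simp_all add: SL2H_invertible\<close>)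
    then have "ext_trace_deriv p0 ((fst z ** A - A ** fst z, fst z ** B - B ** fst z) + R (snd z)) = snd z"
      by (simp add: linear_add [OF linD] R(2))
    then have s0: "snd z = 0"
      unfolding z(1) using linear_0 [OF linD] by simp
    then have "fst z ** A = A ** fst z" "fst z ** B = B ** fst z"
      using z(1) R0 by (simp_all add: zero_prod_def)
    then obtain r where r: "fst z = r *\<^sub>R mat 1"
      using normal_pair_centraliser [OF n] AB p0 by metis
    then have "r = 0"
      using z(2) by (simp add: mat2_one)
    then show "z = 0"
      using r s0 by (simp add: prod_eq_iff)
  qed
  moreover have "dim (UNIV :: (mpair \<times> real) set) = dim (UNIV :: (mat2 \<times> (real^(15 + bool))) set)"
    by (simp add: dim_UNIV DIM_quat)
  ultimately have "surj F"
    by (intro eucl.linear_injective_imp_surjective linF)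
  then have "surj f'"
    unfolding surj_def F_def by (metis fst_conv)
  then obtain g' where g': "bounded_linear g'" "f' \<circ> g' = id"
    using linear_surj_bounded_right_inverse [OF lin] by blast
  define T where "T = S \<inter> {z. norm (snd z) < \<eta>}"
  have T: "open T"
    unfolding T_def by (intro open_Int S(1) open_Collect_less continuous_intros)
  have "0 \<in> interior T"
    unfolding interior_open [OF T] using S(2) \<eta> by (simp add: T_def)
  then have "f 0 \<in> interior (f ` T)"
    by (rule sussmann_open_mapping [OF S(1) cont S(2) der g', rotated]) (simp add: T_def)
  moreover have "f 0 = p0"
    by (simp add: f_def R0)
  ultimately show thesis
  proof (intro that [of "interior (f ` T)"])
    fix p assume "p \<in> interior (f ` T)"
    then obtain z where "z \<in> T" "p = f z"
      using interior_subset by blast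
    then show "\<exists>g s. invertible g \<and> norm s < \<eta> \<and> p = conj_pair g (p0 + R s)"
      by (intro exI [of _ "mat 1 + fst z"] exI [of _ "snd z"]) (simp add: T_def S_def f_def invertible_iff_sq_det)
  qed simp_all
qed

text \<open>The section \<open>\<sigma>\<close> assigns to a vector of traces the pair on the slice with these traces and determinants 1.
A pair near \<open>p0\<close> is conjugate to a pair on the slice with the same \<^const>\<open>ext_trace\<close>, and
\<^const>\<open>ext_trace\<close> is injective on the slice: so its class is the one given by \<open>\<sigma>\<close>. Hence the classes
of the values of \<open>\<sigma>\<close> form an open set on which the traces are coordinates.\<close>

lemma normal_pair_chart:
  assumes n: "normal_data \<alpha> \<beta> \<gamma> \<delta> w" and p0: "p0 = normal_pair \<alpha> \<beta> \<gamma> \<delta> w"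
    and surj: "surj (ext_trace_deriv p0)"
  obtains U where "pair_class p0 \<in> U" "analytic_chart U trace_map"
proof -
  have linD: "linear (ext_trace_deriv p0)"
    by (rule has_derivative_linear [OF has_derivative_ext_trace])
  obtain R where R: "bounded_linear R" "\<And>y. ext_trace_deriv p0 (R y) = y"
    using linear_surj_bounded_right_inverse [OF linD surj] by blast
  define G where "G s = ext_trace (p0 + R s)" for s
  define L :: "real^15 \<Rightarrow> real^(15 + bool)"
    where "L t = (\<chi> i. case i of Inl j \<Rightarrow> t $ j | Inr b \<Rightarrow> 0)" for t
  define t0 where "t0 = trace_map (pair_class p0)"
  have SL: "fst p0 \<in> SL2H" "snd p0 \<in> SL2H"
    using regular_pairs_SL2H [OF normal_pair_regular [OF n]] p0 by auto
  have R0: "R 0 = 0"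
    by (rule linear_0 [OF bounded_linear.linear [OF R(1)]])
  have G0: "G 0 = slice_value t0"
    using ext_trace_SL2H_pair [OF SL] by (simp add: G_def R0 t0_def)
  have polyG: "polynomial_function G"
    unfolding G_def [abs_def]
    using polynomial_function_compose [OF polynomial_function_add [OF polynomial_function_const
          polynomial_function_bounded_linear [OF R(1)]] polynomial_ext_trace, of p0]
    by (simp add: o_def)
  have "((\<lambda>s. p0 + R s) has_derivative R) (at 0)"
    using bounded_linear_imp_has_derivative [OF R(1)] by (auto intro!: derivative_eq_intros)
  then have "(G has_derivative (\<lambda>s. ext_trace_deriv p0 (R s))) (at 0)"
    unfolding G_def [abs_def]
    by (rule has_derivative_compose) (simp add: R0 has_derivative_ext_trace)
  then have G': "(G has_derivative (\<lambda>s. s)) (at 0)"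
    by (simp add: R(2))
  have L: "bounded_linear L"
    unfolding linear_conv_bounded_linear [symmetric] L_def [abs_def]
    by (rule linearI) (auto simp: vec_eq_iff split: sum.split)
  obtain \<rho> \<eta> M s where s: "0 < \<rho>" "0 < \<eta>" "vec_series t0 \<rho> M s" "s t0 = 0"
    "\<And>t. t \<in> ball t0 \<rho> \<Longrightarrow> G (s t) = G 0 + L (t - t0) \<and> norm (s t) < \<eta>" "inj_on G (ball 0 \<eta>)"
    using analytic_right_inverse [OF polyG G' L] by blast
  define \<sigma> where "\<sigma> t = p0 + R (s t)" for t
  have \<sigma>_analytic: "real_analytic_at \<sigma> t" if "t \<in> ball t0 \<rho>" for t
    unfolding \<sigma>_def [abs_def] by (rule vec_series_affine_analytic [OF s(3) R(1) that])
  have \<sigma>_cont: "continuous_on (ball t0 \<rho>) \<sigma>"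
    by (intro continuous_at_imp_continuous_on ballI differentiable_imp_continuous_within
        real_analytic_at_differentiable \<sigma>_analytic)
  have \<sigma>_trace: "ext_trace (\<sigma> t) = slice_value t" if "t \<in> ball t0 \<rho>" for t
  proof -
    have "ext_trace (\<sigma> t) = G 0 + L (t - t0)"
      using s(5) [OF that] by (simp add: \<sigma>_def G_def)
    then show ?thesis
      by (auto simp: G0 slice_value_def L_def vec_eq_iff split: sum.split)
  qed
  obtain N1 where N1: "open N1" "p0 \<in> N1"
    "\<And>p. p \<in> N1 \<Longrightarrow> \<exists>g s. invertible g \<and> norm s < \<eta> \<and> p = conj_pair g (p0 + R s)"
    using conj_slice_open [OF n p0 R s(2)] by blast
  obtain N2 where N2: "open N2" "p0 \<in> N2"
    "\<And>p. p \<in> N2 \<Longrightarrow> fst p \<in> SL2H \<Longrightarrow> snd p \<in> SL2H \<Longrightarrow>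
      \<exists>P \<alpha>' \<beta>' \<gamma>' \<delta>' w'. P \<in> SL2H \<and> normal_data \<alpha>' \<beta>' \<gamma>' \<delta>' w' \<and> p = conj_pair P (normal_pair \<alpha>' \<beta>' \<gamma>' \<delta>' w')"
    using normal_pair_open [OF n] p0 by blast
  define N where "N = N1 \<inter> N2"
  have slice: "pair_class p = pair_class (\<sigma> (trace_map (pair_class p)))"
    if p: "p \<in> N" "fst p \<in> SL2H" "snd p \<in> SL2H" "trace_map (pair_class p) \<in> ball t0 \<rho>" for p
  proof -
    define t where "t = trace_map (pair_class p)"
    have "p \<in> N1"
      using p(1) by (simp add: N_def)
    from N1(3) [OF this] obtain g u where g: "invertible g" "norm u < \<eta>" "p = conj_pair g (p0 + R u)"
      by blast
    define q where "q = p0 + R u"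
    have q: "fst q \<in> SL2H" "snd q \<in> SL2H"
      using p(2,3) g by (simp_all add: q_def SL2H_conj_pair)
    have "p = (conj_by g (fst q), conj_by g (snd q))"
      by (simp only: g(3) q_def conj_pair_def)
    then have "ext_trace p = ext_trace q"
      by (simp only: ext_trace_conj_by [OF g(1) SL2H_invertible [OF q(1)] SL2H_invertible [OF q(2)]] prod.collapse)
    then have "G u = G (s t)"
      using ext_trace_SL2H_pair [OF p(2,3)] \<sigma>_trace p(4) by (simp add: G_def q_def t_def \<sigma>_def)
    then have "u = s t"
      by (rule inj_onD [OF s(6)]) (use g(2) s(5) p(4) in \<open>simp_all add: t_def\<close>)
    then show ?thesis
      using pair_class_conj [OF g(1)] by (simp add: g(3) \<sigma>_def t_def)
  qed
  define V where "V = ball t0 \<rho> \<inter> \<sigma> -` N"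
  have V: "open V"
    unfolding V_def N_def using continuous_open_preimage [OF \<sigma>_cont open_ball] N1(1) N2(1) by blast
  have t0V: "t0 \<in> V"
    using s(1,4) N1(2) N2(2) by (simp add: V_def N_def \<sigma>_def R0)
  have \<sigma>0: "\<sigma> t0 = p0"
    by (simp add: \<sigma>_def s(4) R0)
  have V_ball: "t \<in> ball t0 \<rho>" if "t \<in> V" for t
    using that by (simp add: V_def)
  have \<sigma>_reg: "\<sigma> t \<in> regular_pairs \<and> pair_class (\<sigma> t) \<in> Mreg_star" if "t \<in> V" for t
  proof -
    have "\<sigma> t \<in> N2" "fst (\<sigma> t) \<in> SL2H" "snd (\<sigma> t) \<in> SL2H"
      using that ext_trace_slice_value [OF \<sigma>_trace [OF V_ball [OF that]]] by (simp_all add: V_def N_def)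
    then obtain P \<alpha>' \<beta>' \<gamma>' \<delta>' w' where P: "P \<in> SL2H" "normal_data \<alpha>' \<beta>' \<gamma>' \<delta>' w'"
      "\<sigma> t = conj_pair P (normal_pair \<alpha>' \<beta>' \<gamma>' \<delta>' w')"
      using N2(3) by blast
    then show ?thesis
      using regular_conj_normal_pair [OF P(2,1)] normal_pair_Mreg_star [OF P(2)] pair_class_conj_SL2H [OF P(1)] by simp
  qed
  define U where "U = (\<lambda>t. pair_class (\<sigma> t)) ` V"
  have trace_\<sigma>: "trace_map (pair_class (\<sigma> t)) = t" if "t \<in> V" for t
    by (rule ext_trace_slice_value(3) [OF \<sigma>_trace [OF V_ball [OF that]]])
  have inj: "inj_on trace_map U"
    by (auto simp: U_def inj_on_def trace_\<sigma>)
  have image: "trace_map ` U = V"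
    by (auto simp: U_def trace_\<sigma> image_image)
  have tr_open: "open {p. (\<chi> j. ext_trace p $ Inl j) \<in> V}"
  proof -
    have "continuous_on UNIV ext_trace"
      by (rule continuous_on_polymonial_function [OF polynomial_ext_trace])
    then have "continuous_on UNIV (\<lambda>p. \<chi> j. ext_trace p $ Inl j)"
      by (intro continuous_on_vec_lambda continuous_on_component)
    from open_vimage [OF V this] show ?thesis
      by (simp add: vimage_def)
  qed
  note tr_eq = trace_map_ext_trace [symmetric]
  have "openin (top_of_set regular_pairs) {p \<in> regular_pairs. pair_class p \<in> U}"
  proof (subst openin_subopen, intro ballI)
    fix p assume p: "p \<in> {p \<in> regular_pairs. pair_class p \<in> U}"
    then obtain t where t: "t \<in> V" "pair_class p = pair_class (\<sigma> t)"
      by (auto simp: U_def)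
    obtain P where P: "P \<in> SL2H" "\<sigma> t = conj_pair P p"
      using pair_class_eqD [OF t(2) [symmetric]] by blast
    define W where "W = conj_pair P -` N \<inter> {p. (\<chi> j. ext_trace p $ Inl j) \<in> V}"
    have "continuous_on UNIV (conj_pair P)"
      unfolding conj_pair_def [abs_def]
      by (intro continuous_on_Pair continuous_on_compose2 [OF linear_continuous_on [OF bounded_linear_conj_by, of UNIV]]
          continuous_intros) auto
    then have W: "open W"
      unfolding W_def N_def using N1(1) N2(1) tr_open by (intro open_Int open_vimage) auto
    have pW: "p \<in> W"
      using p t P(2) tr_eq [of p] trace_\<sigma> [OF t(1)] by (auto simp: W_def V_def)
    have "regular_pairs \<inter> W \<subseteq> {p \<in> regular_pairs. pair_class p \<in> U}"
    proof
      fix p' assume p': "p' \<in> regular_pairs \<inter> W"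
      define q where "q = conj_pair P p'"
      have Pi: "invertible P" by (rule SL2H_invertible [OF P(1)])
      have pc: "pair_class q = pair_class p'"
        unfolding q_def by (rule pair_class_conj_SL2H [OF P(1)])
      have tV: "trace_map (pair_class p') \<in> V"
        using p' tr_eq [of p'] by (auto simp: W_def)
      have "pair_class q = pair_class (\<sigma> (trace_map (pair_class q)))"
      proof (rule slice)
        show "q \<in> N" using p' by (simp add: W_def q_def)
        show "fst q \<in> SL2H" "snd q \<in> SL2H"
          using p' regular_pairs_SL2H [of p'] by (simp_all add: q_def SL2H_conj_pair [OF Pi])
        show "trace_map (pair_class q) \<in> ball t0 \<rho>"
          using V_ball [OF tV] by (simp only: pc)
      qed
      then have "pair_class p' \<in> U"
        using tV by (simp only: pc U_def image_eqI)
      with p' show "p' \<in> {p \<in> regular_pairs. pair_class p \<in> U}" by simp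
    qed
    then show "\<exists>T. openin (top_of_set regular_pairs) T \<and> p \<in> T \<and> T \<subseteq> {p \<in> regular_pairs. pair_class p \<in> U}"
      using openin_open_Int [OF W, of regular_pairs] pW p by blast
  qed
  moreover have "U \<subseteq> Mreg"
    using \<sigma>_reg by (auto simp: U_def Mreg_def)
  ultimately have openU: "openin Mreg_top U"
    by (simp add: openin_Mreg_top)
  have U_star: "U \<subseteq> Mreg_star"
    using \<sigma>_reg by (auto simp: U_def)
  have "analytic_chart U trace_map"
    unfolding analytic_chart_def
  proof (intro conjI ballI)
    show "openin Mreg_star_top U"
      unfolding Mreg_star_top_def using openin_subtopology_Int [OF openU, of Mreg_star] U_star by (simp add: Int_absorb2)
    show "inj_on trace_map U" by (rule inj)
    show "open (trace_map ` U)" unfolding image by (rule V)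
    show "real_analytic_on (\<lambda>p. trace_map (pair_class p)) {p \<in> regular_pairs. pair_class p \<in> U}"
      unfolding real_analytic_on_def
    proof
      fix x assume "x \<in> {p \<in> regular_pairs. pair_class p \<in> U}"
      have "bounded_linear (\<lambda>v :: real^(15 + bool). (\<chi> j. v $ Inl j) :: real^15)"
        unfolding linear_conv_bounded_linear [symmetric] by (rule linearI) (simp_all add: vec_eq_iff)
      from polynomial_function_linear_image [OF this polynomial_ext_trace]
      have "real_analytic_at (\<lambda>p. (\<chi> j. ext_trace p $ Inl j) :: real^15) y" for y
        by (rule polynomial_real_analytic_at)
      then show "\<exists>N g. open N \<and> x \<in> N \<and> (\<forall>y\<in>N. real_analytic_at g y) \<and>
          (\<forall>y\<in>N \<inter> {p \<in> regular_pairs. pair_class p \<in> U}. g y = trace_map (pair_class y))"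
        by (intro exI [of _ UNIV] exI [of _ "\<lambda>p. \<chi> j. ext_trace p $ Inl j"]) (simp add: tr_eq)
    qed
    fix y assume "y \<in> trace_map ` U"
    then have y: "y \<in> V" by (simp add: image)
    have "real_analytic_on \<sigma> V"
      unfolding real_analytic_on_def
    proof
      fix x assume x: "x \<in> V"
      show "\<exists>N g. open N \<and> x \<in> N \<and> (\<forall>y\<in>N. real_analytic_at g y) \<and> (\<forall>y\<in>N \<inter> V. g y = \<sigma> y)"
        by (rule exI [of _ V], rule exI [of _ \<sigma>]) (use V x \<sigma>_analytic V_ball in blast)
    qed
    moreover have "pair_class (\<sigma> z) = inv_into U trace_map z" if "z \<in> V" for z
    proof -
      have "pair_class (\<sigma> z) \<in> U"
        using that by (auto simp: U_def)
      from inv_into_f_f [OF inj this] show ?thesis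
        by (simp add: trace_\<sigma> [OF that])
    qed
    ultimately show "\<exists>V \<sigma>. open V \<and> y \<in> V \<and> V \<subseteq> trace_map ` U \<and> real_analytic_on \<sigma> V \<and>
        (\<forall>z\<in>V. \<sigma> z \<in> regular_pairs \<and> pair_class (\<sigma> z) = inv_into U trace_map z)"
      using V y \<sigma>_reg unfolding image by (intro exI [of _ V] exI [of _ \<sigma>]) simp
  qed
  moreover have "pair_class p0 \<in> U"
    using t0V \<sigma>0 unfolding U_def by (metis image_eqI)
  ultimately show thesis
    using that by blast
qed

section \<open>Change of charts and density\<close>

lemma real_analytic_on_differentiable:
  fixes f :: "'a::euclidean_space \<Rightarrow> 'b::euclidean_space"
  assumes "real_analytic_on f S" "open S" "x \<in> S"
  shows "f differentiable (at x)"
proof -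
  have "\<exists>N g. open N \<and> x \<in> N \<and> (\<forall>y\<in>N. real_analytic_at g y) \<and> (\<forall>y\<in>N \<inter> S. g y = f y)"
    using assms(1) unfolding real_analytic_on_def by (rule bspec) (rule assms(3))
  then obtain N g where N: "open N" "x \<in> N" "\<forall>y\<in>N. real_analytic_at g y" "\<forall>y\<in>N \<inter> S. g y = f y"
    by (elim exE conjE)
  obtain g' where "(g has_derivative g') (at x)"
    using real_analytic_at_differentiable [OF bspec [OF N(3,2)]] unfolding differentiable_def by blast
  then have "(f has_derivative g') (at x)"
    by (rule has_derivative_transform_within_open [OF _ open_Int [OF N(1) assms(2)]]) (use N(2,4) assms(3) in simp_all)
  then show ?thesis
    unfolding differentiable_def by blast
qed

lemma analytic_chart_section:
  assumes "analytic_chart U \<phi>" "m \<in> U"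
  shows "\<exists>V \<sigma>. open V \<and> \<phi> m \<in> V \<and> V \<subseteq> \<phi> ` U \<and> (\<forall>z\<in>V. \<sigma> differentiable (at z)) \<and>
    (\<forall>z\<in>V. \<sigma> z \<in> regular_pairs) \<and> (\<forall>z\<in>V. pair_class (\<sigma> z) = inv_into U \<phi> z)"
proof -
  have "\<phi> m \<in> \<phi> ` U"
    using assms(2) by (rule imageI)
  with assms(1) have "\<exists>V \<sigma>. open V \<and> \<phi> m \<in> V \<and> V \<subseteq> \<phi> ` U \<and> real_analytic_on \<sigma> V \<and>
      (\<forall>z\<in>V. \<sigma> z \<in> regular_pairs \<and> pair_class (\<sigma> z) = inv_into U \<phi> z)"
    unfolding analytic_chart_def by (elim conjE) (rule bspec)
  then obtain V \<sigma> where V: "open V" "\<phi> m \<in> V" "V \<subseteq> \<phi> ` U" "real_analytic_on \<sigma> V"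
    "\<forall>z\<in>V. \<sigma> z \<in> regular_pairs \<and> pair_class (\<sigma> z) = inv_into U \<phi> z"
    by (elim exE conjE)
  show ?thesis
    by (rule exI [of _ V], rule exI [of _ \<sigma>]) (use V real_analytic_on_differentiable [OF V(4,1)] in simp)
qed

text \<open>Let \<open>H\<close> express the traces in a given chart, and let \<open>K\<close> be the inverse change of coordinates. Both are
differentiable because each chart has local sections into the space of pairs and is analytic on that space.
From \<open>H \<circ> K = id\<close> the derivative of \<open>H\<close> is onto, so its components are independent.\<close>

lemma chart_independent_differentials:
  assumes m: "m \<in> U" and U: "analytic_chart U trace_map"
  shows "independent_differentials_at (map trace_fun trace_words) m"
proof -
  define fs where "fs = map trace_fun trace_words"
  have "length trace_words = 15"
    by (simp add: trace_words_def)
  then have len: "length fs = 15" and fs: "\<And>n. n < 15 \<Longrightarrow> fs ! n = trace_fun (trace_words ! n)"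
    by (simp_all add: fs_def)
  have main: "\<exists>D. (\<forall>n<15. ((\<lambda>y. (fs ! n) (inv_into S \<phi> y)) has_derivative D n) (at (\<phi> m))) \<and>
      (\<forall>c :: nat \<Rightarrow> real. (\<forall>v. (\<Sum>n<15. c n * D n v) = 0) \<longrightarrow> (\<forall>n<15. c n = 0))"
    if S: "m \<in> S" "analytic_chart S \<phi>" for S \<phi>
  proof -
    define t where "t = trace_map m"
    obtain V \<sigma> where V: "open V" "\<phi> m \<in> V" "V \<subseteq> \<phi> ` S" "\<forall>z\<in>V. \<sigma> differentiable (at z)"
      "\<forall>z\<in>V. \<sigma> z \<in> regular_pairs" "\<forall>z\<in>V. pair_class (\<sigma> z) = inv_into S \<phi> z"
      using analytic_chart_section [OF S(2,1)] by (elim exE conjE)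
    obtain V' \<tau> where V': "open V'" "t \<in> V'" "V' \<subseteq> trace_map ` U" "\<forall>z\<in>V'. \<tau> differentiable (at z)"
      "\<forall>z\<in>V'. \<tau> z \<in> regular_pairs" "\<forall>z\<in>V'. pair_class (\<tau> z) = inv_into U trace_map z"
      using analytic_chart_section [OF U m, folded t_def] by (elim exE conjE)
    note V = V(1-3) V(4-6) [rule_format]
    note V' = V'(1-3) V'(4-6) [rule_format]
    define H where "H z = trace_map (inv_into S \<phi> z)" for z
    define K where "K z = \<phi> (inv_into U trace_map z)" for z
    have inj: "inj_on \<phi> S" "inj_on trace_map U"
      using S(2) U by (simp_all add: analytic_chart_def)
    have inv_t: "inv_into U trace_map t = m"
      unfolding t_def by (rule inv_into_f_f [OF inj(2) m])
    have pair_t: "pair_class (\<tau> t) = m"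
      using V'(6) [OF V'(2)] inv_t by simp
    have Kt: "K t = \<phi> m"
      by (simp add: K_def inv_t)
    \<comment> \<open>\<open>H\<close> is differentiable because the traces are polynomial in the entries of the pair.\<close>
    obtain H' where H': "(H has_derivative H') (at (\<phi> m))"
    proof -
      obtain \<sigma>' where "(\<sigma> has_derivative \<sigma>') (at (\<phi> m))"
        using V(4) [OF V(2)] unfolding differentiable_def by blast
      then have 1: "((\<lambda>z. ext_trace (\<sigma> z)) has_derivative (\<lambda>v. ext_trace_deriv (\<sigma> (\<phi> m)) (\<sigma>' v))) (at (\<phi> m))"
        by (rule has_derivative_compose) (rule has_derivative_ext_trace)
      have bl: "bounded_linear (\<lambda>v :: real^(15 + bool). (\<chi> j. v $ Inl j) :: real^15)"
        unfolding linear_conv_bounded_linear [symmetric] by (rule linearI) (simp_all add: vec_eq_iff)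
      show thesis
      proof (rule that, rule has_derivative_transform_within_open [OF bounded_linear.has_derivative [OF bl 1] V(1,2)])
        fix z assume "z \<in> V"
        then show "(\<chi> j. ext_trace (\<sigma> z) $ Inl j) = H z"
          by (simp add: H_def V(6) [symmetric] trace_map_ext_trace [OF V(5)])
      qed
    qed
    have "openin Mreg_star_top S" "openin Mreg_star_top U"
      using S(2) U by (simp_all add: analytic_chart_def)
    then obtain W where W: "openin Mreg_top W" "S = W \<inter> Mreg_star"
      unfolding Mreg_star_top_def openin_subtopology by blast
    then obtain O1 where O1: "open O1" "{p \<in> regular_pairs. pair_class p \<in> W} = regular_pairs \<inter> O1"
      unfolding openin_Mreg_top openin_open by blast
    have U_star: "U \<subseteq> Mreg_star"
      using openin_subset [OF \<open>openin Mreg_star_top U\<close>] by (simp add: Mreg_star_top_def)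
    obtain O2 g where O2: "open O2" "\<tau> t \<in> O2" "\<And>p. p \<in> O2 \<Longrightarrow> real_analytic_at g p"
      "\<And>p. p \<in> O2 \<inter> {p \<in> regular_pairs. pair_class p \<in> S} \<Longrightarrow> g p = \<phi> (pair_class p)"
    proof -
      have "\<tau> t \<in> {p \<in> regular_pairs. pair_class p \<in> S}"
        using V'(5) [OF V'(2)] pair_t S(1) by simp
      with S(2) have "\<exists>N g. open N \<and> \<tau> t \<in> N \<and> (\<forall>y\<in>N. real_analytic_at g y) \<and>
          (\<forall>y\<in>N \<inter> {p \<in> regular_pairs. pair_class p \<in> S}. g y = \<phi> (pair_class y))"
        unfolding analytic_chart_def real_analytic_on_def by (elim conjE) (rule bspec)
      then show thesis
        by (elim exE conjE) (rule that, assumption+, erule (1) bspec, erule (1) bspec)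
    qed
    define V2 where "V2 = V' \<inter> \<tau> -` (O1 \<inter> O2)"
    have \<tau>_cont: "continuous_on V' \<tau>"
      by (intro continuous_at_imp_continuous_on ballI differentiable_imp_continuous_within V'(4))
    have V2: "open V2"
      unfolding V2_def by (rule continuous_open_preimage [OF \<tau>_cont V'(1)]) (intro open_Int O1(1) O2(1))
    have tV2: "t \<in> V2"
    proof -
      have "\<tau> t \<in> {p \<in> regular_pairs. pair_class p \<in> W}"
        using V'(5) [OF V'(2)] pair_t S(1) W(2) by simp
      then show ?thesis
        using O1(2) O2(2) V'(2) by (simp add: V2_def)
    qed
    have inS: "inv_into U trace_map z \<in> S" if "z \<in> V2" for z
    proof -
      have z: "z \<in> V'" "\<tau> z \<in> O1"
        using that by (simp_all add: V2_def)
      then have "\<tau> z \<in> {p \<in> regular_pairs. pair_class p \<in> W}"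
        unfolding O1(2) using V'(5) by simp
      then have "inv_into U trace_map z \<in> W"
        using V'(6) [OF z(1)] by simp
      moreover have "inv_into U trace_map z \<in> Mreg_star"
        using inv_into_into [of z trace_map U] V'(3) z(1) U_star by blast
      ultimately show ?thesis
        by (simp add: W(2))
    qed
    obtain K' where K': "(K has_derivative K') (at t)"
    proof -
      obtain \<tau>' where \<tau>': "(\<tau> has_derivative \<tau>') (at t)"
        using V'(4) [OF V'(2)] unfolding differentiable_def by blast
      obtain g' where g': "(g has_derivative g') (at (\<tau> t))"
        using real_analytic_at_differentiable [OF O2(3) [OF O2(2)]] unfolding differentiable_def by blast
      show thesis
      proof (rule that, rule has_derivative_transform_within_open [OF has_derivative_compose [OF \<tau>' g'] V2 tV2])
        fix z assume z: "z \<in> V2"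
        then have z': "z \<in> V'" "\<tau> z \<in> O2"
          by (simp_all add: V2_def)
        have "g (\<tau> z) = \<phi> (pair_class (\<tau> z))"
          by (rule O2(4)) (use z' inS [OF z] V'(5,6) in simp)
        then show "g (\<tau> z) = K z"
          by (simp add: K_def V'(6) [OF z'(1)])
      qed
    qed
    have "((\<lambda>z. H (K z)) has_derivative (\<lambda>v. H' (K' v))) (at t)"
      by (rule has_derivative_compose [OF K']) (simp add: Kt H')
    moreover have "((\<lambda>z. H (K z)) has_derivative (\<lambda>v. v)) (at t)"
    proof (rule has_derivative_transform_within_open [OF has_derivative_ident V2 tV2])
      fix z assume z: "z \<in> V2"
      then have "z \<in> trace_map ` U"
        using V'(3) by (auto simp: V2_def)
      then show "z = H (K z)"
        by (simp add: H_def K_def inv_into_f_f [OF inj(1) inS [OF z]] f_inv_into_f)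
    qed
    ultimately have HK: "H' (K' v) = v" for v
      by (metis has_derivative_unique)
    define j where "j n = inv word_index n" for n
    have word_j: "word_index (j n) = n" if "n < 15" for n
      unfolding j_def by (rule word_index_inverse [OF that])
    define D where "D n v = H' v $ j n" for n v
    have "((\<lambda>y. (fs ! n) (inv_into S \<phi> y)) has_derivative D n) (at (\<phi> m))" if "n < 15" for n
      using bounded_linear.has_derivative [OF bounded_linear_vec_nth H', of "j n"]
      by (simp add: D_def [abs_def] H_def trace_map_nth word_j [OF that] fs [OF that])
    moreover have "c n = 0" if c: "\<And>v. (\<Sum>n<15. c n * D n v) = 0" and n: "n < 15" for c n
    proof -
      have j_eq: "j k = j n \<longleftrightarrow> k = n" if "k < 15" for k
        using arg_cong [of "j k" "j n" word_index] unfolding word_j [OF that] word_j [OF n] by blast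
      have "D k (K' (axis (j n) 1)) = (if k = n then 1 else 0)" if "k < 15" for k
        unfolding D_def HK axis_def vec_lambda_beta using j_eq [OF that] by simp
      then have "(\<Sum>k<15. c k * D k (K' (axis (j n) 1))) = (\<Sum>k<15. if k = n then c k else 0)"
        by (intro sum.cong refl) simp
      also have "\<dots> = c n"
        using n by simp
      finally show ?thesis
        unfolding c by simp
    qed
    ultimately show ?thesis
      by (intro exI [of _ D] conjI allI impI) simp_all
  qed
  show ?thesis
    unfolding independent_differentials_at_def fs_def [symmetric] len
  proof (intro conjI allI impI)
    show "\<exists>U \<phi>. m \<in> U \<and> analytic_chart U \<phi>"
      using m U by (intro exI conjI)
  qed (erule conjE, rule main)
qed

theorem theorem1p3:
  shows "\<exists>\<D>. openin Mreg_star_top \<D> \<and> Mreg_star_top closure_of \<D> = Mreg_star \<and>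
    (\<forall>m\<in>\<D>. independent_differentials_at (map trace_fun trace_words) m) \<and>
    (\<forall>m\<in>\<D>. local_analytic_diffeo_at trace_map m)"
proof (intro exI conjI ballI)
  let ?D = "\<Union>{U. analytic_chart U trace_map}"
  show "openin Mreg_star_top ?D"
    by (rule openin_Union) (simp add: analytic_chart_def)
  have "Mreg_star \<subseteq> Mreg"
    by (auto simp: Mreg_star_def Mreg_def)
  moreover have "topspace Mreg_top = Mreg"
  proof (rule subset_antisym)
    show "topspace Mreg_top \<subseteq> Mreg"
      using openin_topspace [of Mreg_top] unfolding openin_Mreg_top by blast
    have "{p \<in> regular_pairs. pair_class p \<in> Mreg} = regular_pairs"
      by (auto simp: Mreg_def)
    then have "openin Mreg_top Mreg"
      unfolding openin_Mreg_top by simp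
    then show "Mreg \<subseteq> topspace Mreg_top"
      by (rule openin_subset)
  qed
  ultimately have space: "topspace Mreg_star_top = Mreg_star"
    by (auto simp: Mreg_star_top_def)
  show "Mreg_star_top closure_of ?D = Mreg_star"
  proof (rule subset_antisym)
    show "Mreg_star_top closure_of ?D \<subseteq> Mreg_star"
      using closure_of_subset_topspace [of Mreg_star_top] space by simp
    show "Mreg_star \<subseteq> Mreg_star_top closure_of ?D"
    proof
      fix m assume m: "m \<in> Mreg_star"
      have "\<exists>y. y \<in> ?D \<and> y \<in> T" if T: "m \<in> T" "openin Mreg_star_top T" for T
      proof -
        obtain W where W: "openin Mreg_top W" "T = W \<inter> Mreg_star"
          using T(2) unfolding Mreg_star_top_def openin_subtopology by blast
        then obtain N where N: "open N" "{p \<in> regular_pairs. pair_class p \<in> W} = regular_pairs \<inter> N"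
          unfolding openin_Mreg_top openin_open by blast
        obtain \<alpha> \<beta> \<gamma> \<delta> w where n: "normal_data \<alpha> \<beta> \<gamma> \<delta> w" "m = pair_class (normal_pair \<alpha> \<beta> \<gamma> \<delta> w)"
          using Mreg_star_cases [OF m] .
        have "normal_pair \<alpha> \<beta> \<gamma> \<delta> w \<in> {p \<in> regular_pairs. pair_class p \<in> W}"
          using normal_pair_regular [OF n(1)] n(2) T(1) W(2) by simp
        then have "normal_pair \<alpha> \<beta> \<gamma> \<delta> w \<in> N"
          unfolding N(2) by simp
        from normal_pair_dense [OF n(1) N(1) this] obtain \<alpha>' \<beta>' \<gamma>' \<delta>' w' where n':
          "normal_data \<alpha>' \<beta>' \<gamma>' \<delta>' w'" "normal_pair \<alpha>' \<beta>' \<gamma>' \<delta>' w' \<in> N"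
          "surj (ext_trace_deriv (normal_pair \<alpha>' \<beta>' \<gamma>' \<delta>' w'))" .
        have "normal_pair \<alpha>' \<beta>' \<gamma>' \<delta>' w' \<in> {p \<in> regular_pairs. pair_class p \<in> W}"
          unfolding N(2) using n'(2) normal_pair_regular [OF n'(1)] by simp
        then have "pair_class (normal_pair \<alpha>' \<beta>' \<gamma>' \<delta>' w') \<in> T"
          using normal_pair_Mreg_star [OF n'(1)] W(2) by simp
        moreover have "pair_class (normal_pair \<alpha>' \<beta>' \<gamma>' \<delta>' w') \<in> ?D"
          using normal_pair_chart [OF n'(1) refl n'(3)] by blast
        ultimately show ?thesis
          by blast
      qed
      then show "m \<in> Mreg_star_top closure_of ?D"
        unfolding in_closure_of space using m by blast
    qed
  qed
  fix m assume "m \<in> ?D"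
  then obtain U where U: "m \<in> U" "analytic_chart U trace_map"
    by blast
  show "independent_differentials_at (map trace_fun trace_words) m"
    by (rule chart_independent_differentials [OF U])
  show "local_analytic_diffeo_at trace_map m"
    unfolding local_analytic_diffeo_at_def using U by blast
qed

end
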